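(* Assume that the root system $R$ is of type $\mathsf{A}$. Then there are tensor product decompositions $$\mathcal{B}_W=\mathcal{N}_W\otimes\mathcal{B}_W'=\mathcal{B}_W'\otimes\mathcal{N}_W,$$ i.e. the multiplication maps $\mathcal{N}_W\otimes\mathcal{B}_W'\to\mathcal{B}_W$ and $\mathcal{B}_W'\otimes\mathcal{N}_W\to\mathcal{B}_W$ are isomorphisms of vector spaces.
   Context: $\mathbf{k}$ is an arbitrary field; $(W,S)$ is a finite Coxeter system with $W\neq 1$; $R$ is its root system in the geometric representation, $\Delta$ the set of simple roots, $R^+$ the set of positive roots, $s_\alpha$ the reflection of a root $\alpha$. Here $R$ is of type $\mathsf{A}$, so $W$ is a symmetric group with $S$ the adjacent transpositions. $V_W$ is the Yetter-Drinfeld $W$-module over $\mathbf{k}$ spanned by symbols $x_\alpha$ ($\alpha\in R$) subject only to the linear relations $x_{-\alpha}=-x_\alpha$, with action $wx_\alpha=x_{w(\alpha)}$ and with $x_\alpha$ of $W$-degree $s_\alpha$; the braiding of Yetter-Drinfeld $W$-modules is $\Psi(v\otimes u)=gu\otimes v$ for $v$ of $W$-degree $g$. $\mathcal{B}_W$ is the Nichols algebra of $V_W$: the (unique up to isomorphism) braided $\mathbb{Z}_{\geq 0}$-graded Hopf algebra in the category of Yetter-Drinfeld $W$-modules which is connected (degree-zero component $\mathbf{k}1$), generated as an algebra in degree one, and whose primitive elements are exactly its degree-one component $V_W$. $\mathcal{N}_W$ (the nilCoxeter algebra) is the subalgebra of $\mathcal{B}_W$ generated by $x_\beta$, $\beta\in\Delta$.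 $\mathcal{B}_W'$ is the subalgebra of $\mathcal{B}_W$ generated by $x_\alpha$, $\alpha\in R^+\setminus\Delta$. *)

theory Defs
  imports Complex_Main "HOL-Algebra.Sym_Groups" "HOL-Library.Function_Algebras"
begin

section \<open>Tensor products of vector spaces\<close>

definition bilinear_map ::
  "('k::field \<Rightarrow> 'a::ab_group_add \<Rightarrow> 'a) \<Rightarrow> ('k \<Rightarrow> 'c::ab_group_add \<Rightarrow> 'c) \<Rightarrow>
   ('k \<Rightarrow> 'd::ab_group_add \<Rightarrow> 'd) \<Rightarrow> ('a \<Rightarrow> 'c \<Rightarrow> 'd) \<Rightarrow> bool"
  where "bilinear_map s1 s2 s3 \<beta> \<longleftrightarrow>
    (\<forall>a. Vector_Spaces.linear s2 s3 (\<beta> a)) \<and>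
    (\<forall>c. Vector_Spaces.linear s1 s3 (\<lambda>a. \<beta> a c))"

definition trilinear_form ::
  "('k::field \<Rightarrow> 'a::ab_group_add \<Rightarrow> 'a) \<Rightarrow> ('a \<Rightarrow> 'a \<Rightarrow> 'a \<Rightarrow> 'k) \<Rightarrow> bool"
  where "trilinear_form s \<tau> \<longleftrightarrow>
    (\<forall>a b. Vector_Spaces.linear s (*) (\<lambda>c. \<tau> a b c)) \<and>
    (\<forall>a c. Vector_Spaces.linear s (*) (\<lambda>b. \<tau> a b c)) \<and>
    (\<forall>b c. Vector_Spaces.linear s (*) (\<lambda>a. \<tau> a b c))"

text \<open>
  The tensor product of two vector spaces over \<open>'k\<close> is realised inside the dual of the space of
  bilinear forms: \<open>a \<otimes> c\<close> is the evaluation \<open>\<beta> \<mapsto> \<beta> a c\<close>, and the tensor product is the linear span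
  of these elements. (The value on functions that are not bilinear forms is irrelevant and set
  to 0.) Over a field this is a model of the tensor product: the universal property is
  \<open>tens_universal\<close> below. It is proved there for subspaces, so that for subspaces \<open>A\<close> and \<open>C\<close> the
  span \<open>tensor_space s1 s2 A C\<close> of the \<open>a \<otimes> c\<close> with \<open>a \<in> A\<close>, \<open>c \<in> C\<close> is a tensor product of \<open>A\<close>
  and \<open>C\<close>.
\<close>

definition tens ::
  "('k::field \<Rightarrow> 'a::ab_group_add \<Rightarrow> 'a) \<Rightarrow> ('k \<Rightarrow> 'c::ab_group_add \<Rightarrow> 'c) \<Rightarrow>
   'a \<Rightarrow> 'c \<Rightarrow> ('a \<Rightarrow> 'c \<Rightarrow> 'k) \<Rightarrow> 'k"
  where "tens s1 s2 a c = (\<lambda>\<beta>. if bilinear_map s1 s2 (*) \<beta> then \<beta> a c else 0)"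

definition tens3 ::
  "('k::field \<Rightarrow> 'a::ab_group_add \<Rightarrow> 'a) \<Rightarrow> 'a \<Rightarrow> 'a \<Rightarrow> 'a \<Rightarrow> ('a \<Rightarrow> 'a \<Rightarrow> 'a \<Rightarrow> 'k) \<Rightarrow> 'k"
  where "tens3 s a b c = (\<lambda>\<tau>. if trilinear_form s \<tau> then \<tau> a b c else 0)"

definition fscale :: "'k::field \<Rightarrow> ('x \<Rightarrow> 'k) \<Rightarrow> 'x \<Rightarrow> 'k"
  where "fscale r t = (\<lambda>\<beta>. r * t \<beta>)"

definition tensor_space ::
  "('k::field \<Rightarrow> 'a::ab_group_add \<Rightarrow> 'a) \<Rightarrow> ('k \<Rightarrow> 'c::ab_group_add \<Rightarrow> 'c) \<Rightarrow>
   'a set \<Rightarrow> 'c set \<Rightarrow> (('a \<Rightarrow> 'c \<Rightarrow> 'k) \<Rightarrow> 'k) set"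
  where "tensor_space s1 s2 A C = module.span fscale {tens s1 s2 a c | a c. a \<in> A \<and> c \<in> C}"

text \<open>
  The linear map induced by a bilinear map \<open>\<beta>\<close>. It is determined by \<open>\<beta>\<close> on
  \<open>tensor_space s1 s2 UNIV UNIV\<close>; no other values are ever used.
\<close>

definition tlift ::
  "('k::field \<Rightarrow> 'a::ab_group_add \<Rightarrow> 'a) \<Rightarrow> ('k \<Rightarrow> 'c::ab_group_add \<Rightarrow> 'c) \<Rightarrow>
   ('k \<Rightarrow> 'd::ab_group_add \<Rightarrow> 'd) \<Rightarrow> ('a \<Rightarrow> 'c \<Rightarrow> 'd) \<Rightarrow> (('a \<Rightarrow> 'c \<Rightarrow> 'k) \<Rightarrow> 'k) \<Rightarrow> 'd"
  where "tlift s1 s2 s3 \<beta> =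
    (SOME L. Vector_Spaces.linear fscale s3 L \<and> (\<forall>a c. L (tens s1 s2 a c) = \<beta> a c))"

lemma vector_space_fscale: "vector_space (fscale :: 'k::field \<Rightarrow> ('x \<Rightarrow> 'k) \<Rightarrow> _)"
  by unfold_locales (auto simp: fscale_def fun_eq_iff algebra_simps)

lemma vector_space_field: "vector_space ((*) :: 'k::field \<Rightarrow> _)"
  by unfold_locales (auto simp: algebra_simps)

lemma linearI':
  assumes "vector_space s1" "vector_space s2"
    and "\<And>x y. f (x + y) = f x + f y" "\<And>r x. f (s1 r x) = s2 r (f x)"
  shows "Vector_Spaces.linear s1 s2 f"
  using assms unfolding Vector_Spaces.linear_def module_hom_def module_hom_axioms_def
  by (auto simp: module_iff_vector_space)

lemma bilinear_mapD:
  assumes "bilinear_map s1 s2 s3 \<beta>"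
  shows "\<beta> (a + a') c = \<beta> a c + \<beta> a' c" "\<beta> a (c + c') = \<beta> a c + \<beta> a c'"
    "\<beta> (s1 r a) c = s3 r (\<beta> a c)" "\<beta> a (s2 r c) = s3 r (\<beta> a c)"
proof -
  interpret l: Vector_Spaces.linear s2 s3 "\<beta> a" for a
    using assms by (auto simp: bilinear_map_def)
  interpret r: Vector_Spaces.linear s1 s3 "\<lambda>a. \<beta> a c" for c
    using assms by (auto simp: bilinear_map_def)
  show "\<beta> (a + a') c = \<beta> a c + \<beta> a' c" "\<beta> a (c + c') = \<beta> a c + \<beta> a c'"
    "\<beta> (s1 r a) c = s3 r (\<beta> a c)" "\<beta> a (s2 r c) = s3 r (\<beta> a c)"
    by (auto simp: l.add l.scale r.add r.scale)
qed

lemma bilinear_mapI: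
  assumes "vector_space s1" "vector_space s2" "vector_space s3"
    and "\<And>a a' c. \<beta> (a + a') c = \<beta> a c + \<beta> a' c" "\<And>a c c'. \<beta> a (c + c') = \<beta> a c + \<beta> a c'"
    "\<And>r a c. \<beta> (s1 r a) c = s3 r (\<beta> a c)" "\<And>r a c. \<beta> a (s2 r c) = s3 r (\<beta> a c)"
  shows "bilinear_map s1 s2 s3 \<beta>"
  using assms by (auto simp: bilinear_map_def intro!: linearI')

lemma bilinear_tens:
  assumes "vector_space s1" "vector_space s2"
  shows "bilinear_map s1 s2 fscale (tens s1 s2)"
  using assms vector_space_fscale
  by (intro bilinear_mapI) (auto simp: tens_def fscale_def fun_eq_iff bilinear_mapD)

lemma vector_space_basis:
  assumes "vector_space s"
  obtains E where "\<not> module.dependent s E" "module.span s E = UNIV"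
proof -
  interpret vector_space s by fact
  show ?thesis
    using maximal_independent_subset[of UNIV] that by (auto simp: top.extremum_unique)
qed

lemma sum_fun_apply: "(\<Sum>i\<in>I. h i) y = (\<Sum>i\<in>I. h i y)"
  by (induction I rule: infinite_finite_induct) simp_all

lemma tlift_exists:
  fixes s1 :: "'k::field \<Rightarrow> 'a::ab_group_add \<Rightarrow> 'a" and s2 :: "'k \<Rightarrow> 'c::ab_group_add \<Rightarrow> 'c"
  assumes s1: "vector_space s1" and s2: "vector_space s2" and s3: "vector_space s3"
    and \<beta>: "bilinear_map s1 s2 s3 \<beta>"
  shows "\<exists>L. Vector_Spaces.linear fscale s3 L \<and> (\<forall>a c. L (tens s1 s2 a c) = \<beta> a c)"
proof -
  interpret v1: vector_space s1 by fact
  interpret v2: vector_space s2 by fact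
  interpret v3: vector_space s3 by fact
  interpret t: vector_space "fscale :: 'k \<Rightarrow> (('a \<Rightarrow> 'c \<Rightarrow> 'k) \<Rightarrow> 'k) \<Rightarrow> _"
    by (rule vector_space_fscale)
  interpret p: vector_space_pair "fscale :: 'k \<Rightarrow> (('a \<Rightarrow> 'c \<Rightarrow> 'k) \<Rightarrow> 'k) \<Rightarrow> _" s3
    by unfold_locales
  obtain E where E: "v1.independent E" "v1.span E = UNIV" using vector_space_basis[OF s1] by blast
  obtain F where F: "v2.independent F" "v2.span F = UNIV" using vector_space_basis[OF s2] by blast
  define \<delta> where "\<delta> e f = (\<lambda>a c. v1.representation E a e * v2.representation F c f)" for e f
  have bil: "bilinear_map s1 s2 (*) (\<delta> e f)" for e f
  proof -
    have "v1.representation E (a + a') e = v1.representation E a e + v1.representation E a' e"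
      "v1.representation E (s1 r a) e = r * v1.representation E a e" for a a' r
      using E by (auto simp: v1.representation_add v1.representation_scale)
    moreover have "v2.representation F (c + c') f = v2.representation F c f + v2.representation F c' f"
      "v2.representation F (s2 r c) f = r * v2.representation F c f" for c c' r
      using F by (auto simp: v2.representation_add v2.representation_scale)
    ultimately show ?thesis
      by (intro bilinear_mapI s1 s2 vector_space_field) (auto simp: \<delta>_def algebra_simps)
  qed
  have ev: "tens s1 s2 e f (\<delta> e' f') = (if e = e' \<and> f = f' then 1 else 0)"
    if "e \<in> E" "f \<in> F" for e f e' f'
    using that bil E F
    by (auto simp: tens_def \<delta>_def v1.representation_basis v2.representation_basis)
  define T where "T = {tens s1 s2 e f | e f. e \<in> E \<and> f \<in> F}"
  have inj: "inj_on (\<lambda>(e, f). tens s1 s2 e f) (E \<times> F)"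
  proof (rule inj_onI, clarsimp)
    fix e f e' f' assume *: "e \<in> E" "f \<in> F" "e' \<in> E" "f' \<in> F" "tens s1 s2 e f = tens s1 s2 e' f'"
    have "tens s1 s2 e f (\<delta> e f) = 1" using ev[OF *(1,2), of e f] by simp
    hence "tens s1 s2 e' f' (\<delta> e f) = 1" by (simp only: *(5))
    with ev[OF *(3,4), of e f] show "e = e' \<and> f = f'" by (metis zero_neq_one)
  qed
  have ind: "t.independent T"
  proof
    assume "t.dependent T"
    then obtain S u v where S: "finite S" "S \<subseteq> T" "(\<Sum>v\<in>S. fscale (u v) v) = 0" "v \<in> S"
      and u: "u v \<noteq> 0"
      unfolding t.dependent_explicit by (elim exE conjE bexE) (rule that)
    from S(2,4) have "v \<in> T" by (rule subsetD)
    then obtain e f where v: "v = tens s1 s2 e f" "e \<in> E" "f \<in> F"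
      unfolding T_def by blast
    have z: "w (\<delta> e f) = (if w = v then 1 else 0)" if "w \<in> S" for w
    proof -
      from S(2) that have "w \<in> T" by (rule subsetD)
      then obtain e' f' where w: "w = tens s1 s2 e' f'" "e' \<in> E" "f' \<in> F"
        unfolding T_def by blast
      have "w = v \<longleftrightarrow> e' = e \<and> f' = f"
        using inj_on_eq_iff[OF inj, of "(e', f')" "(e, f)"] w(2,3) v(2,3)
        unfolding w(1) v(1) by simp
      with ev[OF w(2,3), of e f] show ?thesis unfolding w(1) by (simp only:)
    qed
    have "0 = (\<Sum>w\<in>S. fscale (u w) w) (\<delta> e f)" unfolding S(3) by simp
    also have "\<dots> = (\<Sum>w\<in>S. u w * w (\<delta> e f))"
      unfolding sum_fun_apply fscale_def ..
    also have "\<dots> = (\<Sum>w\<in>S. if w = v then u w else 0)"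
    proof (rule sum.cong[OF refl])
      fix w assume "w \<in> S"
      from z[OF this] show "u w * w (\<delta> e f) = (if w = v then u w else 0)" by simp
    qed
    also have "\<dots> = u v" using S(1,4) by simp
    finally show False using u by simp
  qed
  define h where "h = (\<lambda>x. case the_inv_into (E \<times> F) (\<lambda>(e, f). tens s1 s2 e f) x of (e, f) \<Rightarrow> \<beta> e f)"
  have "\<exists>L. Vector_Spaces.linear fscale s3 L \<and> (\<forall>x\<in>T. L x = h x)"
    by (rule p.linear_independent_extend[OF ind])
  then obtain L where L: "Vector_Spaces.linear fscale s3 L" "\<forall>x\<in>T. L x = h x"
    by (elim exE conjE) (rule that)
  have LEF: "L (tens s1 s2 e f) = \<beta> e f" if "e \<in> E" "f \<in> F" for e f
  proof -
    have "tens s1 s2 e f \<in> T"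
      unfolding T_def using that by blast
    moreover have "h (tens s1 s2 e f) = \<beta> e f"
      using that the_inv_into_f_f[OF inj, of "(e, f)"] by (simp add: h_def)
    ultimately show ?thesis using bspec[OF L(2)] by metis
  qed
  have lin1: "Vector_Spaces.linear s1 s3 (\<lambda>a. L (tens s1 s2 a c))" for c
    using Vector_Spaces.linear_compose[OF _ L(1), of s1 "\<lambda>a. tens s1 s2 a c"] bilinear_tens[OF s1 s2]
    by (auto simp: bilinear_map_def o_def)
  have lin2: "Vector_Spaces.linear s2 s3 (\<lambda>c. L (tens s1 s2 a c))" for a
    using Vector_Spaces.linear_compose[OF _ L(1), of s2 "\<lambda>c. tens s1 s2 a c"] bilinear_tens[OF s1 s2]
    by (auto simp: bilinear_map_def o_def)
  interpret p1: vector_space_pair s1 s3 by unfold_locales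
  interpret p2: vector_space_pair s2 s3 by unfold_locales
  have 1: "L (tens s1 s2 e c) = \<beta> e c" if "e \<in> E" for e c
    using p2.linear_eq_on[OF lin2[of e], of "\<beta> e" c F] \<beta> F LEF that
    by (auto simp: bilinear_map_def)
  have "L (tens s1 s2 a c) = \<beta> a c" for a c
    using p1.linear_eq_on[OF lin1[of c], of "\<lambda>a. \<beta> a c" a E] \<beta> E 1
    by (auto simp: bilinear_map_def)
  with L(1) show ?thesis by (intro exI[of _ L]) simp
qed

lemma tlift:
  assumes "vector_space s1" "vector_space s2" "vector_space s3" "bilinear_map s1 s2 s3 \<beta>"
  shows "Vector_Spaces.linear fscale s3 (tlift s1 s2 s3 \<beta>)"
    and "tlift s1 s2 s3 \<beta> (tens s1 s2 a c) = \<beta> a c"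
  using someI_ex[OF tlift_exists[OF assms]] unfolding tlift_def by auto

lemma subspace_projection:
  assumes "vector_space s" "module.subspace s A"
  obtains p where "Vector_Spaces.linear s s p" "\<And>a. a \<in> A \<Longrightarrow> p a = a" "\<And>a. p a \<in> A"
proof -
  interpret vector_space s by fact
  interpret q: vector_space_pair s s by unfold_locales
  obtain E where E: "E \<subseteq> A" "independent E" "A \<subseteq> span E"
    by (rule maximal_independent_subset)
  have EA: "span E = A"
    using E span_minimal[OF E(1) assms(2)] by (intro antisym)
  obtain p where p: "Vector_Spaces.linear s s p" "\<forall>x\<in>E. p x = id x" "range p = span (id ` E)"
    using q.linear_independent_extend_subspace[OF E(2), of id]
    by (elim exE conjE) (rule that)
  have "p a = a" if "a \<in> A" for a
    using q.linear_eq_on[OF p(1) linear_id, of a E] p(2) that EA by simp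
  moreover have "p a \<in> A" for a
    using p(3) EA by (metis image_id id_apply rangeI)
  ultimately show ?thesis using p(1) by (intro that)
qed

lemma tens_universal:
  fixes s1 :: "'k::field \<Rightarrow> 'a::ab_group_add \<Rightarrow> 'a" and s2 :: "'k \<Rightarrow> 'c::ab_group_add \<Rightarrow> 'c"
    and s3 :: "'k \<Rightarrow> 'd::ab_group_add \<Rightarrow> 'd"
  assumes s: "vector_space s1" "vector_space s2" "vector_space s3"
    and A: "module.subspace s1 A" and C: "module.subspace s2 C"
    and "\<And>a a' c. a \<in> A \<Longrightarrow> a' \<in> A \<Longrightarrow> c \<in> C \<Longrightarrow> \<beta> (a + a') c = \<beta> a c + \<beta> a' c"
    and "\<And>a c c'. a \<in> A \<Longrightarrow> c \<in> C \<Longrightarrow> c' \<in> C \<Longrightarrow> \<beta> a (c + c') = \<beta> a c + \<beta> a c'"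
    and "\<And>r a c. a \<in> A \<Longrightarrow> c \<in> C \<Longrightarrow> \<beta> (s1 r a) c = s3 r (\<beta> a c)"
    and "\<And>r a c. a \<in> A \<Longrightarrow> c \<in> C \<Longrightarrow> \<beta> a (s2 r c) = s3 r (\<beta> a c)"
  shows "\<exists>L. Vector_Spaces.linear fscale s3 L \<and> (\<forall>a\<in>A. \<forall>c\<in>C. L (tens s1 s2 a c) = \<beta> a c)"
    and "\<lbrakk>Vector_Spaces.linear fscale s3 L; Vector_Spaces.linear fscale s3 L';
      \<And>a c. a \<in> A \<Longrightarrow> c \<in> C \<Longrightarrow> L (tens s1 s2 a c) = L' (tens s1 s2 a c);
      t \<in> tensor_space s1 s2 A C\<rbrakk> \<Longrightarrow> L t = L' t"
proof -
  obtain p where p: "Vector_Spaces.linear s1 s1 p" "\<And>a. a \<in> A \<Longrightarrow> p a = a" "\<And>a. p a \<in> A"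
    using subspace_projection[OF s(1) A] by blast
  obtain q where q: "Vector_Spaces.linear s2 s2 q" "\<And>a. a \<in> C \<Longrightarrow> q a = a" "\<And>a. q a \<in> C"
    using subspace_projection[OF s(2) C] by blast
  interpret p: Vector_Spaces.linear s1 s1 p by fact
  interpret q: Vector_Spaces.linear s2 s2 q by fact
  have "bilinear_map s1 s2 s3 (\<lambda>a c. \<beta> (p a) (q c))"
    using assms p(3) q(3) by (intro bilinear_mapI s) (auto simp: p.add q.add p.scale q.scale)
  from tlift_exists[OF s this] p(2) q(2)
  show "\<exists>L. Vector_Spaces.linear fscale s3 L \<and> (\<forall>a\<in>A. \<forall>c\<in>C. L (tens s1 s2 a c) = \<beta> a c)"
    by auto
next
  assume L: "Vector_Spaces.linear fscale s3 L" "Vector_Spaces.linear fscale s3 L'"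
      "\<And>a c. a \<in> A \<Longrightarrow> c \<in> C \<Longrightarrow> L (tens s1 s2 a c) = L' (tens s1 s2 a c)"
      "t \<in> tensor_space s1 s2 A C"
  interpret p: vector_space_pair "fscale :: 'k \<Rightarrow> (('a \<Rightarrow> 'c \<Rightarrow> 'k) \<Rightarrow> 'k) \<Rightarrow> _" s3
    using s(3) vector_space_fscale by (auto simp: vector_space_pair_def)
  show "L t = L' t"
    using p.linear_eq_on[OF L(1,2)] L(3,4) by (auto simp: tensor_space_def)
qed


section \<open>Braided Hopf algebras in the category of Yetter-Drinfeld modules\<close>

definition direct_sum_decomposition ::
  "('k::field \<Rightarrow> 'b::ab_group_add \<Rightarrow> 'b) \<Rightarrow> 'i set \<Rightarrow> ('i \<Rightarrow> 'b set) \<Rightarrow> bool"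
  where "direct_sum_decomposition s I D \<longleftrightarrow>
    (\<forall>i\<in>I. module.subspace s (D i)) \<and>
    module.span s (\<Union>i\<in>I. D i) = UNIV \<and>
    (\<forall>J f. finite J \<and> J \<subseteq> I \<and> (\<forall>i\<in>J. f i \<in> D i) \<and> sum f J = 0 \<longrightarrow> (\<forall>i\<in>J. f i = 0))"

lemma direct_sum_linear_exists:
  fixes s :: "'k::field \<Rightarrow> 'b::ab_group_add \<Rightarrow> 'b" and s3 :: "'k \<Rightarrow> 'd::ab_group_add \<Rightarrow> 'd"
    and I :: "'i set"
  assumes s: "vector_space s" and s3: "vector_space s3"
    and D: "direct_sum_decomposition s I D"
    and f: "\<And>i. i \<in> I \<Longrightarrow> Vector_Spaces.linear s s3 (f i)"
  shows "\<exists>F. Vector_Spaces.linear s s3 F \<and> (\<forall>i\<in>I. \<forall>v\<in>D i. F v = f i v)"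
proof -
  interpret v: vector_space s by fact
  interpret v3: vector_space s3 by fact
  have sub: "v.subspace (D i)" if "i \<in> I" for i
    using D that by (simp add: direct_sum_decomposition_def)
  have f0: "f i 0 = 0" and f_diff: "f i (x - y) = f i x - f i y" and f_add: "f i (x + y) = f i x + f i y"
    and f_scale: "f i (s r x) = s3 r (f i x)" if "i \<in> I" for i x y r
  proof -
    interpret l: Vector_Spaces.linear s s3 "f i" by (rule f[OF that])
    show "f i 0 = 0" "f i (x - y) = f i x - f i y" "f i (x + y) = f i x + f i y"
      "f i (s r x) = s3 r (f i x)"
      by (simp_all add: l.diff l.add l.scale)
  qed
  have indep: "\<forall>i\<in>J. h i = 0" if "finite J" "J \<subseteq> I" "\<forall>i\<in>J. h i \<in> D i" "sum h J = 0" for J h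
    using D that unfolding direct_sum_decomposition_def by simp
  define R where "R v J w \<longleftrightarrow> finite J \<and> J \<subseteq> I \<and> (\<forall>i\<in>I. w i \<in> D i) \<and> (\<forall>i. i \<notin> J \<longrightarrow> w i = 0) \<and> v = sum w J"
    for v and J :: "'i set" and w
  have R_sum: "v = sum w J" if "R v J w" for v J w using that unfolding R_def by blast
  have R_zero: "w i = 0" if "R v J w" "i \<notin> J" for v J w i using that unfolding R_def by blast
  have R_mem: "w i \<in> D i" if "R v J w" "i \<in> I" for v J w i using that unfolding R_def by blast
  have R_mono: "R v J' w" if "R v J w" "finite J'" "J \<subseteq> J'" "J' \<subseteq> I" for v J J' w
  proof -
    have "sum w J = sum w J'" using that by (intro sum.mono_neutral_left) (auto simp: R_def)
    with that show ?thesis by (auto simp: R_def)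
  qed
  have R_add: "R (v + v') (J \<union> J') (\<lambda>i. w i + w' i)" if *: "R v J w" "R v' J' w'" for v v' J J' w w'
  proof -
    have J: "finite (J \<union> J')" "J \<union> J' \<subseteq> I" using * by (simp_all add: R_def)
    have "R v (J \<union> J') w" "R v' (J \<union> J') w'"
      by (rule R_mono[OF *(1) J(1) _ J(2)], simp) (rule R_mono[OF *(2) J(1) _ J(2)], simp)
    then show ?thesis using sub by (auto simp: R_def sum.distrib intro!: v.subspace_add)
  qed
  have R_scale: "R (s r v) J (\<lambda>i. s r (w i))" if *: "R v J w" for v J w r
    using * sub by (auto simp: R_def v.scale_sum_right intro!: v.subspace_scale)
  have R_exists: "\<exists>J w. R v J w" for v
  proof -
    have "v \<in> v.span (\<Union>i\<in>I. D i)" using D by (simp add: direct_sum_decomposition_def)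
    then show ?thesis
    proof (induction rule: v.span_induct_alt)
      case base
      show ?case
        using sub by (intro exI[of _ "{}"] exI[of _ "\<lambda>_. 0"]) (auto simp: R_def v.subspace_0)
    next
      case (step c x y)
      then obtain i where i: "i \<in> I" "x \<in> D i" by blast
      have "R x {i} (\<lambda>k. if k = i then x else 0)" using i sub by (auto simp: R_def v.subspace_0)
      from R_scale[OF this, of c] have x: "R (s c x) {i} (\<lambda>k. s c (if k = i then x else 0))" .
      from step(2) obtain J w where "R y J w" by (elim exE) (rule that)
      from R_add[OF x this] show ?case by (intro exI)
    qed
  qed
  have R_unique: "w = w'" if *: "R v J w" "R v J' w'" for v J J' w w'
  proof
    fix k
    have J: "finite (J \<union> J')" "J \<union> J' \<subseteq> I" using * by (simp_all add: R_def)
    have R: "R v (J \<union> J') w" "R v (J \<union> J') w'"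
      by (rule R_mono[OF *(1) J(1) _ J(2)], simp) (rule R_mono[OF *(2) J(1) _ J(2)], simp)
    have sum0: "sum (\<lambda>i. w i - w' i) (J \<union> J') = 0"
      unfolding sum_subtractf R_sum[OF R(1), symmetric] R_sum[OF R(2), symmetric] by (rule diff_self)
    have mem: "\<forall>i\<in>J \<union> J'. w i - w' i \<in> D i"
    proof
      fix i assume "i \<in> J \<union> J'"
      with J(2) have i: "i \<in> I" by (rule subsetD)
      show "w i - w' i \<in> D i"
        by (rule v.subspace_diff[OF sub[OF i] R_mem[OF R(1) i] R_mem[OF R(2) i]])
    qed
    note eq0 = indep[OF J mem sum0]
    show "w k = w' k"
    proof (cases "k \<in> J \<union> J'")
      case True
      with eq0 have "w k - w' k = 0" by (rule bspec)
      then show ?thesis by (rule right_minus_eq[THEN iffD1])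
    next
      case False
      show ?thesis unfolding R_zero[OF R(1) False] R_zero[OF R(2) False] ..
    qed
  qed
  define J where "J v = (SOME J. \<exists>w. R v J w)" for v
  define w where "w v = (SOME w. R v (J v) w)" for v
  have "\<exists>w. R v (J v) w" for v
    unfolding J_def using R_exists[of v] by (rule someI_ex)
  then have Jw: "R v (J v) (w v)" for v
    unfolding w_def by (rule someI_ex)
  have J_fin: "finite (J v)" "J v \<subseteq> I" for v
    using Jw[of v] unfolding R_def by simp_all
  define F where "F v = (\<Sum>i\<in>J v. f i (w v i))" for v
  have F: "F v = (\<Sum>i\<in>J'. f i (w' i))" if R: "R v J' w'" for v J' w'
  proof -
    have w: "w v = w'" using R_unique[OF Jw R] .
    have J: "finite (J v \<union> J')" "J v \<union> J' \<subseteq> I"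
      using J_fin[of v] R by (simp_all add: R_def)
    have z: "f i (w' i) = 0" if "i \<in> J v \<union> J'" "i \<notin> J v \<or> i \<notin> J'" for i
    proof -
      have "i \<in> I" using J(2) that(1) by (rule subsetD)
      moreover have "w' i = 0" using that(2) R_zero[OF R] R_zero[OF Jw[of v]] w by (elim disjE) simp_all
      ultimately show ?thesis using f0 by simp
    qed
    have "F v = (\<Sum>i\<in>J v \<union> J'. f i (w' i))"
      unfolding F_def w by (intro sum.mono_neutral_left J(1) ballI z) auto
    also have "\<dots> = (\<Sum>i\<in>J'. f i (w' i))"
      by (intro sum.mono_neutral_right J(1) ballI z) auto
    finally show ?thesis .
  qed
  have "F (v + v') = F v + F v'" for v v'
  proof -
    have J: "finite (J v \<union> J v')" "J v \<union> J v' \<subseteq> I"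
      using J_fin[of v] J_fin[of v'] by simp_all
    have "F (v + v') = (\<Sum>i\<in>J v \<union> J v'. f i (w v i + w v' i))"
      by (rule F[OF R_add[OF Jw Jw]])
    also have "\<dots> = (\<Sum>i\<in>J v \<union> J v'. f i (w v i) + f i (w v' i))"
    proof (rule sum.cong[OF refl])
      fix i assume "i \<in> J v \<union> J v'"
      with J(2) have "i \<in> I" by (rule subsetD)
      then show "f i (w v i + w v' i) = f i (w v i) + f i (w v' i)" by (rule f_add)
    qed
    also have "\<dots> = F v + F v'"
      using F[OF R_mono[OF Jw[of v] J(1) _ J(2)]] F[OF R_mono[OF Jw[of v'] J(1) _ J(2)]]
      by (simp add: sum.distrib)
    finally show ?thesis .
  qed
  moreover have "F (s r v) = s3 r (F v)" for r v
  proof -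
    have "F (s r v) = (\<Sum>i\<in>J v. f i (s r (w v i)))" by (rule F[OF R_scale[OF Jw]])
    also have "\<dots> = (\<Sum>i\<in>J v. s3 r (f i (w v i)))"
    proof (rule sum.cong[OF refl])
      fix i assume "i \<in> J v"
      with J_fin(2)[of v] have "i \<in> I" by (rule subsetD)
      then show "f i (s r (w v i)) = s3 r (f i (w v i))" by (rule f_scale)
    qed
    finally show ?thesis by (simp add: F_def v3.scale_sum_right)
  qed
  ultimately have "Vector_Spaces.linear s s3 F" by (intro linearI' s s3)
  moreover have "F v = f i v" if "i \<in> I" "v \<in> D i" for i v
  proof -
    have "R v {i} (\<lambda>k. if k = i then v else 0)" using that sub by (auto simp: R_def v.subspace_0)
    from F[OF this] show ?thesis by simp
  qed
  ultimately show ?thesis by (intro exI[of _ F]) simp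
qed

locale yetter_drinfeld_module = group G + vector_space scale
  for G :: "('g, 'm) monoid_scheme" (structure)
    and scale :: "'k::field \<Rightarrow> 'b::ab_group_add \<Rightarrow> 'b" +
  fixes act :: "'g \<Rightarrow> 'b \<Rightarrow> 'b" and deg :: "'g \<Rightarrow> 'b set"
  assumes act_linear: "g \<in> carrier G \<Longrightarrow> Vector_Spaces.linear scale scale (act g)"
    and act_one: "act \<one> v = v"
    and act_comp: "g \<in> carrier G \<Longrightarrow> h \<in> carrier G \<Longrightarrow> act (g \<otimes> h) v = act g (act h v)"
    and deg_decomposition: "direct_sum_decomposition scale (carrier G) deg"
    and act_deg: "g \<in> carrier G \<Longrightarrow> h \<in> carrier G \<Longrightarrow> v \<in> deg h \<Longrightarrow>
      act g v \<in> deg (g \<otimes> h \<otimes> inv g)"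

definition yd_braiding ::
  "('g, 'm) monoid_scheme \<Rightarrow> ('k::field \<Rightarrow> 'b::ab_group_add \<Rightarrow> 'b) \<Rightarrow> ('g \<Rightarrow> 'b \<Rightarrow> 'b) \<Rightarrow>
   ('g \<Rightarrow> 'b set) \<Rightarrow> (('b \<Rightarrow> 'b \<Rightarrow> 'k) \<Rightarrow> 'k) \<Rightarrow> (('b \<Rightarrow> 'b \<Rightarrow> 'k) \<Rightarrow> 'k)"
  where "yd_braiding G s act deg =
    (SOME \<Psi>. Vector_Spaces.linear fscale fscale \<Psi> \<and>
      (\<forall>g\<in>carrier G. \<forall>v\<in>deg g. \<forall>u. \<Psi> (tens s s v u) = tens s s (act g u) v))"

lemma (in yetter_drinfeld_module) yd_braiding:
  shows "Vector_Spaces.linear fscale fscale (yd_braiding G scale act deg)"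
    and "\<lbrakk>g \<in> carrier G; v \<in> deg g\<rbrakk> \<Longrightarrow>
      yd_braiding G scale act deg (tens scale scale v u) = tens scale scale (act g u) v"
proof -
  have vs: "vector_space scale" by (rule vector_space_axioms)
  have vt: "vector_space (fscale :: 'k \<Rightarrow> (('b \<Rightarrow> 'b \<Rightarrow> 'k) \<Rightarrow> 'k) \<Rightarrow> _)"
    by (rule vector_space_fscale)
  interpret t: vector_space "fscale :: 'k \<Rightarrow> (('b \<Rightarrow> 'b \<Rightarrow> 'k) \<Rightarrow> 'k) \<Rightarrow> _" by (rule vt)
  note bt = bilinear_mapD[OF bilinear_tens[OF vs vs]]
  define sp :: "'k \<Rightarrow> ('b \<Rightarrow> ('b \<Rightarrow> 'b \<Rightarrow> 'k) \<Rightarrow> 'k) \<Rightarrow> _" where "sp = (\<lambda>r \<phi> u. fscale r (\<phi> u))"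
  have sp: "vector_space sp"
    by unfold_locales (simp_all add: sp_def fun_eq_iff fscale_def algebra_simps)
  have lin: "Vector_Spaces.linear scale sp (\<lambda>v u. tens scale scale (act g u) v)" for g
    by (rule linearI'[OF vs sp]) (simp_all add: sp_def fun_eq_iff bt)
  have "\<exists>F. Vector_Spaces.linear scale sp F \<and>
      (\<forall>g\<in>carrier G. \<forall>v\<in>deg g. F v = (\<lambda>u. tens scale scale (act g u) v))"
    by (rule direct_sum_linear_exists[OF vs sp deg_decomposition]) (rule lin)
  then obtain F where F: "Vector_Spaces.linear scale sp F"
    "\<forall>g\<in>carrier G. \<forall>v\<in>deg g. F v = (\<lambda>u. tens scale scale (act g u) v)"
    by (elim exE conjE) (rule that)
  interpret F: Vector_Spaces.linear scale sp F by fact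
  have F1: "F (v + v') u = F v u + F v' u" "F (scale r v) u = fscale r (F v u)" "F 0 u = 0" for v v' u r
    by (simp_all add: F.add F.scale sp_def)
  have F2: "F v (u + u') = F v u + F v u' \<and> F v (scale r u) = fscale r (F v u)" for v u u' r
  proof -
    have "v \<in> span (\<Union>g\<in>carrier G. deg g)"
      using deg_decomposition by (simp add: direct_sum_decomposition_def)
    then show ?thesis
    proof (induction rule: span_induct_alt)
      case base
      show ?case by (simp add: F1 fscale_def fun_eq_iff)
    next
      case (step c x y)
      then obtain g where g: "g \<in> carrier G" "x \<in> deg g" by blast
      interpret a: Vector_Spaces.linear scale scale "act g" by (rule act_linear[OF g(1)])
      have Fx: "F x = (\<lambda>u. tens scale scale (act g u) x)" using F(2) g by blast
      show ?case
        using step(2)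
        by (simp add: F1 Fx a.add a.scale bt fscale_def fun_eq_iff algebra_simps)
    qed
  qed
  have "bilinear_map scale scale fscale F"
    by (rule bilinear_mapI[OF vs vs vt]) (simp_all add: F1 F2)
  from tlift_exists[OF vs vs vt this] obtain L where L: "Vector_Spaces.linear fscale fscale L"
    "\<forall>a c. L (tens scale scale a c) = F a c" by (elim exE conjE) (rule that)
  have "\<exists>\<Psi>. Vector_Spaces.linear fscale fscale \<Psi> \<and> (\<forall>g\<in>carrier G. \<forall>v\<in>deg g. \<forall>u.
      \<Psi> (tens scale scale v u) = tens scale scale (act g u) v)"
    using L F(2) by (intro exI[of _ L] conjI) simp_all
  from someI_ex[OF this]
  show "Vector_Spaces.linear fscale fscale (yd_braiding G scale act deg)"
    and "\<lbrakk>g \<in> carrier G; v \<in> deg g\<rbrakk> \<Longrightarrow>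
      yd_braiding G scale act deg (tens scale scale v u) = tens scale scale (act g u) v"
    unfolding yd_braiding_def by simp_all
qed

definition mult_map ::
  "('k::field \<Rightarrow> 'b::ring_1 \<Rightarrow> 'b) \<Rightarrow> (('b \<Rightarrow> 'b \<Rightarrow> 'k) \<Rightarrow> 'k) \<Rightarrow> 'b"
  where "mult_map s = tlift s s s (*)"

definition tensor_map ::
  "('k::field \<Rightarrow> 'b::ab_group_add \<Rightarrow> 'b) \<Rightarrow> ('b \<Rightarrow> 'b) \<Rightarrow> ('b \<Rightarrow> 'b) \<Rightarrow>
   (('b \<Rightarrow> 'b \<Rightarrow> 'k) \<Rightarrow> 'k) \<Rightarrow> (('b \<Rightarrow> 'b \<Rightarrow> 'k) \<Rightarrow> 'k)"
  where "tensor_map s f h = tlift s s fscale (\<lambda>a b. tens s s (f a) (h b))"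

text \<open>
  The product of the braided tensor square, \<open>(m \<otimes> m) \<circ> (id \<otimes> \<Psi> \<otimes> id)\<close>: on pure tensors
  \<open>a \<otimes> b\<close> and \<open>c \<otimes> d\<close> it is the sum of the \<open>a c' \<otimes> b' d\<close> if \<open>\<Psi> (b \<otimes> c)\<close> is the sum of the
  \<open>c' \<otimes> b'\<close>.
\<close>

definition braided_mult ::
  "('k::field \<Rightarrow> 'b::ring_1 \<Rightarrow> 'b) \<Rightarrow> ((('b \<Rightarrow> 'b \<Rightarrow> 'k) \<Rightarrow> 'k) \<Rightarrow> (('b \<Rightarrow> 'b \<Rightarrow> 'k) \<Rightarrow> 'k)) \<Rightarrow>
   (('b \<Rightarrow> 'b \<Rightarrow> 'k) \<Rightarrow> 'k) \<Rightarrow> (('b \<Rightarrow> 'b \<Rightarrow> 'k) \<Rightarrow> 'k) \<Rightarrow> (('b \<Rightarrow> 'b \<Rightarrow> 'k) \<Rightarrow> 'k)"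
  where "braided_mult s \<Psi> t u =
    tlift s s fscale (\<lambda>a b. tlift s s fscale (\<lambda>c d.
      tlift s s fscale (\<lambda>c' b'. tens s s (a * c') (b' * d)) (\<Psi> (tens s s b c))) u) t"

definition comult_left ::
  "('k::field \<Rightarrow> 'b::ab_group_add \<Rightarrow> 'b) \<Rightarrow> ('b \<Rightarrow> ('b \<Rightarrow> 'b \<Rightarrow> 'k) \<Rightarrow> 'k) \<Rightarrow>
   (('b \<Rightarrow> 'b \<Rightarrow> 'k) \<Rightarrow> 'k) \<Rightarrow> ('b \<Rightarrow> 'b \<Rightarrow> 'b \<Rightarrow> 'k) \<Rightarrow> 'k"
  where "comult_left s \<Delta> =
    tlift s s fscale (\<lambda>a c. tlift s s fscale (\<lambda>a' a''. tens3 s a' a'' c) (\<Delta> a))"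

definition comult_right ::
  "('k::field \<Rightarrow> 'b::ab_group_add \<Rightarrow> 'b) \<Rightarrow> ('b \<Rightarrow> ('b \<Rightarrow> 'b \<Rightarrow> 'k) \<Rightarrow> 'k) \<Rightarrow>
   (('b \<Rightarrow> 'b \<Rightarrow> 'k) \<Rightarrow> 'k) \<Rightarrow> ('b \<Rightarrow> 'b \<Rightarrow> 'b \<Rightarrow> 'k) \<Rightarrow> 'k"
  where "comult_right s \<Delta> =
    tlift s s fscale (\<lambda>a c. tlift s s fscale (\<lambda>c' c''. tens3 s a c' c'') (\<Delta> c))"

locale braided_hopf_algebra = yetter_drinfeld_module G scale act deg
  for G :: "('g, 'm) monoid_scheme" (structure)
    and scale :: "'k::field \<Rightarrow> 'b::ring_1 \<Rightarrow> 'b" and act deg +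
  fixes \<Delta> :: "'b \<Rightarrow> ('b \<Rightarrow> 'b \<Rightarrow> 'k) \<Rightarrow> 'k" and \<epsilon> :: "'b \<Rightarrow> 'k" and S :: "'b \<Rightarrow> 'b"
  \<comment> \<open>algebra in the category\<close>
  assumes scale_mult_left: "scale r x * y = scale r (x * y)"
    and scale_mult_right: "x * scale r y = scale r (x * y)"
    and act_unit: "g \<in> carrier G \<Longrightarrow> act g 1 = 1"
    and act_mult: "g \<in> carrier G \<Longrightarrow> act g (x * y) = act g x * act g y"
    and deg_unit: "1 \<in> deg \<one>"
    and deg_mult: "g \<in> carrier G \<Longrightarrow> h \<in> carrier G \<Longrightarrow> x \<in> deg g \<Longrightarrow> y \<in> deg h \<Longrightarrow>
      x * y \<in> deg (g \<otimes> h)"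
  \<comment> \<open>coalgebra in the category; the field is the trivial module concentrated in degree \<open>\<one>\<close>\<close>
    and comult_linear: "Vector_Spaces.linear scale fscale \<Delta>"
    and comult_range: "\<Delta> x \<in> tensor_space scale scale UNIV UNIV"
    and comult_act: "g \<in> carrier G \<Longrightarrow> \<Delta> (act g x) = tensor_map scale (act g) (act g) (\<Delta> x)"
    and comult_deg: "g \<in> carrier G \<Longrightarrow> x \<in> deg g \<Longrightarrow>
      \<Delta> x \<in> module.span fscale {tens scale scale a b | a b. \<exists>h\<in>carrier G. \<exists>k\<in>carrier G.
        h \<otimes> k = g \<and> a \<in> deg h \<and> b \<in> deg k}"
    and counit_linear: "Vector_Spaces.linear scale (*) \<epsilon>"
    and counit_act: "g \<in> carrier G \<Longrightarrow> \<epsilon> (act g x) = \<epsilon> x"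
    and counit_deg: "g \<in> carrier G \<Longrightarrow> g \<noteq> \<one> \<Longrightarrow> x \<in> deg g \<Longrightarrow> \<epsilon> x = 0"
    and coassoc: "comult_left scale \<Delta> (\<Delta> x) = comult_right scale \<Delta> (\<Delta> x)"
    and counit_left: "tlift scale scale scale (\<lambda>a b. scale (\<epsilon> a) b) (\<Delta> x) = x"
    and counit_right: "tlift scale scale scale (\<lambda>a b. scale (\<epsilon> b) a) (\<Delta> x) = x"
  \<comment> \<open>bialgebra\<close>
    and comult_unit: "\<Delta> 1 = tens scale scale 1 1"
    and comult_mult: "\<Delta> (x * y) = braided_mult scale (yd_braiding G scale act deg) (\<Delta> x) (\<Delta> y)"
    and counit_unit: "\<epsilon> 1 = 1"
    and counit_mult: "\<epsilon> (x * y) = \<epsilon> x * \<epsilon> y"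
  \<comment> \<open>antipode\<close>
    and antipode_linear: "Vector_Spaces.linear scale scale S"
    and antipode_act: "g \<in> carrier G \<Longrightarrow> S (act g x) = act g (S x)"
    and antipode_deg: "g \<in> carrier G \<Longrightarrow> x \<in> deg g \<Longrightarrow> S x \<in> deg g"
    and antipode_left: "mult_map scale (tensor_map scale S id (\<Delta> x)) = scale (\<epsilon> x) 1"
    and antipode_right: "mult_map scale (tensor_map scale id S (\<Delta> x)) = scale (\<epsilon> x) 1"

locale graded_braided_hopf_algebra = braided_hopf_algebra G scale act deg \<Delta> \<epsilon> S
  for G :: "('g, 'm) monoid_scheme" (structure)
    and scale :: "'k::field \<Rightarrow> 'b::ring_1 \<Rightarrow> 'b" and act deg \<Delta> \<epsilon> S +
  fixes gr :: "nat \<Rightarrow> 'b set"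
  assumes gr_decomposition: "direct_sum_decomposition scale UNIV gr"
  \<comment> \<open>each \<open>gr n\<close> is a Yetter-Drinfeld submodule\<close>
    and gr_act: "g \<in> carrier G \<Longrightarrow> x \<in> gr n \<Longrightarrow> act g x \<in> gr n"
    and gr_deg: "gr n = module.span scale (\<Union>g\<in>carrier G. gr n \<inter> deg g)"
    and gr_unit: "1 \<in> gr 0"
    and gr_mult: "x \<in> gr i \<Longrightarrow> y \<in> gr j \<Longrightarrow> x * y \<in> gr (i + j)"
    and gr_comult: "x \<in> gr n \<Longrightarrow>
      \<Delta> x \<in> module.span fscale {tens scale scale a b | a b. \<exists>i j. i + j = n \<and> a \<in> gr i \<and> b \<in> gr j}"
    and gr_counit: "n > 0 \<Longrightarrow> x \<in> gr n \<Longrightarrow> \<epsilon> x = 0"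
    and gr_antipode: "x \<in> gr n \<Longrightarrow> S x \<in> gr n"

definition subalgebra :: "('k::field \<Rightarrow> 'b::ring_1 \<Rightarrow> 'b) \<Rightarrow> 'b set \<Rightarrow> bool"
  where "subalgebra s A \<longleftrightarrow> module.subspace s A \<and> 1 \<in> A \<and> (\<forall>x\<in>A. \<forall>y\<in>A. x * y \<in> A)"

definition generated_subalgebra :: "('k::field \<Rightarrow> 'b::ring_1 \<Rightarrow> 'b) \<Rightarrow> 'b set \<Rightarrow> 'b set"
  where "generated_subalgebra s X = subalgebra s hull X"

text \<open>The Nichols algebra of the Yetter-Drinfeld module \<open>gr 1\<close>.\<close>

locale nichols_algebra = graded_braided_hopf_algebra G scale act deg \<Delta> \<epsilon> S gr
  for G :: "('g, 'm) monoid_scheme" (structure)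
    and scale :: "'k::field \<Rightarrow> 'b::ring_1 \<Rightarrow> 'b" and act deg \<Delta> \<epsilon> S gr +
  assumes connected: "gr 0 = range (\<lambda>r. scale r 1)"
    and generated: "generated_subalgebra scale (gr 1) = UNIV"
    and primitives: "{x. \<Delta> x = tens scale scale x 1 + tens scale scale 1 x} = gr 1"


section \<open>The root system of type A\<close>

text \<open>
  The group is the symmetric group on \<open>{1..n}\<close>, acting on coordinate vectors by
  \<open>w e\<^sub>i = e\<^bsub>w i\<^esub>\<close>. The geometric representation is, up to scaling the form, the subspace of
  vectors in \<open>\<real>\<^sup>n\<close> with coordinate sum 0; the root system is
  \<open>{e\<^sub>i - e\<^sub>j | i \<noteq> j}\<close>, with simple roots \<open>e\<^sub>i - e\<^bsub>i+1\<^esub>\<close>.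
\<close>

definition unit_vec :: "nat \<Rightarrow> nat \<Rightarrow> real"
  where "unit_vec i = (\<lambda>k. if k = i then 1 else 0)"

definition roots :: "nat \<Rightarrow> (nat \<Rightarrow> real) set"
  where "roots n = {unit_vec i - unit_vec j | i j. i \<in> {1..n} \<and> j \<in> {1..n} \<and> i \<noteq> j}"

definition pos_roots :: "nat \<Rightarrow> (nat \<Rightarrow> real) set"
  where "pos_roots n = {unit_vec i - unit_vec j | i j. i \<in> {1..n} \<and> j \<in> {1..n} \<and> i < j}"

definition simple_roots :: "nat \<Rightarrow> (nat \<Rightarrow> real) set"
  where "simple_roots n = {unit_vec i - unit_vec (Suc i) | i. i \<in> {1..<n}}"

definition perm_vec :: "(nat \<Rightarrow> nat) \<Rightarrow> (nat \<Rightarrow> real) \<Rightarrow> nat \<Rightarrow> real"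
  where "perm_vec w v = (\<lambda>k. v (inv_into UNIV w k))"

definition inner_vec :: "nat \<Rightarrow> (nat \<Rightarrow> real) \<Rightarrow> (nat \<Rightarrow> real) \<Rightarrow> real"
  where "inner_vec n u v = (\<Sum>k\<in>{1..n}. u k * v k)"

definition root_reflection :: "nat \<Rightarrow> (nat \<Rightarrow> real) \<Rightarrow> nat \<Rightarrow> nat"
  where "root_reflection n \<alpha> = (THE w. w \<in> carrier (sym_group n) \<and>
    (\<forall>v. perm_vec w v = (\<lambda>k. v k - 2 * inner_vec n \<alpha> v / inner_vec n \<alpha> \<alpha> * \<alpha> k)))"

lemma root_reflection:
  assumes ij: "i \<in> {1..n}" "j \<in> {1..n}" "i \<noteq> j"
  shows "root_reflection n (unit_vec i - unit_vec j) = transpose i j"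
proof -
  let ?\<alpha> = "unit_vec i - unit_vec j"
  have e: "(\<Sum>k\<in>{1..n}. unit_vec l k * v k) = v l" if "l \<in> {1..n}" for v l
  proof -
    have "(\<Sum>k\<in>{1..n}. unit_vec l k * v k) = (\<Sum>k\<in>{1..n}. if k = l then v k else 0)"
      by (rule sum.cong) (simp_all add: unit_vec_def)
    with that show ?thesis by simp
  qed
  have in1: "inner_vec n ?\<alpha> v = v i - v j" for v
    using e[OF ij(1)] e[OF ij(2)] by (simp add: inner_vec_def left_diff_distrib sum_subtractf)
  have in2: "inner_vec n ?\<alpha> ?\<alpha> = 2" unfolding in1 using ij by (simp add: unit_vec_def)
  have refl: "perm_vec (transpose i j) v = (\<lambda>k. v k - 2 * inner_vec n ?\<alpha> v / inner_vec n ?\<alpha> ?\<alpha> * ?\<alpha> k)" for v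
    unfolding in1 in2 using ij
    by (simp add: fun_eq_iff perm_vec_def unit_vec_def transpose_def field_simps)
  have carr: "transpose i j \<in> carrier (sym_group n)"
    using ij by (simp add: sym_group_carrier permutes_swap_id)
  have uniq: "w = transpose i j"
    if w: "w \<in> carrier (sym_group n)" and eq: "\<And>v. perm_vec w v = perm_vec (transpose i j) v" for w
  proof -
    have "bij w" using w by (simp add: sym_group_carrier permutes_bij)
    have "inv_into UNIV w k = transpose i j k" for k
      using fun_cong[OF eq[of "\<lambda>k. real k"], of k] by (simp add: perm_vec_def)
    then have "inv_into UNIV w = transpose i j" by (simp add: fun_eq_iff)
    then show ?thesis using inv_inv_eq[OF \<open>bij w\<close>] by simp
  qed
  show ?thesis
    unfolding root_reflection_def
  proof (rule the_equality)
    show "transpose i j \<in> carrier (sym_group n) \<and> (\<forall>v. perm_vec (transpose i j) v =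
      (\<lambda>k. v k - 2 * inner_vec n ?\<alpha> v / inner_vec n ?\<alpha> ?\<alpha> * ?\<alpha> k))"
      using carr refl by simp
  next
    fix w assume w: "w \<in> carrier (sym_group n) \<and> (\<forall>v. perm_vec w v =
      (\<lambda>k. v k - 2 * inner_vec n ?\<alpha> v / inner_vec n ?\<alpha> ?\<alpha> * ?\<alpha> k))"
    show "w = transpose i j"
      using uniq w unfolding refl by simp
  qed
qed

text \<open>
  \<open>is_V_W n scale act deg V x\<close>: with the given action and grading, \<open>V\<close> is the Yetter-Drinfeld
  module spanned by the \<open>x \<alpha>\<close>, \<open>\<alpha>\<close> a root, subject only to \<open>x (- \<alpha>) = - x \<alpha>\<close>. The last clause
  says that every linear relation between the \<open>x \<alpha>\<close> is a linear combination of the relations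
  \<open>x \<alpha> + x (- \<alpha>) = 0\<close>.
\<close>

definition is_V_W ::
  "nat \<Rightarrow> ('k::field \<Rightarrow> 'b::ab_group_add \<Rightarrow> 'b) \<Rightarrow> ((nat \<Rightarrow> nat) \<Rightarrow> 'b \<Rightarrow> 'b) \<Rightarrow>
   ((nat \<Rightarrow> nat) \<Rightarrow> 'b set) \<Rightarrow> 'b set \<Rightarrow> ((nat \<Rightarrow> real) \<Rightarrow> 'b) \<Rightarrow> bool"
  where "is_V_W n scale act deg V x \<longleftrightarrow>
    module.span scale (x ` roots n) = V \<and>
    (\<forall>w\<in>carrier (sym_group n). \<forall>\<alpha>\<in>roots n. act w (x \<alpha>) = x (perm_vec w \<alpha>)) \<and>
    (\<forall>\<alpha>\<in>roots n. x \<alpha> \<in> deg (root_reflection n \<alpha>)) \<and>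
    (\<forall>\<alpha>\<in>roots n. x (- \<alpha>) = - x \<alpha>) \<and>
    (\<forall>c. (\<Sum>\<alpha>\<in>roots n. scale (c \<alpha>) (x \<alpha>)) = 0 \<longrightarrow>
      (\<exists>d. \<forall>\<alpha>\<in>roots n. c \<alpha> = d \<alpha> + d (- \<alpha>)))"

definition nilcoxeter ::
  "nat \<Rightarrow> ('k::field \<Rightarrow> 'b::ring_1 \<Rightarrow> 'b) \<Rightarrow> ((nat \<Rightarrow> real) \<Rightarrow> 'b) \<Rightarrow> 'b set"
  where "nilcoxeter n scale x = generated_subalgebra scale (x ` simple_roots n)"

definition B_prime ::
  "nat \<Rightarrow> ('k::field \<Rightarrow> 'b::ring_1 \<Rightarrow> 'b) \<Rightarrow> ((nat \<Rightarrow> real) \<Rightarrow> 'b) \<Rightarrow> 'b set"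
  where "B_prime n scale x = generated_subalgebra scale (x ` (pos_roots n - simple_roots n))"

end

theory Submission
  imports Defs
begin

text \<open>
  Write \<open>y a b\<close> for the generator of the root \<open>e\<^sub>a - e\<^sub>b\<close>, \<open>V'\<close> for the span of the nonsimple
  positive generators, \<open>N\<close> for the nilCoxeter algebra and \<open>B'\<close> for the subalgebra generated by
  \<open>V'\<close>. The monomials \<open>X\<close> along reduced words span \<open>N\<close>, so the theorem says that
  every element of the Nichols algebra \<open>B\<close> is a sum of products \<open>X p * b\<^sub>p\<close> with unique
  coefficients \<open>b\<^sub>p \<in> B'\<close>, and likewise for the products \<open>b\<^sub>p * X p\<close>.

  Existence uses the quadratic relations of type A: \<open>y\<^sub>a\<^sub>b\<^sup>2 = 0\<close>, commutation for disjoint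
  index pairs, and one relation for each triangle \<open>a, b, c\<close>. They hold because a primitive
  element of degree two vanishes. By induction on the degree it is enough that
  \<open>B = N + B V'\<close>, which means that \<open>N\<close> is stable under all \<open>y a b\<close> modulo the left ideal
  \<open>B V'\<close>. In fact \<open>y a b\<close> acts on \<open>B / B V'\<close> in the manner of the Bruhat operators of Fomin and
  Kirillov: it takes the monomial of a permutation \<open>w\<close> to a multiple of the monomial of
  \<open>s\<^sub>a\<^sub>b w\<close>, and this multiple is zero unless the length grows by exactly one
  (\<open>top_part_y_mult_X\<close>). The relations are stable under reversing all products, so the same
  argument in the opposite algebra gives \<open>B = B' N\<close>.

  Uniqueness uses the skew derivations \<open>\<partial>\<close> that the coproduct defines, with
  \<open>\<partial>\<^sub>\<alpha> (u v) = u \<partial>\<^sub>\<alpha> v + \<partial>\<^sub>\<alpha> u \<cdot> s\<^sub>\<alpha> v\<close>. For simple \<open>\<alpha>\<close> they vanish on \<open>B'\<close>, hence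
  \<open>\<partial>\<^sub>\<alpha> (b v) = b \<partial>\<^sub>\<alpha> v\<close> for \<open>b \<in> B'\<close>, and the twisted derivation \<open>\<partial>' = s\<^sub>\<alpha> \<partial>\<^sub>\<alpha>\<close> satisfies
  \<open>\<partial>' (v b) = \<partial>' v \<cdot> b\<close>. Iterating along a reduced word of \<open>w\<close> one obtains an operator that
  commutes with the coefficients, takes the monomial of \<open>w\<close> to 1 and kills the other monomials
  of this or of smaller length; this triangularity makes the monomials independent over \<open>B'\<close>.

  The derivations \<open>\<partial>\<^sub>\<alpha>\<close> need not preserve \<open>N\<close>, so the value of the iterated operator on a monomial is
  computed with a second family of skew derivations, taken from the other tensor factor of the
  coproduct. By coassociativity the two families commute, and they agree after applying the
  counit; the second one acts on monomials by deleting letters (\<open>left_der_X\<close>).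
\<close>


section \<open>Inversions and reduced words\<close>

text \<open>
  A permutation \<open>w\<close> is represented by \<open>p = w\<^sup>-\<^sup>1\<close>, so that left multiplication of \<open>w\<close> by the
  transposition of \<open>a\<close> and \<open>b\<close> becomes \<open>p \<circ> transpose a b\<close>, and \<open>i\<close> is a left descent of \<open>w\<close> iff
  \<open>p (Suc i) < p i\<close>.
\<close>

definition inversions :: "nat \<Rightarrow> (nat \<Rightarrow> nat) \<Rightarrow> (nat \<times> nat) set"
  where "inversions n p = {(a, b). 1 \<le> a \<and> a < b \<and> b \<le> n \<and> p b < p a}"

definition inv_count :: "nat \<Rightarrow> (nat \<Rightarrow> nat) \<Rightarrow> nat"
  where "inv_count n p = card (inversions n p)"

abbreviation adj :: "nat \<Rightarrow> nat \<Rightarrow> nat"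
  where "adj i \<equiv> transpose i (Suc i)"

definition descent :: "nat \<Rightarrow> (nat \<Rightarrow> nat) \<Rightarrow> nat \<Rightarrow> bool"
  where "descent n p i \<longleftrightarrow> 1 \<le> i \<and> i < n \<and> p (Suc i) < p i"

lemma finite_inversions: "finite (inversions n p)"
  by (rule finite_subset[of _ "{1..n} \<times> {1..n}"]) (auto simp: inversions_def)

lemma inversions_comp_adj:
  assumes "descent n p i"
  shows "inversions n p = insert (i, Suc i) (map_prod (adj i) (adj i) ` inversions n (p \<circ> adj i))"
proof -
  have i: "1 \<le> i" "i < n" "p (Suc i) < p i" using assms by (auto simp: descent_def)
  have "(a, b) \<in> insert (i, Suc i) (map_prod (adj i) (adj i) ` inversions n (p \<circ> adj i))"
    if "(a, b) \<in> inversions n p" for a b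
  proof (cases "(a, b) = (i, Suc i)")
    case False
    have "(adj i a, adj i b) \<in> inversions n (p \<circ> adj i)"
      using that False i by (auto simp: inversions_def transpose_def)
    then have "map_prod (adj i) (adj i) (adj i a, adj i b) \<in> map_prod (adj i) (adj i) ` inversions n (p \<circ> adj i)"
      by (rule imageI)
    then show ?thesis by simp
  qed simp
  moreover have "(adj i a, adj i b) \<in> inversions n p" if "(a, b) \<in> inversions n (p \<circ> adj i)" for a b
    using that i by (auto simp: inversions_def transpose_def split: if_splits)
  moreover have "(i, Suc i) \<in> inversions n p" using i by (simp add: inversions_def)
  ultimately show ?thesis by auto
qed

lemma inv_count_comp_descent:
  assumes "descent n p i"
  shows "inv_count n p = Suc (inv_count n (p \<circ> adj i))"
proof -
  have inj: "inj_on (map_prod (adj i) (adj i)) A" for A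
    by (rule inj_on_subset[of _ UNIV]) (auto intro!: prod.inj_map)
  have "(i, Suc i) \<notin> map_prod (adj i) (adj i) ` inversions n (p \<circ> adj i)"
    by (auto simp: inversions_def transpose_def split: if_splits)
  then show ?thesis
    unfolding inv_count_def inversions_comp_adj[OF assms]
    by (simp add: finite_inversions card_image[OF inj])
qed

lemma inv_count_comp_ascent:
  assumes "1 \<le> i" "i < n" "p i < p (Suc i)"
  shows "inv_count n (p \<circ> adj i) = Suc (inv_count n p)"
proof -
  have "descent n (p \<circ> adj i) i" using assms by (simp add: descent_def)
  from inv_count_comp_descent[OF this] show ?thesis by (simp add: o_assoc[symmetric])
qed

function red_word :: "nat \<Rightarrow> (nat \<Rightarrow> nat) \<Rightarrow> nat list"
  where "red_word n p = (if \<exists>i. descent n p i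
    then (let i = (LEAST i. descent n p i) in i # red_word n (p \<circ> adj i)) else [])"
  by pat_completeness auto
termination
proof (relation "measure (\<lambda>(n, p). inv_count n p)")
  fix n i p assume "\<exists>i. descent n p i" "i = (LEAST i. descent n p i)"
  then have "descent n p i" by (simp add: LeastI_ex)
  from inv_count_comp_descent[OF this]
  show "((n, p \<circ> adj i), n, p) \<in> measure (\<lambda>(n, p). inv_count n p)" by simp
qed simp

declare red_word.simps[simp del]

text \<open>
  A permutation without descents is increasing, hence \<open>i \<le> p i\<close> for all \<open>i\<close>; since both sides
  have the same sum over \<open>{1..n}\<close>, equality holds everywhere.
\<close>

lemma no_descent_imp_id:
  assumes p: "p permutes {1..n}" and nd: "\<And>i. \<not> descent n p i"
  shows "p = id"
proof -
  have mono: "p i < p (Suc i)" if "1 \<le> i" "i < n" for i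
  proof -
    have "p i \<noteq> p (Suc i)" by (simp add: inj_eq[OF permutes_inj[OF p]])
    with nd[of i] that show ?thesis by (auto simp: descent_def)
  qed
  have img: "p i \<in> {1..n}" if "i \<in> {1..n}" for i using permutes_in_image[OF p] that by simp
  have ge: "i \<le> p i" if "1 \<le> i" "i \<le> n" for i
    using that
  proof (induction i rule: dec_induct)
    case base
    then show ?case using img[of 1] by simp
  next
    case (step m)
    then show ?case using mono[of m] by fastforce
  qed
  have "(\<Sum>i\<in>{1..n}. p i) = (\<Sum>i\<in>{1..n}. i)"
    using sum.permute[OF p, of "\<lambda>i. i"] by (simp add: o_def)
  then have eq: "p i = i" if "i \<in> {1..n}" for i
    using sum_mono_inv[of "\<lambda>i. i" "{1..n}" p i] ge that by auto
  show ?thesis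
  proof
    fix i show "p i = id i"
      using eq[of i] permutes_not_in[OF p, of i] by (cases "i \<in> {1..n}") auto
  qed
qed

lemma descent_exists:
  assumes "p permutes {1..n}" "p \<noteq> id"
  obtains i where "descent n p i"
  using no_descent_imp_id[OF assms(1)] assms(2) by blast

lemma red_word_id: "red_word n id = []"
  by (subst red_word.simps) (auto simp: descent_def)

lemma inv_count_id: "inv_count n id = 0"
proof -
  have "inversions n id = {}" by (auto simp: inversions_def)
  then show ?thesis by (simp add: inv_count_def)
qed

lemma permutes_adj:
  assumes "p permutes {1..n}" "1 \<le> i" "i < n"
  shows "(p \<circ> adj i) permutes {1..n}"
proof (rule permutes_compose[OF _ assms(1)])
  show "adj i permutes {1..n}" using assms by (intro permutes_swap_id) auto
qed

lemma inv_count_0: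
  assumes "p permutes {1..n}" "inv_count n p = 0"
  shows "p = id"
proof (rule no_descent_imp_id[OF assms(1)])
  fix i show "\<not> descent n p i"
  proof
    assume "descent n p i"
    from inv_count_comp_descent[OF this] show False unfolding assms(2) by simp
  qed
qed

lemma red_word_cases:
  assumes p: "p permutes {1..n}"
  obtains "p = id" "red_word n p = []" "inv_count n p = 0"
  | i where "p \<noteq> id" "descent n p i" "red_word n p = i # red_word n (p \<circ> adj i)"
      "(p \<circ> adj i) permutes {1..n}" "inv_count n p = Suc (inv_count n (p \<circ> adj i))"
proof (cases "p = id")
  case True
  with that(1) show ?thesis by (simp add: red_word_id inv_count_id)
next
  case False
  have ex: "\<exists>i. descent n p i" using descent_exists[OF p False] by blast
  define i where "i = (LEAST i. descent n p i)"
  have i: "descent n p i" unfolding i_def using ex by (rule LeastI_ex)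
  show ?thesis
  proof (rule that(2)[OF False i])
    show "red_word n p = i # red_word n (p \<circ> adj i)"
      unfolding i_def using ex by (subst (1) red_word.simps) (simp only: if_True Let_def)
    show "(p \<circ> adj i) permutes {1..n}" using i by (intro permutes_adj[OF p]) (auto simp: descent_def)
  qed (rule inv_count_comp_descent[OF i])
qed

lemma permutation_word_induct [consumes 1, case_names id step]:
  assumes "p permutes {1..n}" "P id"
    and "\<And>p i. p permutes {1..n} \<Longrightarrow> descent n p i \<Longrightarrow> red_word n p = i # red_word n (p \<circ> adj i) \<Longrightarrow>
      (p \<circ> adj i) permutes {1..n} \<Longrightarrow> inv_count n p = Suc (inv_count n (p \<circ> adj i)) \<Longrightarrow>
      P (p \<circ> adj i) \<Longrightarrow> P p"
  shows "P p"
  using assms(1)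
proof (induction "inv_count n p" arbitrary: p rule: less_induct)
  case less
  from less.prems show ?case
  proof (cases rule: red_word_cases)
    case 1
    with assms(2) show ?thesis by simp
  next
    case (2 i)
    with less show ?thesis by (intro assms(3)[of p i]) auto
  qed
qed


section \<open>Algebras with the quadratic relations of type A\<close>

text \<open>
  The quadratic relations of the Fomin-Kirillov algebra. The multiplication is a parameter, not the
  one of a ring type, because the axioms also hold for the opposite multiplication: both tensor
  product decompositions are instances of one argument.
\<close>

locale fk_algebra = vector_space scale
  for scale :: "'k::field \<Rightarrow> 'b::ab_group_add \<Rightarrow> 'b" +
  fixes n :: nat and mult :: "'b \<Rightarrow> 'b \<Rightarrow> 'b" (infixl "\<odot>" 70) and unit :: 'b
    and y :: "nat \<Rightarrow> nat \<Rightarrow> 'b"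
  assumes assoc: "(a \<odot> b) \<odot> c = a \<odot> (b \<odot> c)"
    and unit_left: "unit \<odot> a = a" and unit_right: "a \<odot> unit = a"
    and add_left: "(a + b) \<odot> c = a \<odot> c + b \<odot> c" and add_right: "a \<odot> (b + c) = a \<odot> b + a \<odot> c"
    and scale_left: "scale r a \<odot> b = scale r (a \<odot> b)" and scale_right: "a \<odot> scale r b = scale r (a \<odot> b)"
    and y_swap: "i \<in> {1..n} \<Longrightarrow> j \<in> {1..n} \<Longrightarrow> i \<noteq> j \<Longrightarrow> y j i = - y i j"
    and y_square: "i \<in> {1..n} \<Longrightarrow> j \<in> {1..n} \<Longrightarrow> i \<noteq> j \<Longrightarrow> y i j \<odot> y i j = 0"
    and y_commute: "{i, j, k, l} \<subseteq> {1..n} \<Longrightarrow> distinct [i, j, k, l] \<Longrightarrow> y i j \<odot> y k l = y k l \<odot> y i j"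
    and y_triangle: "{i, j, k} \<subseteq> {1..n} \<Longrightarrow> distinct [i, j, k] \<Longrightarrow>
      y i j \<odot> y j k = y j k \<odot> y i k + y i k \<odot> y i j"
begin

lemma zero_left: "0 \<odot> a = 0" using add_left[of 0 0 a] by simp
lemma zero_right: "a \<odot> 0 = 0" using add_right[of a 0 0] by simp
lemma minus_left: "(- a) \<odot> b = - (a \<odot> b)"
  using add_left[of a "- a" b] by (simp add: zero_left eq_neg_iff_add_eq_0 add.commute)
lemma minus_right: "a \<odot> (- b) = - (a \<odot> b)"
  using add_right[of a b "- b"] by (simp add: zero_right eq_neg_iff_add_eq_0 add.commute)
lemma diff_left: "(a - b) \<odot> c = a \<odot> c - b \<odot> c"
  using add_left[of a "- b" c] by (simp add: minus_left)
lemma diff_right: "a \<odot> (b - c) = a \<odot> b - a \<odot> c"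
  using add_right[of a b "- c"] by (simp add: minus_right)

lemmas mult_simps = zero_left zero_right minus_left minus_right diff_left diff_right
  add_left add_right scale_left scale_right unit_left unit_right

lemma mult_span_right:
  assumes "u \<in> span S" "\<And>v. v \<in> S \<Longrightarrow> a \<odot> v \<in> span T"
  shows "a \<odot> u \<in> span T"
  using assms(1)
  by (induction rule: span_induct_alt)
     (auto simp: mult_simps intro!: span_zero span_add span_scale assms(2))

lemma mult_span_left:
  assumes "u \<in> span S" "\<And>v. v \<in> S \<Longrightarrow> v \<odot> a \<in> span T"
  shows "u \<odot> a \<in> span T"
  using assms(1)
  by (induction rule: span_induct_alt)
     (auto simp: mult_simps intro!: span_zero span_add span_scale assms(2))

text \<open>
  Both sides equal \<open>y i j \<odot> (y i k \<odot> y j k)\<close>, by one triangle relation and \<open>y\<^sup>2 = 0\<close>.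
\<close>

lemma y_braid:
  assumes "{i, j, k} \<subseteq> {1..n}" "distinct [i, j, k]"
  shows "y i j \<odot> (y j k \<odot> y i j) = y j k \<odot> (y i j \<odot> y j k)"
proof -
  \<comment> \<open>the triangle relation read in the opposite direction\<close>
  have r: "y j k \<odot> y i j = y i j \<odot> y i k + y i k \<odot> y j k"
    using y_triangle[of k j i] y_swap[of i j] y_swap[of j k] y_swap[of i k] assms
    by (simp add: mult_simps)
  have "y i j \<odot> (y j k \<odot> y i j) = y i j \<odot> (y i k \<odot> y j k)"
    using y_square[of i j] assms unfolding r by (simp add: mult_simps assoc[symmetric])
  moreover have "y j k \<odot> (y i j \<odot> y j k) = y i j \<odot> (y i k \<odot> y j k)"
    using y_square[of j k] assms unfolding assoc[symmetric] r by (simp add: mult_simps assoc)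
  ultimately show ?thesis by simp
qed

text \<open>
  \<open>X p\<close> is the nilCoxeter monomial of the permutation \<open>p\<^sup>-\<^sup>1\<close>.
\<close>

definition X :: "(nat \<Rightarrow> nat) \<Rightarrow> 'b"
  where "X p = foldr (\<lambda>i z. y i (Suc i) \<odot> z) (red_word n p) unit"

lemma X_id: "X id = unit" by (simp add: X_def red_word_id)

text \<open>
  Matsumoto's theorem in the form needed here: the monomial does not depend on the reduced word.
  Two different descents \<open>i\<close>, \<open>j\<close> of \<open>p\<close> can be continued to a commutation or to a braid with the
  same end point, and the monomials of the shorter permutations are independent of the word by
  induction.
\<close>

lemma X_descent:
  assumes "p permutes {1..n}" "descent n p i"
  shows "X p = y i (Suc i) \<odot> X (p \<circ> adj i)"
  using assms
proof (induction "inv_count n p" arbitrary: p i rule: less_induct)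
  case less
  note IH = less.hyps
  from less.prems(1) show ?case
  proof (cases rule: red_word_cases)
    case 1
    with less.prems show ?thesis by (simp add: descent_def)
  next
    case (2 j)
    have Xj: "X p = y j (Suc j) \<odot> X (p \<circ> adj j)" by (simp add: X_def 2(3))
    have perm_i: "(p \<circ> adj i) permutes {1..n}"
      using less.prems by (intro permutes_adj) (auto simp: descent_def)
    have inv_i: "inv_count n p = Suc (inv_count n (p \<circ> adj i))"
      by (rule inv_count_comp_descent[OF less.prems(2)])
    have stepi: "X (p \<circ> adj i) = y k (Suc k) \<odot> X (p \<circ> adj i \<circ> adj k)" if "descent n (p \<circ> adj i) k" for k
      using IH[OF _ perm_i that] inv_i by simp
    have stepj: "X (p \<circ> adj j) = y k (Suc k) \<odot> X (p \<circ> adj j \<circ> adj k)" if "descent n (p \<circ> adj j) k" for k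
      using IH[OF _ 2(4) that] 2(5) by simp
    have step2: "X (p \<circ> adj j \<circ> adj k) = y l (Suc l) \<odot> X (p \<circ> adj j \<circ> adj k \<circ> adj l)"
      if "descent n (p \<circ> adj j) k" "descent n (p \<circ> adj j \<circ> adj k) l" for k l
    proof (rule IH[OF _ _ that(2)])
      show "inv_count n (p \<circ> adj j \<circ> adj k) < inv_count n p"
        using 2(5) inv_count_comp_descent[OF that(1)] by simp
      show "(p \<circ> adj j \<circ> adj k) permutes {1..n}"
        using permutes_adj[OF 2(4)] that(1) by (auto simp: descent_def)
    qed
    have step2': "X (p \<circ> adj i \<circ> adj k) = y l (Suc l) \<odot> X (p \<circ> adj i \<circ> adj k \<circ> adj l)"
      if "descent n (p \<circ> adj i) k" "descent n (p \<circ> adj i \<circ> adj k) l" for k l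
    proof (rule IH[OF _ _ that(2)])
      show "inv_count n (p \<circ> adj i \<circ> adj k) < inv_count n p"
        using inv_i inv_count_comp_descent[OF that(1)] by simp
      show "(p \<circ> adj i \<circ> adj k) permutes {1..n}"
        using permutes_adj[OF perm_i] that(1) by (auto simp: descent_def)
    qed
    note di = less.prems(2) and dj = 2(2)
    consider "i = j" | "Suc i < j \<or> Suc j < i" | "i = Suc j" | "j = Suc i" by linarith
    then show ?thesis
    proof cases
      case 1
      with Xj show ?thesis by simp
    next
      case far: 2
      have d1: "descent n (p \<circ> adj j) i" and d2: "descent n (p \<circ> adj i) j"
        using far di dj by (auto simp: descent_def transpose_def)
      have eq: "p \<circ> adj j \<circ> adj i = p \<circ> adj i \<circ> adj j"
        using far by (auto simp: fun_eq_iff transpose_def)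
      have "y j (Suc j) \<odot> y i (Suc i) = y i (Suc i) \<odot> y j (Suc j)"
        using far di dj by (intro y_commute) (auto simp: descent_def)
      then show ?thesis
        unfolding Xj stepj[OF d1] stepi[OF d2] eq by (simp only: assoc[symmetric])
    next
      case adjc: 3
      have d1: "descent n (p \<circ> adj j) i" "descent n (p \<circ> adj j \<circ> adj i) j"
        and d2: "descent n (p \<circ> adj i) j" "descent n (p \<circ> adj i \<circ> adj j) i"
        using adjc di dj by (auto simp: descent_def transpose_def)
      have eq: "p \<circ> adj j \<circ> adj i \<circ> adj j = p \<circ> adj i \<circ> adj j \<circ> adj i"
        using adjc by (auto simp: fun_eq_iff transpose_def)
      have "y j (Suc j) \<odot> (y i (Suc i) \<odot> y j (Suc j)) = y i (Suc i) \<odot> (y j (Suc j) \<odot> y i (Suc i))"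
        unfolding adjc using adjc di dj by (intro y_braid) (auto simp: descent_def)
      then show ?thesis
        unfolding Xj stepj[OF d1(1)] stepi[OF d2(1)] step2[OF d1] step2'[OF d2] eq
        by (simp only: assoc[symmetric])
    next
      case adjc: 4
      have d1: "descent n (p \<circ> adj j) i" "descent n (p \<circ> adj j \<circ> adj i) j"
        and d2: "descent n (p \<circ> adj i) j" "descent n (p \<circ> adj i \<circ> adj j) i"
        using adjc di dj by (auto simp: descent_def transpose_def)
      have eq: "p \<circ> adj j \<circ> adj i \<circ> adj j = p \<circ> adj i \<circ> adj j \<circ> adj i"
        using adjc by (auto simp: fun_eq_iff transpose_def)
      have "y i (Suc i) \<odot> (y j (Suc j) \<odot> y i (Suc i)) = y j (Suc j) \<odot> (y i (Suc i) \<odot> y j (Suc j))"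
        unfolding adjc using adjc di dj by (intro y_braid) (auto simp: descent_def)
      then show ?thesis
        unfolding Xj stepj[OF d1(1)] stepi[OF d2(1)] step2[OF d1] step2'[OF d2] eq
        by (simp only: assoc[symmetric])
    qed
  qed
qed

lemma y_mult_X:
  assumes p: "p permutes {1..n}" and i: "1 \<le> i" "i < n"
  shows "y i (Suc i) \<odot> X p = (if p i < p (Suc i) then X (p \<circ> adj i) else 0)"
proof (cases "p i < p (Suc i)")
  case True
  have "descent n (p \<circ> adj i) i" using True i by (simp add: descent_def)
  from X_descent[OF permutes_adj[OF p i] this] True show ?thesis by (simp add: o_assoc[symmetric])
next
  case False
  have "p i \<noteq> p (Suc i)" by (simp add: inj_eq[OF permutes_inj[OF p]])
  with False i have "descent n p i" by (simp add: descent_def)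
  from X_descent[OF p this] False i y_square[of i "Suc i"] show ?thesis
    by (simp add: mult_simps assoc[symmetric])
qed

lemma y_mult_span_X:
  assumes "1 \<le> i" "i < n" "v \<in> span (X ` {p. p permutes {1..n}})"
  shows "y i (Suc i) \<odot> v \<in> span (X ` {p. p permutes {1..n}})"
proof (rule mult_span_right[OF assms(3)])
  fix v assume "v \<in> X ` {p. p permutes {1..n}}"
  then obtain p where p: "v = X p" "p permutes {1..n}" by blast
  have "X (p \<circ> adj i) \<in> span (X ` {p. p permutes {1..n}})"
    using permutes_adj[OF p(2) assms(1,2)] by (intro span_base) blast
  then show "y i (Suc i) \<odot> v \<in> span (X ` {p. p permutes {1..n}})"
    unfolding p(1) y_mult_X[OF p(2) assms(1,2)] by (simp add: span_zero)
qed

section \<open>Products of nilCoxeter monomials and nonsimple generators\<close>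

primrec words :: "nat \<Rightarrow> 'b set"
  where "words 0 = span {unit}"
  | "words (Suc m) = span {y a b \<odot> u | a b u. 1 \<le> a \<and> a < b \<and> b \<le> n \<and> u \<in> words m}"

text \<open>
  The degree \<open>m + 1\<close> part of the left ideal generated by the nonsimple generators.
\<close>

definition words_nonsimple :: "nat \<Rightarrow> 'b set"
  where "words_nonsimple m = span {u \<odot> y a b | a b u. 1 \<le> a \<and> Suc a < b \<and> b \<le> n \<and> u \<in> words m}"

lemma y_mult_words:
  assumes "1 \<le> a" "a < b" "b \<le> n" "u \<in> words m"
  shows "y a b \<odot> u \<in> words (Suc m)"
  using assms by (auto intro!: span_base)

lemma y_mult_words_nonsimple:
  assumes "1 \<le> a" "a < b" "b \<le> n" "u \<in> words_nonsimple m"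
  shows "y a b \<odot> u \<in> words_nonsimple (Suc m)"
  unfolding words_nonsimple_def
proof (rule mult_span_right[OF assms(4)[unfolded words_nonsimple_def]])
  fix v assume "v \<in> {u \<odot> y a b | a b u. 1 \<le> a \<and> Suc a < b \<and> b \<le> n \<and> u \<in> words m}"
  then obtain c d u where v: "v = u \<odot> y c d" "1 \<le> c" "Suc c < d" "d \<le> n" "u \<in> words m" by blast
  have "y a b \<odot> v = (y a b \<odot> u) \<odot> y c d" by (simp add: v(1) assoc)
  then show "y a b \<odot> v \<in> span {u \<odot> y a b | a b u. 1 \<le> a \<and> Suc a < b \<and> b \<le> n \<and> u \<in> words (Suc m)}"
    using y_mult_words[OF assms(1-3) v(5)] v(2-4) by (intro span_base) blast
qed

text \<open>
  Modulo the left ideal, \<open>z\<close> is a multiple of \<open>X q\<close>. The degree of \<open>z\<close> is \<open>m + 1\<close>, so a nonzero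
  multiple is only possible if \<open>q\<close> has \<open>m + 1\<close> inversions; recording this keeps the induction below
  inside one degree.
\<close>

definition top_part :: "nat \<Rightarrow> (nat \<Rightarrow> nat) \<Rightarrow> 'b \<Rightarrow> bool"
  where "top_part m q z \<longleftrightarrow>
    (\<exists>c. z - scale c (X q) \<in> words_nonsimple m \<and> (c \<noteq> 0 \<longrightarrow> inv_count n q = Suc m))"

lemma top_part_add:
  assumes "top_part m q z" "top_part m q w"
  shows "top_part m q (z + w)"
proof -
  obtain c d where c: "z - scale c (X q) \<in> words_nonsimple m" "c \<noteq> 0 \<longrightarrow> inv_count n q = Suc m"
    and d: "w - scale d (X q) \<in> words_nonsimple m" "d \<noteq> 0 \<longrightarrow> inv_count n q = Suc m"
    using assms unfolding top_part_def by blast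
  have eq: "z + w - scale (c + d) (X q) = (z - scale c (X q)) + (w - scale d (X q))"
    by (simp add: scale_left_distrib)
  from c d have "z + w - scale (c + d) (X q) \<in> words_nonsimple m"
    unfolding eq by (simp add: words_nonsimple_def span_add)
  with c d show ?thesis unfolding top_part_def by (intro exI[of _ "c + d"]) auto
qed

lemma top_part_scale:
  assumes "top_part m q z"
  shows "top_part m q (scale r z)"
proof -
  obtain c where c: "z - scale c (X q) \<in> words_nonsimple m" "c \<noteq> 0 \<longrightarrow> inv_count n q = Suc m"
    using assms unfolding top_part_def by blast
  have "scale r z - scale (r * c) (X q) = scale r (z - scale c (X q))"
    by (simp add: scale_right_diff_distrib)
  with c have "scale r z - scale (r * c) (X q) \<in> words_nonsimple m"
    by (simp add: words_nonsimple_def span_scale)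
  with c show ?thesis unfolding top_part_def by (intro exI[of _ "r * c"]) auto
qed

lemma top_part_diff:
  assumes "top_part m q z" "top_part m q w"
  shows "top_part m q (z - w)"
  using top_part_add[OF assms(1) top_part_scale[OF assms(2), of "- 1"]] by simp

lemma top_part_words_nonsimple: "z \<in> words_nonsimple m \<Longrightarrow> top_part m q z"
  unfolding top_part_def by (intro exI[of _ 0]) simp

lemma top_part_mult:
  assumes z: "top_part m q z" and ab: "1 \<le> a" "a < b" "b \<le> n"
    and q: "inv_count n q = Suc m \<Longrightarrow> top_part (Suc m) r (y a b \<odot> X q)"
  shows "top_part (Suc m) r (y a b \<odot> z)"
proof -
  obtain c where c: "z - scale c (X q) \<in> words_nonsimple m" "c \<noteq> 0 \<longrightarrow> inv_count n q = Suc m"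
    using z unfolding top_part_def by blast
  have "y a b \<odot> z = scale c (y a b \<odot> X q) + y a b \<odot> (z - scale c (X q))"
    by (simp add: mult_simps)
  moreover have "top_part (Suc m) r (scale c (y a b \<odot> X q))"
  proof (cases "c = 0")
    case True
    then show ?thesis by (simp add: top_part_words_nonsimple words_nonsimple_def span_zero)
  next
    case False
    with c q show ?thesis by (intro top_part_scale) simp
  qed
  ultimately show ?thesis
    using top_part_add top_part_words_nonsimple[OF y_mult_words_nonsimple[OF ab c(1)]] by metis
qed

lemma top_part_simple_X:
  assumes p: "p permutes {1..n}" and i: "1 \<le> i" "i < n"
  shows "top_part (inv_count n p) (p \<circ> adj i) (y i (Suc i) \<odot> X p)"
proof (cases "p i < p (Suc i)")
  case True
  have "inv_count n (p \<circ> adj i) = Suc (inv_count n p)"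
    by (rule inv_count_comp_ascent[OF i True])
  with True show ?thesis
    unfolding y_mult_X[OF p i] top_part_def
    by (intro exI[of _ 1]) (simp add: words_nonsimple_def span_zero)
next
  case False
  then show ?thesis unfolding y_mult_X[OF p i]
    by (simp add: top_part_words_nonsimple words_nonsimple_def span_zero)
qed

lemma top_part_mult_simple:
  assumes "top_part m q z" "q permutes {1..n}" and i: "1 \<le> i" "i < n"
  shows "top_part (Suc m) (q \<circ> adj i) (y i (Suc i) \<odot> z)"
  using assms top_part_simple_X[OF assms(2-4)] by (intro top_part_mult[OF assms(1)]) auto

lemma permutes_comp_transpose:
  assumes "p permutes {1..n}" "a \<in> {1..n}" "b \<in> {1..n}"
  shows "(p \<circ> transpose a b) permutes {1..n}"
  by (rule permutes_compose[OF permutes_swap_id[OF assms(2,3)] assms(1)])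

text \<open>
  The operator of a root on the nilCoxeter algebra modulo the left ideal. The induction is on the
  number of inversions of \<open>p\<close> and, for equally many inversions, on the height \<open>b - a\<close> of the root.
  A descent of \<open>p\<close> whose indices avoid \<open>a\<close> and \<open>b\<close> commutes with \<open>y a b\<close>. A descent at \<open>b - 1\<close> or \<open>a\<close>
  gives a triangle relation with roots of smaller height. The remaining case is a descent at \<open>b\<close> or
  \<open>a - 1\<close>, where the triangle relation produces a root of larger height, applied to the monomial of
  another permutation \<open>q\<close> with as many inversions as \<open>p\<close>. If \<open>p\<close> has only descents of this last
  kind, it is increasing on \<open>{a..b}\<close>, and then \<open>q\<close> has a descent strictly between the two indices of
  the larger root. It commutes with that root, and the induction applies to shorter permutations.
\<close>

lemma top_part_y_mult_X:
  assumes "p permutes {1..n}" "1 \<le> a" "a < b" "b \<le> n"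
  shows "top_part (inv_count n p) (p \<circ> transpose a b) (y a b \<odot> X p)"
  using assms
proof (induction "inv_count n p * Suc n + (b - a)" arbitrary: p a b rule: less_induct)
  case less
  note p = less.prems(1) and ab = less.prems(2-4)
  \<comment> \<open>fewer inversions, any root: the height is at most \<open>n\<close>, so the measure decreases\<close>
  have IH1: "top_part (inv_count n p') (p' \<circ> transpose a' b') (y a' b' \<odot> X p')"
    if "p' permutes {1..n}" "inv_count n p' < inv_count n p" "1 \<le> a'" "a' < b'" "b' \<le> n" for p' a' b'
  proof (rule less.hyps[OF _ that(1,3-5)])
    have "Suc (inv_count n p') * Suc n \<le> inv_count n p * Suc n"
      using that(2) by (intro mult_le_mono1) simp
    then show "inv_count n p' * Suc n + (b' - a') < inv_count n p * Suc n + (b - a)"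
      using that(3-5) ab by simp
  qed
  \<comment> \<open>as many inversions, smaller height\<close>
  have IH2: "top_part (inv_count n p') (p' \<circ> transpose a' b') (y a' b' \<odot> X p')"
    if "p' permutes {1..n}" "inv_count n p' = inv_count n p" "1 \<le> a'" "a' < b'" "b' \<le> n"
      "b' - a' < b - a" for p' a' b'
    using that by (intro less.hyps) auto
  note triangle = y_triangle[simplified]
  show ?case
  proof (cases "Suc a = b")
    case True
    then show ?thesis using top_part_simple_X[OF p, of a] ab by auto
  next
    case False
    with ab have nonsimple: "Suc a < b" by simp
    show ?thesis
    proof (cases "p = id")
      case True
      have "unit \<odot> y a b \<in> words_nonsimple 0"
        unfolding words_nonsimple_def using ab nonsimple
        by (intro span_base CollectI exI[of _ a] exI[of _ b] exI[of _ unit]) (simp add: span_base)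
      then show ?thesis unfolding True
        by (simp add: X_id unit_left unit_right inv_count_id top_part_words_nonsimple)
    next
      case not_id: False
      have desc: "X p = y i (Suc i) \<odot> X (p \<circ> adj i) \<and> (p \<circ> adj i) permutes {1..n} \<and>
          inv_count n p = Suc (inv_count n (p \<circ> adj i)) \<and> 1 \<le> i \<and> i < n"
        if "descent n p i" for i
        using X_descent[OF p that] permutes_adj[OF p, of i] inv_count_comp_descent[OF that] that
        by (simp add: descent_def)
      \<comment> \<open>a descent away from both ends is moved to the left\<close>
      have comm: "top_part (inv_count n q) (q \<circ> transpose c d) (y c d \<odot> X q)"
        if q: "q permutes {1..n}" "inv_count n q = inv_count n p" "descent n q i"
          and cd: "1 \<le> c" "c < d" "d \<le> n" "i \<noteq> c" "i \<noteq> d" "Suc i \<noteq> c" "Suc i \<noteq> d" for q i c d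
      proof -
        have i: "1 \<le> i" "i < n" using q(3) by (auto simp: descent_def)
        have perm: "(q \<circ> adj i) permutes {1..n}" by (rule permutes_adj[OF q(1) i])
        have inv: "inv_count n q = Suc (inv_count n (q \<circ> adj i))" by (rule inv_count_comp_descent[OF q(3)])
        have perm': "(q \<circ> adj i \<circ> transpose c d) permutes {1..n}"
          using cd by (intro permutes_comp_transpose[OF perm]) auto
        have eq: "q \<circ> adj i \<circ> transpose c d \<circ> adj i = q \<circ> transpose c d"
          using cd by (auto simp: fun_eq_iff transpose_def)
        have "y c d \<odot> X q = y i (Suc i) \<odot> (y c d \<odot> X (q \<circ> adj i))"
          unfolding X_descent[OF q(1,3)] assoc[symmetric]
          using cd i y_commute[of c d i "Suc i"] by simp
        moreover have "top_part (inv_count n q) (q \<circ> transpose c d)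
            (y i (Suc i) \<odot> (y c d \<odot> X (q \<circ> adj i)))"
          using top_part_mult_simple[OF IH1[OF perm _ cd(1-3)] perm' i] inv q(2) unfolding eq by simp
        ultimately show ?thesis by simp
      qed
      consider i where "descent n p i" "i \<noteq> a" "i \<noteq> b" "Suc i \<noteq> a" "Suc i \<noteq> b"
        | "descent n p (b - 1)" | "descent n p a"
        | "\<And>i. descent n p i \<Longrightarrow> i = b \<or> Suc i = a" by fastforce
      then show ?thesis
      proof cases
        case 1
        show ?thesis by (rule comm[OF p refl 1(1) ab 1(2-)])
      next
        case 2
        define k where "k = b - 1"
        have k: "b = Suc k" "a < k" using nonsimple by (auto simp: k_def)
        from 2 desc[of k] have d: "X p = y k b \<odot> X (p \<circ> adj k)" "(p \<circ> adj k) permutes {1..n}"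
          "inv_count n p = Suc (inv_count n (p \<circ> adj k))" "1 \<le> k" "k < n" by (simp_all add: k)
        let ?p = "p \<circ> adj k"
        have "y a b \<odot> y k b = y k b \<odot> y a k - y a k \<odot> y a b"
          using triangle[of a b k] y_swap[of k b] ab k d(4,5) by (simp add: mult_simps algebra_simps)
        then have eq: "y a b \<odot> X p = y k b \<odot> (y a k \<odot> X ?p) - y a k \<odot> (y a b \<odot> X ?p)"
          unfolding d(1) assoc[symmetric] by (simp add: mult_simps)
        have perm: "(?p \<circ> transpose a k) permutes {1..n}" "(?p \<circ> transpose a b) permutes {1..n}"
          using permutes_comp_transpose[OF d(2), of a k] permutes_comp_transpose[OF d(2), of a b] ab k d(4,5)
          by simp_all
        have e1: "?p \<circ> transpose a k \<circ> adj k = p \<circ> transpose a b"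
          and e2: "?p \<circ> transpose a b \<circ> transpose a k = p \<circ> transpose a b"
          using k by (auto simp: fun_eq_iff transpose_def)
        have t1: "top_part (inv_count n p) (p \<circ> transpose a b) (y k b \<odot> (y a k \<odot> X ?p))"
          using top_part_mult_simple[OF IH1[OF d(2) _ ab(1) k(2)] perm(1) d(4,5)] d(3,5) unfolding e1
          by (simp add: k(1))
        have "top_part (inv_count n ?p) (?p \<circ> transpose a b) (y a b \<odot> X ?p)"
          using IH1[OF d(2) _ ab] d(3) by simp
        then have "top_part (Suc (inv_count n ?p)) (?p \<circ> transpose a b \<circ> transpose a k)
            (y a k \<odot> (y a b \<odot> X ?p))"
        proof (rule top_part_mult)
          assume "inv_count n (?p \<circ> transpose a b) = Suc (inv_count n ?p)"
          then show "top_part (Suc (inv_count n ?p)) (?p \<circ> transpose a b \<circ> transpose a k)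
              (y a k \<odot> X (?p \<circ> transpose a b))"
            using IH2[OF perm(2) _ ab(1) k(2)] d(3,5) k by simp
        qed (use ab k d in auto)
        with t1 show ?thesis unfolding eq d(3)[symmetric] e2 by (intro top_part_diff)
      next
        case 3
        define k where "k = Suc a"
        from 3 desc[of a] have d: "X p = y a k \<odot> X (p \<circ> adj a)" "(p \<circ> adj a) permutes {1..n}"
          "inv_count n p = Suc (inv_count n (p \<circ> adj a))" "1 \<le> a" "a < n" by (simp_all add: k_def)
        have k: "a < k" "k < b" "1 \<le> k" using nonsimple by (auto simp: k_def)
        let ?p = "p \<circ> adj a"
        have "y a b \<odot> y a k = y a k \<odot> y k b - y k b \<odot> y a b"
          using triangle[of b a k] y_swap[of a b] y_swap[of k b] ab k
          by (simp add: mult_simps algebra_simps)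
        then have eq: "y a b \<odot> X p = y a k \<odot> (y k b \<odot> X ?p) - y k b \<odot> (y a b \<odot> X ?p)"
          unfolding d(1) assoc[symmetric] by (simp add: mult_simps)
        have perm: "(?p \<circ> transpose k b) permutes {1..n}" "(?p \<circ> transpose a b) permutes {1..n}"
          using permutes_comp_transpose[OF d(2), of k b] permutes_comp_transpose[OF d(2), of a b] ab k d(4,5)
          by simp_all
        have e1: "?p \<circ> transpose k b \<circ> adj a = p \<circ> transpose a b"
          and e2: "?p \<circ> transpose a b \<circ> transpose k b = p \<circ> transpose a b"
          using k by (auto simp: fun_eq_iff transpose_def k_def)
        have t1: "top_part (inv_count n p) (p \<circ> transpose a b) (y a k \<odot> (y k b \<odot> X ?p))"
          using top_part_mult_simple[OF IH1[OF d(2) _ k(3,2) ab(3)] perm(1) d(4,5)] d(3) unfolding e1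
          by (simp add: k_def)
        have "top_part (inv_count n ?p) (?p \<circ> transpose a b) (y a b \<odot> X ?p)"
          using IH1[OF d(2) _ ab] d(3) by simp
        then have "top_part (Suc (inv_count n ?p)) (?p \<circ> transpose a b \<circ> transpose k b)
            (y k b \<odot> (y a b \<odot> X ?p))"
        proof (rule top_part_mult)
          assume "inv_count n (?p \<circ> transpose a b) = Suc (inv_count n ?p)"
          then show "top_part (Suc (inv_count n ?p)) (?p \<circ> transpose a b \<circ> transpose k b)
              (y k b \<odot> X (?p \<circ> transpose a b))"
            using IH2[OF perm(2) _ k(3,2) ab(3)] d(3) k by simp
        qed (use ab k d in auto)
        with t1 show ?thesis unfolding eq d(3)[symmetric] e2 by (intro top_part_diff)
      next
        case 4
        have mono_step: "p j < p (Suc j)" if "a \<le> j" "j < b" for j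
        proof -
          have "\<not> descent n p j" using 4[of j] that by auto
          moreover have "p j \<noteq> p (Suc j)" by (simp add: inj_eq[OF permutes_inj[OF p]])
          ultimately show ?thesis using that ab by (auto simp: descent_def)
        qed
        have incr: "p c < p d" if "a \<le> c" "c < d" "d \<le> b" for c d
          using that(2,1,3)
        proof (induction d rule: less_Suc_induct)
          case (1 c)
          then show ?case using mono_step[of c] by simp
        next
          case (2 c d e)
          then show ?case by simp
        qed
        obtain i where i: "descent n p i" using descent_exists[OF p not_id] by blast
        from 4[OF i] show ?thesis
        proof
          assume "i = b"
          define k where "k = Suc b"
          from i desc[of b] \<open>i = b\<close> have d: "X p = y b k \<odot> X (p \<circ> adj b)" "(p \<circ> adj b) permutes {1..n}"
            "inv_count n p = Suc (inv_count n (p \<circ> adj b))" "1 \<le> b" "b < n" by (simp_all add: k_def)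
          have k: "a < k" "b < k" "1 \<le> k" "k \<le> n" using ab d by (auto simp: k_def)
          let ?p = "p \<circ> adj b" let ?q = "p \<circ> adj b \<circ> transpose a b"
          have "y a b \<odot> y b k = y b k \<odot> y a k + y a k \<odot> y a b"
            using triangle[of a b k] ab k by simp
          then have eq: "y a b \<odot> X p = y b k \<odot> (y a k \<odot> X ?p) + y a k \<odot> (y a b \<odot> X ?p)"
            unfolding d(1) assoc[symmetric] by (simp add: mult_simps)
          have perm: "(?p \<circ> transpose a k) permutes {1..n}" "?q permutes {1..n}"
            using permutes_comp_transpose[OF d(2), of a k] permutes_comp_transpose[OF d(2), of a b] ab k d(4,5)
            by simp_all
          have e1: "?p \<circ> transpose a k \<circ> adj b = p \<circ> transpose a b"
            and e2: "?q \<circ> transpose a k = p \<circ> transpose a b"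
            using ab by (auto simp: fun_eq_iff transpose_def k_def)
          have t1: "top_part (inv_count n p) (p \<circ> transpose a b) (y b k \<odot> (y a k \<odot> X ?p))"
            using top_part_mult_simple[OF IH1[OF d(2) _ ab(1) k(1,4)] perm(1) d(4,5)] d(3) unfolding e1
            by (simp add: k_def)
          have "top_part (inv_count n ?p) ?q (y a b \<odot> X ?p)"
            using IH1[OF d(2) _ ab] d(3) by simp
          then have "top_part (Suc (inv_count n ?p)) (?q \<circ> transpose a k) (y a k \<odot> (y a b \<odot> X ?p))"
          proof (rule top_part_mult)
            assume inv: "inv_count n ?q = Suc (inv_count n ?p)"
            have "descent n ?q (b - 1)"
              using nonsimple ab incr[of a "b - 1"] by (auto simp: descent_def transpose_def)
            from comm[OF perm(2) _ this ab(1) k(1,4)] inv d(3) nonsimple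
            show "top_part (Suc (inv_count n ?p)) (?q \<circ> transpose a k) (y a k \<odot> X ?q)"
              by (auto simp: k_def)
          qed (use ab k in auto)
          with t1 show ?thesis unfolding eq d(3)[symmetric] e2 by (intro top_part_add)
        next
          assume "Suc i = a"
          define k where "k = i"
          from i desc[of k] \<open>Suc i = a\<close> have d: "X p = y k a \<odot> X (p \<circ> adj k)" "(p \<circ> adj k) permutes {1..n}"
            "inv_count n p = Suc (inv_count n (p \<circ> adj k))" "1 \<le> k" "k < n" by (simp_all add: k_def)
          have k: "a = Suc k" "k < b" using ab \<open>Suc i = a\<close> by (auto simp: k_def)
          let ?p = "p \<circ> adj k" let ?q = "p \<circ> adj k \<circ> transpose a b"
          have "y a b \<odot> y k a = y k a \<odot> y k b + y k b \<odot> y a b"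
            using triangle[of b a k] y_swap[of a b] y_swap[of k b] y_swap[of k a] ab k d(4)
            by (simp add: mult_simps)
          then have eq: "y a b \<odot> X p = y k a \<odot> (y k b \<odot> X ?p) + y k b \<odot> (y a b \<odot> X ?p)"
            unfolding d(1) assoc[symmetric] by (simp add: mult_simps)
          have perm: "(?p \<circ> transpose k b) permutes {1..n}" "?q permutes {1..n}"
            using permutes_comp_transpose[OF d(2), of k b] permutes_comp_transpose[OF d(2), of a b] ab k d(4,5)
            by simp_all
          have e1: "?p \<circ> transpose k b \<circ> adj k = p \<circ> transpose a b"
            and e2: "?q \<circ> transpose k b = p \<circ> transpose a b"
            using ab k by (auto simp: fun_eq_iff transpose_def)
          have t1: "top_part (inv_count n p) (p \<circ> transpose a b) (y k a \<odot> (y k b \<odot> X ?p))"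
            using top_part_mult_simple[OF IH1[OF d(2) _ d(4) k(2) ab(3)] perm(1) d(4,5)] d(3) unfolding e1
            by (simp add: k(1))
          have "top_part (inv_count n ?p) ?q (y a b \<odot> X ?p)"
            using IH1[OF d(2) _ ab] d(3) by simp
          then have "top_part (Suc (inv_count n ?p)) (?q \<circ> transpose k b) (y k b \<odot> (y a b \<odot> X ?p))"
          proof (rule top_part_mult)
            assume inv: "inv_count n ?q = Suc (inv_count n ?p)"
            have "descent n ?q a"
              using nonsimple ab k incr[of "Suc a" b] by (auto simp: descent_def transpose_def)
            from comm[OF perm(2) _ this d(4) k(2) ab(3)] inv d(3) nonsimple k
            show "top_part (Suc (inv_count n ?p)) (?q \<circ> transpose k b) (y k b \<odot> X ?q)"
              by auto
          qed (use ab k d in auto)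
          with t1 show ?thesis unfolding eq d(3)[symmetric] e2 by (intro top_part_add)
        qed
      qed
    qed
  qed
qed

lemma words_subset_X_nonsimple:
  "words m \<subseteq> span (X ` {p. p permutes {1..n} \<and> inv_count n p = m} \<union> (\<Union>k\<in>{k. Suc k = m}. words_nonsimple k))"
proof (induction m)
  case 0
  have "unit \<in> X ` {p. p permutes {1..n} \<and> inv_count n p = 0}"
    by (rule image_eqI[of _ _ id]) (simp_all add: X_id inv_count_id permutes_id)
  then show ?case by (auto intro!: span_mono)
next
  case (Suc m)
  let ?S = "X ` {p. p permutes {1..n} \<and> inv_count n p = Suc m} \<union> words_nonsimple m"
  have "y a b \<odot> u \<in> span ?S" if ab: "1 \<le> a" "a < b" "b \<le> n" and u: "u \<in> words m" for a b u
  proof (rule mult_span_right[OF subsetD[OF Suc u]])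
    fix v assume "v \<in> X ` {p. p permutes {1..n} \<and> inv_count n p = m} \<union> (\<Union>k\<in>{k. Suc k = m}. words_nonsimple k)"
    then consider p where "v = X p" "p permutes {1..n}" "inv_count n p = m"
      | k where "v \<in> words_nonsimple k" "m = Suc k" by auto
    then show "y a b \<odot> v \<in> span ?S"
    proof cases
      case 1
      let ?q = "p \<circ> transpose a b"
      obtain c where c: "y a b \<odot> X p - scale c (X ?q) \<in> words_nonsimple m"
        "c \<noteq> 0 \<longrightarrow> inv_count n ?q = Suc m"
        using top_part_y_mult_X[OF 1(2) ab] unfolding top_part_def 1(3) by blast
      have "scale c (X ?q) \<in> span ?S"
      proof (cases "c = 0")
        case False
        have "?q permutes {1..n}" using ab by (intro permutes_comp_transpose 1) auto
        with False c show ?thesis by (intro span_scale span_base) auto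
      qed (simp add: span_zero)
      moreover have "y a b \<odot> X p - scale c (X ?q) \<in> span ?S" using c(1) by (intro span_base) auto
      ultimately have "scale c (X ?q) + (y a b \<odot> X p - scale c (X ?q)) \<in> span ?S" by (rule span_add)
      then show ?thesis by (simp add: 1(1))
    next
      case 2
      from y_mult_words_nonsimple[OF ab 2(1)] show ?thesis unfolding 2(2)[symmetric] by (intro span_base) auto
    qed
  qed
  then have "words (Suc m) \<subseteq> span ?S"
    unfolding words.simps by (intro span_minimal) (auto simp: subspace_span)
  then show ?case by simp
qed

text \<open>
  Splitting off one nonsimple generator on the right lowers the degree of the remaining factor, so
  the decomposition modulo the left ideal can be iterated.
\<close>

lemma words_subset_products:
  assumes N: "unit \<in> N" "\<And>i z. 1 \<le> i \<Longrightarrow> i < n \<Longrightarrow> z \<in> N \<Longrightarrow> y i (Suc i) \<odot> z \<in> N"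
    and C: "unit \<in> C" "\<And>a b z. 1 \<le> a \<Longrightarrow> Suc a < b \<Longrightarrow> b \<le> n \<Longrightarrow> z \<in> C \<Longrightarrow> z \<odot> y a b \<in> C"
  shows "words m \<subseteq> span {z \<odot> w | z w. z \<in> N \<and> w \<in> C}"
proof (induction m rule: less_induct)
  case (less m)
  have XN: "X p \<in> N" if "p permutes {1..n}" for p
    using that
  proof (induction rule: permutation_word_induct)
    case id
    show ?case unfolding X_id by (rule N(1))
  next
    case (step p i)
    have "1 \<le> i" "i < n" using step(2) by (simp_all add: descent_def)
    then show ?case unfolding X_descent[OF step(1,2)] by (rule N(2)) (rule step.IH)
  qed
  have "v \<in> span {z \<odot> w | z w. z \<in> N \<and> w \<in> C}"
    if "v \<in> X ` {p. p permutes {1..n} \<and> inv_count n p = m} \<union> (\<Union>k\<in>{k. Suc k = m}. words_nonsimple k)" for v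
    using that
  proof
    assume "v \<in> X ` {p. p permutes {1..n} \<and> inv_count n p = m}"
    then obtain p where p: "p permutes {1..n}" "v = X p" by blast
    have "v = X p \<odot> unit" by (simp add: p unit_right)
    with XN[OF p(1)] C(1) show ?thesis by (intro span_base) blast
  next
    assume "v \<in> (\<Union>k\<in>{k. Suc k = m}. words_nonsimple k)"
    then obtain k where k: "k < m" "v \<in> words_nonsimple k" by auto
    have "words_nonsimple k \<subseteq> span {z \<odot> w | z w. z \<in> N \<and> w \<in> C}"
      unfolding words_nonsimple_def
    proof (rule span_minimal; clarify?)
      fix a b u assume ab: "1 \<le> a" "Suc a < b" "b \<le> n" and u: "u \<in> words k"
      show "u \<odot> y a b \<in> span {z \<odot> w | z w. z \<in> N \<and> w \<in> C}"
      proof (rule mult_span_left[OF subsetD[OF less[OF k(1)] u]])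
        fix v assume "v \<in> {z \<odot> w | z w. z \<in> N \<and> w \<in> C}"
        then obtain z w where "v = z \<odot> w" "z \<in> N" "w \<in> C" by blast
        with C(2)[OF ab] show "v \<odot> y a b \<in> span {z \<odot> w | z w. z \<in> N \<and> w \<in> C}"
          by (intro span_base) (auto simp: assoc)
      qed
    qed
    with k(2) show ?thesis by blast
  qed
  then have "span (X ` {p. p permutes {1..n} \<and> inv_count n p = m} \<union> (\<Union>k\<in>{k. Suc k = m}. words_nonsimple k))
      \<subseteq> span {z \<odot> w | z w. z \<in> N \<and> w \<in> C}" (is "?L \<subseteq> _")
    by (intro span_minimal subsetI) (simp_all add: subspace_span)
  with words_subset_X_nonsimple[of m] show ?case by (rule subset_trans)
qed

lemma products_span:
  assumes N: "unit \<in> N" "\<And>i z. 1 \<le> i \<Longrightarrow> i < n \<Longrightarrow> z \<in> N \<Longrightarrow> y i (Suc i) \<odot> z \<in> N"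
    and C: "unit \<in> C" "\<And>a b z. 1 \<le> a \<Longrightarrow> Suc a < b \<Longrightarrow> b \<le> n \<Longrightarrow> z \<in> C \<Longrightarrow> z \<odot> y a b \<in> C"
    and gen: "\<And>A. subspace A \<Longrightarrow> unit \<in> A \<Longrightarrow> (\<And>u v. u \<in> A \<Longrightarrow> v \<in> A \<Longrightarrow> u \<odot> v \<in> A) \<Longrightarrow>
      (\<And>a b. 1 \<le> a \<Longrightarrow> a < b \<Longrightarrow> b \<le> n \<Longrightarrow> y a b \<in> A) \<Longrightarrow> A = UNIV"
  shows "span {z \<odot> w | z w. z \<in> N \<and> w \<in> C} = UNIV"
proof -
  define W where "W = span (\<Union>m. words m)"
  have sub: "{a. \<forall>v\<in>W. a \<odot> v \<in> W} = UNIV"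
  proof (rule gen)
    show "subspace {a. \<forall>v\<in>W. a \<odot> v \<in> W}"
      unfolding subspace_def W_def by (auto simp: mult_simps intro!: span_zero span_add span_scale)
    show "unit \<in> {a. \<forall>v\<in>W. a \<odot> v \<in> W}" by (simp add: unit_left)
    show "u \<odot> v \<in> {a. \<forall>v\<in>W. a \<odot> v \<in> W}"
      if "u \<in> {a. \<forall>v\<in>W. a \<odot> v \<in> W}" "v \<in> {a. \<forall>v\<in>W. a \<odot> v \<in> W}" for u v
      using that by (simp add: assoc)
    show "y a b \<in> {a. \<forall>v\<in>W. a \<odot> v \<in> W}" if ab: "1 \<le> a" "a < b" "b \<le> n" for a b
    proof (intro CollectI ballI)
      fix v assume "v \<in> W"
      then show "y a b \<odot> v \<in> W"
        unfolding W_def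
      proof (rule mult_span_right)
        fix u assume "u \<in> (\<Union>m. words m)"
        then obtain m where "u \<in> words m" by blast
        from y_mult_words[OF ab this] show "y a b \<odot> u \<in> span (\<Union>m. words m)"
          by (intro span_base) blast
      qed
    qed
  qed
  have "unit \<in> words 0" by (simp add: span_base)
  then have "unit \<in> W" unfolding W_def by (intro span_base) blast
  have "a \<in> W" for a
  proof -
    have "a \<in> {a. \<forall>v\<in>W. a \<odot> v \<in> W}" unfolding sub ..
    then have "a \<odot> unit \<in> W" using \<open>unit \<in> W\<close> by blast
    then show ?thesis by (simp only: unit_right)
  qed
  then have "W = UNIV" by blast
  moreover have "W \<subseteq> span {z \<odot> w | z w. z \<in> N \<and> w \<in> C}"
    unfolding W_def
  proof (rule span_minimal)
    show "(\<Union>m. words m) \<subseteq> span {z \<odot> w | z w. z \<in> N \<and> w \<in> C}"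
      by (rule UN_least) (rule words_subset_products[OF N C])
  qed (rule subspace_span)
  ultimately show ?thesis by auto
qed

end


section \<open>Contractions of tensors\<close>

lemma linearD:
  assumes "Vector_Spaces.linear s1 s2 f"
  shows "f (u + v) = f u + f v" "f (s1 r u) = s2 r (f u)" "f 0 = 0" "f (- u) = - f u" "f (u - v) = f u - f v"
proof -
  interpret Vector_Spaces.linear s1 s2 f by fact
  show "f (u + v) = f u + f v" "f (s1 r u) = s2 r (f u)" "f 0 = 0" "f (- u) = - f u" "f (u - v) = f u - f v"
    by (simp_all add: add scale zero neg diff)
qed

lemma linear_spaces:
  assumes "Vector_Spaces.linear s1 s2 f"
  shows "vector_space s1" "vector_space s2"
  using assms by (auto simp: Vector_Spaces.linear_def)

lemma linear_comp:
  "Vector_Spaces.linear s1 s2 f \<Longrightarrow> Vector_Spaces.linear s2 s3 g \<Longrightarrow> Vector_Spaces.linear s1 s3 (\<lambda>u. g (f u))"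
  by (drule (1) Vector_Spaces.linear_compose) (simp add: o_def)

lemma linear_apply:
  assumes "Vector_Spaces.linear s fscale F"
  shows "Vector_Spaces.linear s (*) (\<lambda>u. F u \<tau>)"
  using linearD(1,2)[OF assms]
  by (intro linearI' linear_spaces(1)[OF assms] vector_space_field) (simp_all add: fscale_def)

lemma linear_scalar_mult:
  fixes f :: "'a::ab_group_add \<Rightarrow> 'k::field"
  assumes "Vector_Spaces.linear s (*) f"
  shows "Vector_Spaces.linear s (*) (\<lambda>u. r * f u)" "Vector_Spaces.linear s (*) (\<lambda>u. f u * r)"
  by (rule linearI'[OF linear_spaces(1)[OF assms] vector_space_field];
      simp add: linearD[OF assms] algebra_simps)+

lemma linear_eq_on_span:
  assumes f: "Vector_Spaces.linear s1 s2 f" and g: "Vector_Spaces.linear s1 s2 g"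
    and eq: "\<And>v. v \<in> B \<Longrightarrow> f v = g v" and v: "v \<in> module.span s1 B"
  shows "f v = g v"
proof -
  interpret vector_space_pair s1 s2
    using linear_spaces[OF f] by (simp add: vector_space_pair_def)
  show ?thesis by (rule linear_eq_on[OF f g v eq])
qed

locale tensor_calculus = vector_space scale
  for scale :: "'k::field \<Rightarrow> 'b::ab_group_add \<Rightarrow> 'b"
begin

abbreviation T :: "'b \<Rightarrow> 'b \<Rightarrow> ('b \<Rightarrow> 'b \<Rightarrow> 'k) \<Rightarrow> 'k"
  where "T a b \<equiv> tens scale scale a b"

abbreviation tensors :: "(('b \<Rightarrow> 'b \<Rightarrow> 'k) \<Rightarrow> 'k) set"
  where "tensors \<equiv> tensor_space scale scale UNIV UNIV"

lemmas T_simps = bilinear_mapD[OF bilinear_tens[OF vector_space_axioms vector_space_axioms]]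

lemma subspace_tensors: "module.subspace fscale tensors"
proof -
  interpret t: vector_space "fscale :: 'k \<Rightarrow> (('b \<Rightarrow> 'b \<Rightarrow> 'k) \<Rightarrow> 'k) \<Rightarrow> _" by (rule vector_space_fscale)
  show ?thesis by (simp add: tensor_space_def)
qed

lemma T_in_tensors: "T a b \<in> tensors"
proof -
  interpret t: vector_space "fscale :: 'k \<Rightarrow> (('b \<Rightarrow> 'b \<Rightarrow> 'k) \<Rightarrow> 'k) \<Rightarrow> _" by (rule vector_space_fscale)
  show ?thesis unfolding tensor_space_def by (rule t.span_base) auto
qed

lemma linear_eq_on_tensors:
  assumes "Vector_Spaces.linear fscale s' F" "Vector_Spaces.linear fscale s' G"
    and "\<And>a b. F (T a b) = G (T a b)" "t \<in> tensors"
  shows "F t = G t"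
  using linear_eq_on_span[OF assms(1,2) _ assms(4)[unfolded tensor_space_def]] assms(3) by blast

lemma tlift_T:
  assumes "bilinear_map scale scale s3 \<beta>" "vector_space s3"
  shows "Vector_Spaces.linear fscale s3 (tlift scale scale s3 \<beta>)"
    "tlift scale scale s3 \<beta> (T a b) = \<beta> a b"
  using tlift[OF vector_space_axioms vector_space_axioms assms(2,1)] by auto

text \<open>
  Lifted maps are chosen, and are determined only on the span of the pure tensors; both sides are
  linear there and agree on pure tensors.
\<close>

lemma tlift_linear_comb:
  assumes s3: "vector_space s3" and b: "bilinear_map scale scale s3 \<beta>"
    "bilinear_map scale scale s3 \<beta>1" "bilinear_map scale scale s3 \<beta>2"
    and eq: "\<And>a b. \<beta> a b = s3 r (\<beta>1 a b) + \<beta>2 a b" and t: "t \<in> tensors"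
  shows "tlift scale scale s3 \<beta> t = s3 r (tlift scale scale s3 \<beta>1 t) + tlift scale scale s3 \<beta>2 t"
proof -
  interpret s3: vector_space s3 by fact
  note l = tlift_T(1)[OF b(1) s3] tlift_T(1)[OF b(2) s3] tlift_T(1)[OF b(3) s3]
  have "Vector_Spaces.linear fscale s3
      (\<lambda>t. s3 r (tlift scale scale s3 \<beta>1 t) + tlift scale scale s3 \<beta>2 t)"
    by (rule linearI'[OF vector_space_fscale s3])
       (simp_all add: linearD[OF l(2)] linearD[OF l(3)] s3.scale_right_distrib add_ac mult.commute)
  from linear_eq_on_tensors[OF l(1) this _ t] show ?thesis
    by (simp add: tlift_T(2)[OF b(1) s3] tlift_T(2)[OF b(2) s3] tlift_T(2)[OF b(3) s3] eq)
qed

lemma bilinear_map_tlift: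
  assumes s3: "vector_space s3"
    and bil: "\<And>a b. bilinear_map scale scale s3 (\<gamma> a b)"
    and lin1: "\<And>r a a' b c d. \<gamma> (scale r a + a') b c d = s3 r (\<gamma> a b c d) + \<gamma> a' b c d"
    and lin2: "\<And>r a b b' c d. \<gamma> a (scale r b + b') c d = s3 r (\<gamma> a b c d) + \<gamma> a b' c d"
    and t: "t \<in> tensors"
  shows "bilinear_map scale scale s3 (\<lambda>a b. tlift scale scale s3 (\<gamma> a b) t)"
proof -
  interpret s3: vector_space s3 by fact
  have 1: "tlift scale scale s3 (\<gamma> (scale r a + a') b) t =
      s3 r (tlift scale scale s3 (\<gamma> a b) t) + tlift scale scale s3 (\<gamma> a' b) t" for r a a' b
    by (rule tlift_linear_comb[OF s3 bil bil bil lin1 t])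
  have 2: "tlift scale scale s3 (\<gamma> a (scale r b + b')) t =
      s3 r (tlift scale scale s3 (\<gamma> a b) t) + tlift scale scale s3 (\<gamma> a b') t" for r a b b'
    by (rule tlift_linear_comb[OF s3 bil bil bil lin2 t])
  have z: "tlift scale scale s3 (\<gamma> 0 b) t = 0" "tlift scale scale s3 (\<gamma> a 0) t = 0" for a b
    using 1[of 1 0 0 b] 2[of a 1 0 0] by simp_all
  show ?thesis
    using 1[of 1] 2[of _ 1] 1[of _ _ 0] 2[of _ _ _ 0] z
    by (intro bilinear_mapI vector_space_axioms s3) simp_all
qed

definition contract_left :: "('b \<Rightarrow> 'k) \<Rightarrow> (('b \<Rightarrow> 'b \<Rightarrow> 'k) \<Rightarrow> 'k) \<Rightarrow> 'b"
  where "contract_left f = tlift scale scale scale (\<lambda>a b. scale (f a) b)"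

definition contract_right :: "('b \<Rightarrow> 'k) \<Rightarrow> (('b \<Rightarrow> 'b \<Rightarrow> 'k) \<Rightarrow> 'k) \<Rightarrow> 'b"
  where "contract_right f = tlift scale scale scale (\<lambda>a b. scale (f b) a)"

lemma contract_left:
  assumes f: "Vector_Spaces.linear scale (*) f"
  shows "Vector_Spaces.linear fscale scale (contract_left f)" "contract_left f (T a b) = scale (f a) b"
proof -
  have b: "bilinear_map scale scale scale (\<lambda>a b. scale (f a) b)"
    by (rule bilinear_mapI) (simp_all add: vector_space_axioms linearD[OF f] scale_left_distrib
        scale_right_distrib mult.commute)
  show "Vector_Spaces.linear fscale scale (contract_left f)" "contract_left f (T a b) = scale (f a) b"
    unfolding contract_left_def by (rule tlift_T[OF b vector_space_axioms])+
qed

lemma contract_right: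
  assumes f: "Vector_Spaces.linear scale (*) f"
  shows "Vector_Spaces.linear fscale scale (contract_right f)" "contract_right f (T a b) = scale (f b) a"
proof -
  have b: "bilinear_map scale scale scale (\<lambda>a b. scale (f b) a)"
    by (rule bilinear_mapI) (simp_all add: vector_space_axioms linearD[OF f] scale_left_distrib
        scale_right_distrib mult.commute)
  show "Vector_Spaces.linear fscale scale (contract_right f)" "contract_right f (T a b) = scale (f b) a"
    unfolding contract_right_def by (rule tlift_T[OF b vector_space_axioms])+
qed

text \<open>
  Reduces identities between vectors to identities between scalars. This matters for
  coassociativity, as triple tensors are functions on scalar valued trilinear forms.
\<close>

lemma functionals_separate:
  assumes "\<And>f. Vector_Spaces.linear scale (*) f \<Longrightarrow> f u = f v"
  shows "u = v"
proof (rule ccontr)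
  assume "u \<noteq> v"
  interpret f: vector_space "(*) :: 'k \<Rightarrow> _" by (rule vector_space_field)
  interpret p: vector_space_pair scale "(*) :: 'k \<Rightarrow> _" by unfold_locales
  have "independent {u - v}" using \<open>u \<noteq> v\<close> by simp
  from p.linear_independent_extend[OF this, of "\<lambda>_. 1"]
  obtain f where "Vector_Spaces.linear scale (*) f" "f (u - v) = 1" by auto
  with assms[of f] show False by (simp add: linearD)
qed

lemma tens3_simps:
  "tens3 scale (a + a') b c = tens3 scale a b c + tens3 scale a' b c"
  "tens3 scale a (b + b') c = tens3 scale a b c + tens3 scale a b' c"
  "tens3 scale a b (c + c') = tens3 scale a b c + tens3 scale a b c'"
  "tens3 scale (scale r a) b c = fscale r (tens3 scale a b c)"
  "tens3 scale a (scale r b) c = fscale r (tens3 scale a b c)"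
  "tens3 scale a b (scale r c) = fscale r (tens3 scale a b c)"
proof -
  have l: "Vector_Spaces.linear scale (*) (\<lambda>c. \<tau> a b c)" "Vector_Spaces.linear scale (*) (\<lambda>b. \<tau> a b c)"
    "Vector_Spaces.linear scale (*) (\<lambda>a. \<tau> a b c)" if "trilinear_form scale \<tau>" for \<tau> :: "'b \<Rightarrow> 'b \<Rightarrow> 'b \<Rightarrow> 'k" and a b c
    using that by (auto simp: trilinear_form_def)
  show "tens3 scale (a + a') b c = tens3 scale a b c + tens3 scale a' b c"
    "tens3 scale a (b + b') c = tens3 scale a b c + tens3 scale a b' c"
    "tens3 scale a b (c + c') = tens3 scale a b c + tens3 scale a b c'"
    "tens3 scale (scale r a) b c = fscale r (tens3 scale a b c)"
    "tens3 scale a (scale r b) c = fscale r (tens3 scale a b c)"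
    "tens3 scale a b (scale r c) = fscale r (tens3 scale a b c)"
    by (auto simp: tens3_def fscale_def fun_eq_iff linearD[OF l(1)] linearD[OF l(2)] linearD[OF l(3)])
qed

end


section \<open>The coproduct of a product with a factor of degree one\<close>

sublocale braided_hopf_algebra \<subseteq> tensor_calculus scale ..

context braided_hopf_algebra
begin

abbreviation braiding where "braiding \<equiv> yd_braiding G scale act deg"

lemma linear_eq_on_comult:
  assumes "Vector_Spaces.linear fscale s' F" "Vector_Spaces.linear fscale s' H"
    and "\<And>a b. F (T a b) = H (T a b)"
  shows "F (\<Delta> c) = H (\<Delta> c)"
  by (rule linear_eq_on_tensors[OF assms comult_range])

lemma braiding_T_in_tensors: "braiding (T b c) \<in> tensors"
proof -
  interpret t: vector_space "fscale :: 'k \<Rightarrow> (('b \<Rightarrow> 'b \<Rightarrow> 'k) \<Rightarrow> 'k) \<Rightarrow> _" by (rule vector_space_fscale)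
  have "b \<in> span (\<Union>g\<in>carrier G. deg g)"
    using deg_decomposition by (simp add: direct_sum_decomposition_def)
  then show ?thesis
  proof (induction rule: span_induct_alt)
    case base
    have T0: "T 0 c = 0" using T_simps(1)[of 0 0 c] by simp
    show ?case unfolding T0 linearD(3)[OF yd_braiding(1)] by (rule t.subspace_0[OF subspace_tensors])
  next
    case (step r u v)
    then obtain g where "g \<in> carrier G" "u \<in> deg g" by blast
    from yd_braiding(2)[OF this] have "braiding (T u c) \<in> tensors" by (simp add: T_in_tensors)
    with step(2) show ?case
      unfolding T_simps linearD(1,2)[OF yd_braiding(1)]
      by (intro t.subspace_add[OF subspace_tensors] t.subspace_scale[OF subspace_tensors])
  qed
qed

text \<open>
  The two stages of the braided product: \<open>bmult4 a b c d\<close> is \<open>(a \<otimes> b) (c \<otimes> d)\<close> in the braided tensor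
  square, and \<open>bmult2 a b u\<close> is \<open>(a \<otimes> b) u\<close>. The universal property determines a lifted map only on
  tensors, so linearity in \<open>a\<close> and \<open>b\<close> has to be shown for \<open>u\<close> in the span of the pure tensors.
\<close>

definition bmult4 :: "'b \<Rightarrow> 'b \<Rightarrow> 'b \<Rightarrow> 'b \<Rightarrow> ('b \<Rightarrow> 'b \<Rightarrow> 'k) \<Rightarrow> 'k"
  where "bmult4 a b c d = tlift scale scale fscale (\<lambda>c' b'. T (a * c') (b' * d)) (braiding (T b c))"

definition bmult2 :: "'b \<Rightarrow> 'b \<Rightarrow> (('b \<Rightarrow> 'b \<Rightarrow> 'k) \<Rightarrow> 'k) \<Rightarrow> ('b \<Rightarrow> 'b \<Rightarrow> 'k) \<Rightarrow> 'k"
  where "bmult2 a b = tlift scale scale fscale (bmult4 a b)"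

lemma bilinear_bmult_inner: "bilinear_map scale scale fscale (\<lambda>c' b'. T (a * c') (b' * d))"
  by (rule bilinear_mapI)
     (simp_all add: vector_space_axioms vector_space_fscale T_simps algebra_simps scale_mult_left scale_mult_right)

lemma bmult4_homogeneous:
  assumes "g \<in> carrier G" "b \<in> deg g"
  shows "bmult4 a b c d = T (a * act g c) (b * d)"
  unfolding bmult4_def yd_braiding(2)[OF assms]
  by (rule tlift_T(2)[OF bilinear_bmult_inner vector_space_fscale])

lemma fscale_simps:
  "fscale r (t + u) = fscale r t + fscale r u" "fscale (r + r') t = fscale r t + fscale r' t"
  "fscale r (fscale r' t) = fscale (r * r') t" "fscale 1 t = t" "fscale 0 t = 0" "fscale r 0 = 0"
  "fscale r (- t) = - fscale r t"
  by (simp_all add: fscale_def fun_eq_iff algebra_simps)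

lemma bmult4_linear:
  "bmult4 (scale r a + a') b c d = fscale r (bmult4 a b c d) + bmult4 a' b c d"
  "bmult4 a (scale r b + b') c d = fscale r (bmult4 a b c d) + bmult4 a b' c d"
  "bmult4 a b (scale r c + c') d = fscale r (bmult4 a b c d) + bmult4 a b c' d"
  "bmult4 a b c (scale r d + d') = fscale r (bmult4 a b c d) + bmult4 a b c d'"
proof -
  show "bmult4 (scale r a + a') b c d = fscale r (bmult4 a b c d) + bmult4 a' b c d"
    unfolding bmult4_def
    by (rule tlift_linear_comb[OF vector_space_fscale bilinear_bmult_inner bilinear_bmult_inner bilinear_bmult_inner _ braiding_T_in_tensors])
       (simp add: T_simps algebra_simps scale_mult_left scale_mult_right)
  show "bmult4 a b c (scale r d + d') = fscale r (bmult4 a b c d) + bmult4 a b c d'"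
    unfolding bmult4_def
    by (rule tlift_linear_comb[OF vector_space_fscale bilinear_bmult_inner bilinear_bmult_inner bilinear_bmult_inner _ braiding_T_in_tensors])
       (simp add: T_simps algebra_simps scale_mult_left scale_mult_right)
  note l = tlift_T(1)[OF bilinear_bmult_inner[of a d] vector_space_fscale]
  show "bmult4 a (scale r b + b') c d = fscale r (bmult4 a b c d) + bmult4 a b' c d"
    "bmult4 a b (scale r c + c') d = fscale r (bmult4 a b c d) + bmult4 a b c' d"
    unfolding bmult4_def by (simp_all add: T_simps linearD[OF yd_braiding(1)] linearD[OF l])
qed

lemma bilinear_bmult4: "bilinear_map scale scale fscale (bmult4 a b)"
proof -
  have z: "bmult4 a b 0 d = 0" "bmult4 a b c 0 = 0" for c d
    using bmult4_linear(3)[of a b 1 0 0 d] bmult4_linear(4)[of a b c 1 0 0]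
    by (simp_all add: fscale_simps)
  show ?thesis
    using bmult4_linear(3)[of a b 1] bmult4_linear(4)[of a b _ 1]
      bmult4_linear(3)[of a b _ _ 0] bmult4_linear(4)[of a b _ _ _ 0] z
    by (intro bilinear_mapI vector_space_axioms vector_space_fscale) (simp_all add: fscale_simps)
qed

lemma bmult2_linear: "Vector_Spaces.linear fscale fscale (bmult2 a b)"
  and bmult2_T: "bmult2 a b (T c d) = bmult4 a b c d"
  unfolding bmult2_def by (rule tlift_T[OF bilinear_bmult4 vector_space_fscale])+

lemma braided_mult_T:
  assumes "u \<in> tensors"
  shows "Vector_Spaces.linear fscale fscale (\<lambda>t. braided_mult scale braiding t u)"
    "braided_mult scale braiding (T a b) u = bmult2 a b u"
proof -
  have b: "bilinear_map scale scale fscale (\<lambda>a b. bmult2 a b u)"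
    unfolding bmult2_def
    by (rule bilinear_map_tlift[OF vector_space_fscale bilinear_bmult4 bmult4_linear(1,2) assms])
  have eq: "braided_mult scale braiding t u = tlift scale scale fscale (\<lambda>a b. bmult2 a b u) t" for t
    unfolding braided_mult_def bmult2_def bmult4_def ..
  show "Vector_Spaces.linear fscale fscale (\<lambda>t. braided_mult scale braiding t u)"
    "braided_mult scale braiding (T a b) u = bmult2 a b u"
    unfolding eq by (rule tlift_T[OF b vector_space_fscale])+
qed

text \<open>
  Since \<open>\<Delta> v = v \<otimes> 1 + 1 \<otimes> v\<close>, multiplication of the coproduct by \<open>\<Delta> v\<close> braids only \<open>v\<close> or 1
  past the first tensor factor, and homogeneous \<open>v\<close> acts by its group degree.
\<close>

lemma comult_primitive_mult:
  assumes v: "\<Delta> v = T v 1 + T 1 v" and g: "g \<in> carrier G" "v \<in> deg g"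
  obtains L where "Vector_Spaces.linear fscale fscale L"
    "\<And>c d. L (T c d) = T (v * c) d + T (act g c) (v * d)" "\<And>c. \<Delta> (v * c) = L (\<Delta> c)"
proof
  define L where "L = (\<lambda>t. bmult2 v 1 t + bmult2 1 v t)"
  show "Vector_Spaces.linear fscale fscale L"
    unfolding L_def
    by (rule linearI'[OF vector_space_fscale vector_space_fscale])
       (simp_all add: linearD[OF bmult2_linear] fscale_simps algebra_simps)
  have one: "\<one> \<in> carrier G" by simp
  show "L (T c d) = T (v * c) d + T (act g c) (v * d)" for c d
    unfolding L_def bmult2_T bmult4_homogeneous[OF one deg_unit] bmult4_homogeneous[OF g]
    by (simp add: act_one)
  show "\<Delta> (v * c) = L (\<Delta> c)" for c
    unfolding comult_mult v L_def
    by (simp add: linearD[OF braided_mult_T(1)[OF comult_range]] braided_mult_T(2)[OF comult_range])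
qed

end


section \<open>The Nichols algebra of type A\<close>

context nichols_algebra
begin

lemma subspace_gr: "subspace (gr m)"
  using gr_decomposition by (simp add: direct_sum_decomposition_def)

lemma gr_disjoint:
  assumes "v \<in> gr i" "v \<in> gr j" "i \<noteq> j"
  shows "v = 0"
proof -
  have "\<forall>J f. finite J \<and> J \<subseteq> UNIV \<and> (\<forall>i\<in>J. f i \<in> gr i) \<and> sum f J = 0 \<longrightarrow> (\<forall>i\<in>J. f i = 0)"
    using gr_decomposition by (simp add: direct_sum_decomposition_def)
  from this[rule_format, of "{i, j}" "\<lambda>k. if k = i then v else - v" i]
  show ?thesis using assms by (auto simp: subspace_neg[OF subspace_gr])
qed

lemma linear_eq_on_gr:
  assumes "Vector_Spaces.linear scale s3 F" "Vector_Spaces.linear scale s3 H"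
    and "\<And>m v. v \<in> gr m \<Longrightarrow> F v = H v"
  shows "F v = H v"
proof (rule linear_eq_on_span[OF assms(1,2), of "\<Union>m. gr m"])
  show "v \<in> span (\<Union>m. gr m)"
    using gr_decomposition by (simp add: direct_sum_decomposition_def)
qed (use assms(3) in blast)

lemma counit_scale_one: "\<epsilon> (scale r 1) = r"
  by (simp add: linearD[OF counit_linear] counit_unit)

lemma subalgebra_UNIV:
  assumes "subspace A" "1 \<in> A" "\<And>u v. u \<in> A \<Longrightarrow> v \<in> A \<Longrightarrow> u * v \<in> A" "gr 1 \<subseteq> A"
  shows "A = UNIV"
proof -
  have "subalgebra scale hull gr 1 \<subseteq> A"
    using assms by (intro hull_minimal) (auto simp: subalgebra_def)
  then show ?thesis using generated by (auto simp: generated_subalgebra_def)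
qed

text \<open>
  Such a functional sees \<open>v * c\<close> only through the component of \<open>c\<close> of degree zero, which is the
  scalar \<open>\<epsilon> c\<close>.
\<close>

lemma degree_one_functional_mult:
  assumes f: "Vector_Spaces.linear scale (*) f" and f0: "\<And>m v. m \<noteq> 1 \<Longrightarrow> v \<in> gr m \<Longrightarrow> f v = 0"
    and v: "v \<in> gr 1"
  shows "f (v * c) = f v * \<epsilon> c"
proof (rule linear_eq_on_gr)
  show "Vector_Spaces.linear scale (*) (\<lambda>c. f (v * c))" "Vector_Spaces.linear scale (*) (\<lambda>c. f v * \<epsilon> c)"
    by (rule linearI'[OF vector_space_axioms vector_space_field];
        simp add: algebra_simps linearD[OF f] linearD[OF counit_linear] scale_mult_right)+
  fix m c assume c: "c \<in> gr m"
  show "f (v * c) = f v * \<epsilon> c"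
  proof (cases "m = 0")
    case True
    with c connected obtain r where "c = scale r 1" by auto
    then show ?thesis by (simp add: scale_mult_right linearD[OF f] linearD[OF counit_linear] counit_unit)
  next
    case False
    with gr_mult[OF v c] f0[of "1 + m"] gr_counit[OF _ c] show ?thesis by simp
  qed
qed

end

definition root_vec :: "nat \<Rightarrow> nat \<Rightarrow> nat \<Rightarrow> real"
  where "root_vec a b = unit_vec a - unit_vec b"

lemma root_vec_eq_iff: "a \<noteq> b \<Longrightarrow> c \<noteq> d \<Longrightarrow> root_vec a b = root_vec c d \<longleftrightarrow> a = c \<and> b = d"
proof
  assume *: "root_vec a b = root_vec c d" "a \<noteq> b" "c \<noteq> d"
  from fun_cong[OF *(1), of a] fun_cong[OF *(1), of b] *(2,3) show "a = c \<and> b = d"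
    by (auto simp: root_vec_def unit_vec_def split: if_splits)
qed simp

lemma root_vec_minus: "- root_vec a b = root_vec b a"
  by (simp add: root_vec_def)

lemma perm_vec_root_vec:
  assumes "w permutes A"
  shows "perm_vec w (root_vec a b) = root_vec (w a) (w b)"
proof -
  have "inv_into UNIV w k = a \<longleftrightarrow> k = w a" for k a
    using permutes_inverses[OF assms] by metis
  then show ?thesis by (simp add: perm_vec_def root_vec_def unit_vec_def fun_eq_iff)
qed

definition pos_pairs :: "nat \<Rightarrow> (nat \<times> nat) set"
  where "pos_pairs n = {(a, b). 1 \<le> a \<and> a < b \<and> b \<le> n}"

lemma finite_pos_pairs: "finite (pos_pairs n)"
  by (rule finite_subset[of _ "{1..n} \<times> {1..n}"]) (auto simp: pos_pairs_def)

locale type_A_nichols = nichols_algebra "sym_group n" scale act deg \<Delta> \<epsilon> S gr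
  for n :: nat and scale :: "'k::field \<Rightarrow> 'b::ring_1 \<Rightarrow> 'b" and act deg \<Delta> \<epsilon> S gr +
  fixes x :: "(nat \<Rightarrow> real) \<Rightarrow> 'b"
  assumes VW: "is_V_W n scale act deg (gr 1) x"
begin

definition y :: "nat \<Rightarrow> nat \<Rightarrow> 'b"
  where "y a b = x (root_vec a b)"

lemma root_vec_in_roots: "a \<in> {1..n} \<Longrightarrow> b \<in> {1..n} \<Longrightarrow> a \<noteq> b \<Longrightarrow> root_vec a b \<in> roots n"
  by (auto simp: roots_def root_vec_def)

lemma y_swap': "a \<in> {1..n} \<Longrightarrow> b \<in> {1..n} \<Longrightarrow> a \<noteq> b \<Longrightarrow> y b a = - y a b"
  using VW root_vec_in_roots[of a b] by (auto simp: y_def is_V_W_def root_vec_minus[symmetric, of a b])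

lemma act_y:
  assumes "w permutes {1..n}" "a \<in> {1..n}" "b \<in> {1..n}" "a \<noteq> b"
  shows "act w (y a b) = y (w a) (w b)"
  using VW root_vec_in_roots[OF assms(2-4)] perm_vec_root_vec[OF assms(1)] assms(1)
  by (auto simp: is_V_W_def y_def sym_group_carrier)

lemma transpose_carrier: "a \<in> {1..n} \<Longrightarrow> b \<in> {1..n} \<Longrightarrow> transpose a b \<in> carrier (sym_group n)"
  by (simp add: sym_group_carrier permutes_swap_id)

lemma y_deg: "a \<in> {1..n} \<Longrightarrow> b \<in> {1..n} \<Longrightarrow> a \<noteq> b \<Longrightarrow> y a b \<in> deg (transpose a b)"
  using VW root_vec_in_roots[of a b] root_reflection[of a n b] by (auto simp: y_def is_V_W_def root_vec_def)

lemma gr_1_span: "gr 1 = span {y a b | a b. 1 \<le> a \<and> a < b \<and> b \<le> n}"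
proof
  have "x \<alpha> \<in> span {y a b | a b. 1 \<le> a \<and> a < b \<and> b \<le> n}" if "\<alpha> \<in> roots n" for \<alpha>
  proof -
    from that obtain a b where ab: "\<alpha> = root_vec a b" "a \<in> {1..n}" "b \<in> {1..n}" "a \<noteq> b"
      by (auto simp: roots_def root_vec_def)
    show ?thesis
    proof (cases "a < b")
      case True
      with ab show ?thesis by (intro span_base) (auto simp: y_def)
    next
      case False
      with ab have "y b a \<in> span {y a b | a b. 1 \<le> a \<and> a < b \<and> b \<le> n}"
        by (intro span_base CollectI exI[of _ b] exI[of _ a]) auto
      moreover have "x \<alpha> = - y b a" using ab y_swap'[of b a] by (simp add: y_def)
      ultimately show ?thesis by (simp add: span_neg)
    qed
  qed
  then have sub: "x ` roots n \<subseteq> span {y a b | a b. 1 \<le> a \<and> a < b \<and> b \<le> n}" by blast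
  have gr1: "gr 1 = span (x ` roots n)" using VW by (simp add: is_V_W_def)
  from sub show "gr 1 \<subseteq> span {y a b | a b. 1 \<le> a \<and> a < b \<and> b \<le> n}"
    unfolding gr1 by (rule span_minimal) (rule subspace_span)
  show "span {y a b | a b. 1 \<le> a \<and> a < b \<and> b \<le> n} \<subseteq> gr 1"
    unfolding gr1
    by (intro span_mono) (auto simp: y_def intro!: imageI root_vec_in_roots)
qed

lemma y_gr: "a \<in> {1..n} \<Longrightarrow> b \<in> {1..n} \<Longrightarrow> a \<noteq> b \<Longrightarrow> y a b \<in> gr 1"
  using VW root_vec_in_roots[of a b] by (auto simp: y_def is_V_W_def intro: span_base)

lemma y_primitive:
  assumes "a \<in> {1..n}" "b \<in> {1..n}" "a \<noteq> b"
  shows "\<Delta> (y a b) = T (y a b) 1 + T 1 (y a b)"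
  using y_gr[OF assms] primitives by blast

text \<open>
  Apply the last clause of \<open>is_V_W\<close> to the coefficients extended by 0 to the negative roots: they
  have the form \<open>d \<alpha> + d (- \<alpha>)\<close>, so opposite roots have equal coefficients.
\<close>

lemma y_linear_independent:
  assumes sum0: "(\<Sum>(a, b)\<in>pos_pairs n. scale (u (a, b)) (y a b)) = 0" and ab: "(a, b) \<in> pos_pairs n"
  shows "u (a, b) = 0"
proof -
  let ?r = "\<lambda>(a, b). root_vec a b"
  have inj: "inj_on ?r (pos_pairs n)"
    by (auto simp: inj_on_def pos_pairs_def root_vec_eq_iff)
  define c where "c \<alpha> = (if \<alpha> \<in> ?r ` pos_pairs n then u (the_inv_into (pos_pairs n) ?r \<alpha>) else 0)" for \<alpha>
  have c: "c (root_vec a b) = u (a, b)" if "(a, b) \<in> pos_pairs n" for a b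
  proof -
    have "root_vec a b \<in> ?r ` pos_pairs n" using that by (intro image_eqI[of _ _ "(a, b)"]) auto
    then show ?thesis using the_inv_into_f_f[OF inj that] by (simp add: c_def)
  qed
  have fin: "finite (roots n)"
  proof -
    have "roots n \<subseteq> ?r ` ({1..n} \<times> {1..n})" by (auto simp: roots_def root_vec_def)
    then show ?thesis by (rule finite_subset) simp
  qed
  have sub: "?r ` pos_pairs n \<subseteq> roots n" by (auto simp: pos_pairs_def intro!: root_vec_in_roots)
  have "(\<Sum>\<alpha>\<in>roots n. scale (c \<alpha>) (x \<alpha>)) = (\<Sum>\<alpha>\<in>?r ` pos_pairs n. scale (c \<alpha>) (x \<alpha>))"
    by (intro sum.mono_neutral_right fin sub) (auto simp: c_def)
  also have "\<dots> = (\<Sum>(a, b)\<in>pos_pairs n. scale (u (a, b)) (y a b))"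
    unfolding sum.reindex[OF inj] by (intro sum.cong) (auto simp: c y_def)
  finally have "(\<Sum>\<alpha>\<in>roots n. scale (c \<alpha>) (x \<alpha>)) = 0" using sum0 by simp
  with VW obtain d where d: "\<forall>\<alpha>\<in>roots n. c \<alpha> = d \<alpha> + d (- \<alpha>)" unfolding is_V_W_def by blast
  have roots: "root_vec a b \<in> roots n" "root_vec b a \<in> roots n"
    using ab by (auto simp: pos_pairs_def intro!: root_vec_in_roots)
  have "c (root_vec a b) = c (root_vec b a)"
    using bspec[OF d roots(1)] bspec[OF d roots(2)] by (simp add: root_vec_minus add.commute)
  moreover have "c (root_vec b a) = 0"
    using ab by (auto simp: c_def pos_pairs_def root_vec_eq_iff)
  ultimately show ?thesis using c[OF ab] by simp
qed

lemma coordinate_functional_exists: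
  assumes ab: "(a, b) \<in> pos_pairs n"
  shows "\<exists>f. Vector_Spaces.linear scale (*) f \<and> (\<forall>m v. m \<noteq> 1 \<longrightarrow> v \<in> gr m \<longrightarrow> f v = 0) \<and>
    (\<forall>c d. (c, d) \<in> pos_pairs n \<longrightarrow> f (y c d) = (if (c, d) = (a, b) then 1 else 0))"
proof -
  interpret f: vector_space "(*) :: 'k \<Rightarrow> _" by (rule vector_space_field)
  interpret p: vector_space_pair scale "(*) :: 'k \<Rightarrow> _" by unfold_locales
  let ?y = "\<lambda>(a, b). y a b"
  have inj: "inj_on ?y (pos_pairs n)"
  proof (rule inj_onI)
    fix i j assume ij: "i \<in> pos_pairs n" "j \<in> pos_pairs n" "?y i = ?y j"
    show "i = j"
    proof (rule ccontr)
      assume "i \<noteq> j"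
      let ?u = "\<lambda>k. if k = i then 1 else if k = j then - 1 else 0 :: 'k"
      have "(\<Sum>(a, b)\<in>pos_pairs n. scale (?u (a, b)) (y a b)) = (\<Sum>k\<in>pos_pairs n. scale (?u k) (?y k))"
        by (rule sum.cong) auto
      also have "\<dots> = (\<Sum>k\<in>{i, j}. scale (?u k) (?y k))"
        using ij by (intro sum.mono_neutral_right finite_pos_pairs) auto
      also have "\<dots> = 0" using \<open>i \<noteq> j\<close> ij(3) by simp
      finally show False using y_linear_independent[of ?u "fst i" "snd i"] ij(1) by simp
    qed
  qed
  have ind: "independent (?y ` pos_pairs n)"
  proof (rule independent_if_scalars_zero)
    fix f v assume s: "(\<Sum>v\<in>?y ` pos_pairs n. scale (f v) v) = 0" and v: "v \<in> ?y ` pos_pairs n"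
    from v obtain c d where cd: "(c, d) \<in> pos_pairs n" "v = y c d" by auto
    have "(\<Sum>(a, b)\<in>pos_pairs n. scale ((f \<circ> ?y) (a, b)) (y a b)) = 0"
      using s unfolding sum.reindex[OF inj] by (simp add: case_prod_beta o_def)
    from y_linear_independent[OF this cd(1)] show "f v = 0" by (simp add: cd(2))
  qed (simp add: finite_pos_pairs)
  from p.linear_independent_extend[OF ind, of "\<lambda>v. if v = y a b then 1 else 0"]
  obtain g where g: "Vector_Spaces.linear scale (*) g"
    "\<forall>v\<in>?y ` pos_pairs n. g v = (if v = y a b then 1 else 0)" by blast
  have gy: "g (y c d) = (if (c, d) = (a, b) then 1 else 0)" if cd: "(c, d) \<in> pos_pairs n" for c d
  proof -
    have "y c d \<in> ?y ` pos_pairs n" using cd by (intro image_eqI[of _ _ "(c, d)"]) auto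
    from bspec[OF g(2) this] show ?thesis using inj_on_eq_iff[OF inj cd ab] by simp
  qed
  have "Vector_Spaces.linear scale (*) (if m = (1::nat) then g else (\<lambda>_. 0))" for m
    using g(1) linearI'[OF vector_space_axioms vector_space_field, of "\<lambda>_. 0"] by simp
  from direct_sum_linear_exists[OF vector_space_axioms vector_space_field gr_decomposition,
      of "\<lambda>m. if m = 1 then g else (\<lambda>_. 0)", OF this]
  obtain f where f: "Vector_Spaces.linear scale (*) f"
    "\<And>m v. v \<in> gr m \<Longrightarrow> f v = (if m = 1 then g else (\<lambda>_. 0)) v" by blast
  have "f (y c d) = g (y c d)" if "(c, d) \<in> pos_pairs n" for c d
    using f(2)[of "y c d" 1] y_gr[of c d] that by (auto simp: pos_pairs_def)
  with f gy show ?thesis by (intro exI[of _ f]) auto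
qed

definition pos_coordinate :: "nat \<Rightarrow> nat \<Rightarrow> 'b \<Rightarrow> 'k"
  where "pos_coordinate a b = (SOME f. Vector_Spaces.linear scale (*) f \<and>
    (\<forall>m v. m \<noteq> 1 \<longrightarrow> v \<in> gr m \<longrightarrow> f v = 0) \<and>
    (\<forall>c d. (c, d) \<in> pos_pairs n \<longrightarrow> f (y c d) = (if (c, d) = (a, b) then 1 else 0)))"

text \<open>
  The coordinate of the root \<open>e\<^sub>a - e\<^sub>b\<close> on degree one, extended by 0 to the other degrees. Both signs
  of a root are allowed, so that transpositions simply permute the indices.
\<close>

definition \<phi> :: "nat \<Rightarrow> nat \<Rightarrow> 'b \<Rightarrow> 'k"
  where "\<phi> a b v = (if a < b then pos_coordinate a b v else - pos_coordinate b a v)"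

lemma pos_coordinate:
  assumes "(a, b) \<in> pos_pairs n"
  shows "Vector_Spaces.linear scale (*) (pos_coordinate a b)"
    "m \<noteq> 1 \<Longrightarrow> v \<in> gr m \<Longrightarrow> pos_coordinate a b v = 0"
    "(c, d) \<in> pos_pairs n \<Longrightarrow> pos_coordinate a b (y c d) = (if (c, d) = (a, b) then 1 else 0)"
  using someI_ex[OF coordinate_functional_exists[OF assms]] unfolding pos_coordinate_def by auto

abbreviation idx :: "nat \<Rightarrow> nat \<Rightarrow> bool"
  where "idx a b \<equiv> a \<in> {1..n} \<and> b \<in> {1..n} \<and> a \<noteq> b"

lemma \<phi>_linear:
  assumes "idx a b"
  shows "Vector_Spaces.linear scale (*) (\<phi> a b)"
proof (cases "a < b")
  case True
  with assms pos_coordinate(1)[of a b] show ?thesis by (simp add: \<phi>_def[abs_def] pos_pairs_def)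
next
  case False
  with assms have "Vector_Spaces.linear scale (*) (pos_coordinate b a)"
    by (intro pos_coordinate) (auto simp: pos_pairs_def)
  note l = linearD[OF this]
  show ?thesis
    by (rule linearI'[OF vector_space_axioms vector_space_field]) (use False in \<open>auto simp: \<phi>_def l\<close>)
qed

lemma \<phi>_off_degree_one:
  assumes "idx a b" "m \<noteq> 1" "v \<in> gr m"
  shows "\<phi> a b v = 0"
  using assms pos_coordinate(2)[of a b m v] pos_coordinate(2)[of b a m v]
  by (auto simp: \<phi>_def pos_pairs_def)

lemma \<phi>_y:
  assumes "idx a b" "idx c d"
  shows "\<phi> a b (y c d) = (if c = a \<and> d = b then 1 else if c = b \<and> d = a then - 1 else 0)"
proof -
  have *: "pos_coordinate a b (y c d) = (if c = a \<and> d = b then 1 else if c = b \<and> d = a then - 1 else 0)"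
    if "a < b" "idx a b" for a b
  proof (cases "c < d")
    case True
    then show ?thesis using that assms(2) pos_coordinate(3)[of a b c d] by (auto simp: pos_pairs_def)
  next
    case False
    have ab: "(a, b) \<in> pos_pairs n" using that by (auto simp: pos_pairs_def)
    have "y c d = - y d c" using assms(2) y_swap'[of d c] by auto
    moreover have "(d, c) \<in> pos_pairs n" using False assms(2) by (auto simp: pos_pairs_def)
    ultimately show ?thesis
      using that False assms(2) pos_coordinate(3)[OF ab, of d c] linearD(4)[OF pos_coordinate(1)[OF ab]]
      by auto
  qed
  show ?thesis
    using *[of a b] *[of b a] assms(1) by (cases "a < b") (auto simp: \<phi>_def)
qed

lemma \<phi>_act:
  assumes w: "w permutes {1..n}" and ab: "idx a b"
  shows "\<phi> (w a) (w b) (act w v) = \<phi> a b v"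
proof -
  have w_in: "w c \<in> {1..n} \<longleftrightarrow> c \<in> {1..n}" for c by (rule permutes_in_image[OF w])
  have w_eq: "w c = w d \<longleftrightarrow> c = d" for c d by (rule inj_eq[OF permutes_inj[OF w]])
  have carr: "w \<in> carrier (sym_group n)" using w by (simp add: sym_group_carrier)
  have wab: "idx (w a) (w b)" using ab by (simp only: w_in w_eq not_False_eq_True simp_thms)
  note al = linearD[OF act_linear[OF carr]] and fl = linearD[OF \<phi>_linear[OF wab]]
  have lin: "Vector_Spaces.linear scale (*) (\<lambda>v. \<phi> (w a) (w b) (act w v))"
    by (rule linearI'[OF vector_space_axioms vector_space_field]) (simp_all add: al fl)
  show ?thesis
  proof (rule linear_eq_on_gr[OF lin \<phi>_linear[OF ab]])
    fix m u assume u: "u \<in> gr m"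
    show "\<phi> (w a) (w b) (act w u) = \<phi> a b u"
    proof (cases "m = 1")
      case False
      with \<phi>_off_degree_one[OF wab False gr_act[OF carr u]] \<phi>_off_degree_one[OF ab False u]
      show ?thesis by simp
    next
      case True
      show ?thesis
      proof (rule linear_eq_on_span[OF lin \<phi>_linear[OF ab]])
        show "u \<in> span {y a b | a b. 1 \<le> a \<and> a < b \<and> b \<le> n}"
          using u unfolding True gr_1_span .
        fix v assume "v \<in> {y a b | a b. 1 \<le> a \<and> a < b \<and> b \<le> n}"
        then obtain c d where cd: "v = y c d" "idx c d" by auto
        from cd(2) have "idx (w c) (w d)" by (simp only: w_in w_eq not_False_eq_True simp_thms)
        from \<phi>_y[OF wab this] \<phi>_y[OF ab cd(2)] act_y[OF w, of c d] cd
        show "\<phi> (w a) (w b) (act w v) = \<phi> a b v" by (simp add: w_eq)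
      qed
    qed
  qed
qed

lemma \<phi>_y_mult:
  assumes "idx a b" "idx i j"
  shows "\<phi> a b (y i j * c) = \<phi> a b (y i j) * \<epsilon> c"
  by (rule degree_one_functional_mult[OF \<phi>_linear[OF assms(1)] \<phi>_off_degree_one[OF assms(1)]])
     (use assms y_gr in auto)

end


section \<open>Quadratic relations\<close>

context type_A_nichols
begin

lemma T_neg: "T (- a) b = - T a b" "T a (- b) = - T a b"
proof -
  have 0: "T 0 b = 0" "T a 0 = 0" using T_simps(1)[of 0 0 b] T_simps(2)[of a 0 0] by simp_all
  show "T (- a) b = - T a b" "T a (- b) = - T a b"
    using T_simps(1)[of a "- a" b] T_simps(2)[of a b "- b"] unfolding add.right_inverse 0
    by (simp_all only: eq_neg_iff_add_eq_0 add.commute)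
qed

lemma T_diff: "T (a - a') b = T a b - T a' b" "T a (b - b') = T a b - T a b'"
  using T_simps(1)[of a "- a'" b] T_simps(2)[of a b "- b'"] by (simp_all add: T_neg)

lemma comult_y_mult:
  assumes "idx i j"
  obtains L where "Vector_Spaces.linear fscale fscale L"
    "\<And>c d. L (T c d) = T (y i j * c) d + T (act (transpose i j) c) (y i j * d)"
    "\<And>c. \<Delta> (y i j * c) = L (\<Delta> c)"
  using comult_primitive_mult[OF y_primitive[of i j] transpose_carrier[of i j] y_deg[of i j]] assms
  by blast

lemma comult_y_y:
  assumes ij: "idx i j" and kl: "idx k l"
  shows "\<Delta> (y i j * y k l) = T (y i j * y k l) 1 + T 1 (y i j * y k l) +
    (T (y i j) (y k l) + T (y (transpose i j k) (transpose i j l)) (y i j))"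
proof -
  obtain L where L: "Vector_Spaces.linear fscale fscale L"
    "\<And>c d. L (T c d) = T (y i j * c) d + T (act (transpose i j) c) (y i j * d)"
    "\<And>c. \<Delta> (y i j * c) = L (\<Delta> c)" using comult_y_mult[OF ij] by blast
  have carr: "transpose i j \<in> carrier (sym_group n)" using ij by (intro transpose_carrier) auto
  have "act (transpose i j) (y k l) = y (transpose i j k) (transpose i j l)"
    using ij kl by (intro act_y permutes_swap_id) auto
  then show ?thesis
    using kl by (simp add: L(2,3) y_primitive linearD[OF L(1)] act_unit[OF carr])
qed

text \<open>
  The source of the relations: primitive elements have degree one, so a combination of
  quadratic monomials vanishes as soon as the mixed terms of its coproduct cancel.
\<close>

lemma primitive_degree_two:
  assumes "r \<in> gr 2" "\<Delta> r = T r 1 + T 1 r"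
  shows "r = 0"
proof -
  have "r \<in> gr 1" using assms(2) primitives by blast
  with assms(1) show ?thesis by (rule gr_disjoint) simp
qed

lemma y_y_gr: "idx i j \<Longrightarrow> idx k l \<Longrightarrow> y i j * y k l \<in> gr 2"
  using gr_mult[of "y i j" 1 "y k l" 1] y_gr by (simp add: numeral_2_eq_2)

lemma quadratic_square:
  assumes "idx i j"
  shows "y i j * y i j = 0"
proof (rule primitive_degree_two)
  show "y i j * y i j \<in> gr 2" using assms by (intro y_y_gr)
  show "\<Delta> (y i j * y i j) = T (y i j * y i j) 1 + T 1 (y i j * y i j)"
    unfolding comult_y_y[OF assms assms] using y_swap'[of i j] assms by (simp add: T_neg)
qed

lemma quadratic_commute:
  assumes "idx i j" "idx k l" "distinct [i, j, k, l]"
  shows "y i j * y k l = y k l * y i j"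
proof -
  let ?r = "y i j * y k l - y k l * y i j"
  have "?r = 0"
  proof (rule primitive_degree_two)
    show "?r \<in> gr 2" using assms by (intro subspace_diff[OF subspace_gr] y_y_gr)
    have "\<Delta> ?r = \<Delta> (y i j * y k l) - \<Delta> (y k l * y i j)"
      by (rule linearD(5)[OF comult_linear])
    also have "\<dots> = T ?r 1 + T 1 ?r"
      unfolding comult_y_y[OF assms(1,2)] comult_y_y[OF assms(2,1)] diff_conv_add_uminus
      using assms(3) by (simp add: transpose_def T_neg T_diff)
    finally show "\<Delta> ?r = T ?r 1 + T 1 ?r" .
  qed
  then show ?thesis by simp
qed

lemma quadratic_triangle:
  assumes "idx i j" "idx j k" "idx i k"
  shows "y i j * y j k = y j k * y i k + y i k * y i j"
proof -
  let ?r = "y i j * y j k - y j k * y i k - y i k * y i j"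
  have "?r = 0"
  proof (rule primitive_degree_two)
    show "?r \<in> gr 2" using assms by (intro subspace_diff[OF subspace_gr] y_y_gr)
    have kj: "y k j = - y j k" using assms by (intro y_swap') auto
    have "\<Delta> ?r = \<Delta> (y i j * y j k) - \<Delta> (y j k * y i k) - \<Delta> (y i k * y i j)"
      by (simp only: linearD(5)[OF comult_linear])
    also have "\<dots> = T ?r 1 + T 1 ?r"
      unfolding comult_y_y[OF assms(1,2)] comult_y_y[OF assms(2,3)] comult_y_y[OF assms(3,1)] diff_conv_add_uminus
      using assms by (simp add: transpose_def T_neg T_diff kj)
    finally show "\<Delta> ?r = T ?r 1 + T 1 ?r" .
  qed
  then show ?thesis by (simp add: algebra_simps)
qed

sublocale fk: fk_algebra scale n "(*)" 1 y
proof
  show "y j i = - y i j" if "i \<in> {1..n}" "j \<in> {1..n}" "i \<noteq> j" for i j using that by (rule y_swap')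
  show "y i j * y i j = 0" if "i \<in> {1..n}" "j \<in> {1..n}" "i \<noteq> j" for i j
    using that by (intro quadratic_square) auto
  show "y i j * y k l = y k l * y i j" if "{i, j, k, l} \<subseteq> {1..n}" "distinct [i, j, k, l]" for i j k l
    using that by (intro quadratic_commute) auto
  show "y i j * y j k = y j k * y i k + y i k * y i j" if "{i, j, k} \<subseteq> {1..n}" "distinct [i, j, k]" for i j k
    using that by (intro quadratic_triangle) auto
qed (simp_all add: mult.assoc distrib_left distrib_right scale_mult_left scale_mult_right)

lemma fk_opposite: "fk_algebra scale n (\<lambda>a b. b * a) 1 y"
proof
  show "y j i = - y i j" if "i \<in> {1..n}" "j \<in> {1..n}" "i \<noteq> j" for i j using that by (rule y_swap')
  show "y i j * y i j = 0" if "i \<in> {1..n}" "j \<in> {1..n}" "i \<noteq> j" for i j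
    using that by (intro quadratic_square) auto
  show "y k l * y i j = y i j * y k l" if "{i, j, k, l} \<subseteq> {1..n}" "distinct [i, j, k, l]" for i j k l
    using that by (intro quadratic_commute) auto
  show "y j k * y i j = y i k * y j k + y i j * y i k" if ijk: "{i, j, k} \<subseteq> {1..n}" "distinct [i, j, k]" for i j k
    using quadratic_triangle[of k j i] y_swap'[of i j] y_swap'[of j k] y_swap'[of i k] ijk
    by (simp add: add.commute)
qed (simp_all add: mult.assoc distrib_left distrib_right scale_mult_left scale_mult_right)


section \<open>Skew derivations\<close>

text \<open>
  The part of \<open>\<Delta> c\<close> whose left factor has degree one is the sum of the
  \<open>y a b \<otimes> left_der a b c\<close> over the positive roots, and the part whose right factor has degree one
  is the sum of the \<open>right_der a b c \<otimes> y a b\<close>.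
\<close>

definition left_der :: "nat \<Rightarrow> nat \<Rightarrow> 'b \<Rightarrow> 'b"
  where "left_der a b c = contract_left (\<phi> a b) (\<Delta> c)"

definition right_der :: "nat \<Rightarrow> nat \<Rightarrow> 'b \<Rightarrow> 'b"
  where "right_der a b c = contract_right (\<phi> a b) (\<Delta> c)"

lemma left_der_linear: "idx a b \<Longrightarrow> Vector_Spaces.linear scale scale (left_der a b)"
  using Vector_Spaces.linear_compose[OF comult_linear contract_left(1)[OF \<phi>_linear]]
  by (simp add: left_der_def[abs_def] o_def)

lemma right_der_linear: "idx a b \<Longrightarrow> Vector_Spaces.linear scale scale (right_der a b)"
  using Vector_Spaces.linear_compose[OF comult_linear contract_right(1)[OF \<phi>_linear]]
  by (simp add: right_der_def[abs_def] o_def)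

lemma contract_counit: "contract_left \<epsilon> (\<Delta> c) = c" "contract_right \<epsilon> (\<Delta> c) = c"
  using counit_left[of c] counit_right[of c] by (simp_all add: contract_left_def contract_right_def)

lemma counit_left_der:
  assumes "idx a b"
  shows "\<epsilon> (left_der a b c) = \<phi> a b c"
proof -
  note l = linearD[OF \<phi>_linear[OF assms]] and e = linearD[OF counit_linear]
  have "\<epsilon> (contract_left (\<phi> a b) (\<Delta> c)) = \<phi> a b (contract_right \<epsilon> (\<Delta> c))"
    by (rule linear_eq_on_comult[where s'="(*)",
          OF linear_comp[OF contract_left(1)[OF \<phi>_linear[OF assms]] counit_linear]
            linear_comp[OF contract_right(1)[OF counit_linear] \<phi>_linear[OF assms]]])
       (simp add: contract_left(2)[OF \<phi>_linear[OF assms]] contract_right(2)[OF counit_linear] l e)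
  then show ?thesis by (simp add: left_der_def contract_counit)
qed

lemma counit_right_der:
  assumes "idx a b"
  shows "\<epsilon> (right_der a b c) = \<phi> a b c"
proof -
  note l = linearD[OF \<phi>_linear[OF assms]] and e = linearD[OF counit_linear]
  have "\<epsilon> (contract_right (\<phi> a b) (\<Delta> c)) = \<phi> a b (contract_left \<epsilon> (\<Delta> c))"
    by (rule linear_eq_on_comult[where s'="(*)",
          OF linear_comp[OF contract_right(1)[OF \<phi>_linear[OF assms]] counit_linear]
            linear_comp[OF contract_left(1)[OF counit_linear] \<phi>_linear[OF assms]]])
       (simp add: contract_right(2)[OF \<phi>_linear[OF assms]] contract_left(2)[OF counit_linear] l e)
  then show ?thesis by (simp add: right_der_def contract_counit)
qed

text \<open>
  Moving a functional past \<open>y i j\<close> reflects its root; this is the braiding in the second summand.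
\<close>

lemma left_der_y_mult:
  assumes ab: "idx a b" and ij: "idx i j"
  shows "left_der a b (y i j * c) =
    scale (\<phi> a b (y i j)) c + y i j * left_der (transpose i j a) (transpose i j b) c"
proof -
  let ?t = "transpose i j"
  have t: "?t permutes {1..n}" using ij by (intro permutes_swap_id) auto
  have tab: "idx (?t a) (?t b)" using ab ij by (auto simp: transpose_def)
  obtain L where L: "Vector_Spaces.linear fscale fscale L"
    "\<And>c d. L (T c d) = T (y i j * c) d + T (act ?t c) (y i j * d)"
    "\<And>c. \<Delta> (y i j * c) = L (\<Delta> c)" using comult_y_mult[OF ij] by blast
  note c = contract_left[OF \<phi>_linear[OF ab]] and ct = contract_left[OF \<phi>_linear[OF tab]]
    and ce = contract_left[OF counit_linear]
  have act: "\<phi> a b (act ?t v) = \<phi> (?t a) (?t b) v" for v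
    using \<phi>_act[OF t tab, of v] by simp
  have "contract_left (\<phi> a b) (L (\<Delta> c)) =
      scale (\<phi> a b (y i j)) (contract_left \<epsilon> (\<Delta> c)) + y i j * contract_left (\<phi> (?t a) (?t b)) (\<Delta> c)"
  proof (rule linear_eq_on_comult[where s'=scale])
    show "Vector_Spaces.linear fscale scale (\<lambda>u. contract_left (\<phi> a b) (L u))"
      by (rule linearI'[OF vector_space_fscale vector_space_axioms]) (simp_all add: linearD[OF L(1)] linearD[OF c(1)])
    show "Vector_Spaces.linear fscale scale (\<lambda>u. scale (\<phi> a b (y i j)) (contract_left \<epsilon> u) +
        y i j * contract_left (\<phi> (?t a) (?t b)) u)"
      by (rule linearI'[OF vector_space_fscale vector_space_axioms])
         (simp_all add: linearD[OF ce(1)] linearD[OF ct(1)] scale_right_distrib distrib_left scale_mult_right mult.commute)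
    show "contract_left (\<phi> a b) (L (T u v)) = scale (\<phi> a b (y i j)) (contract_left \<epsilon> (T u v)) +
        y i j * contract_left (\<phi> (?t a) (?t b)) (T u v)" for u v
      by (simp add: L(2) linearD[OF c(1)] c(2) ct(2) ce(2) \<phi>_y_mult[OF ab ij] act scale_mult_right)
  qed
  then show ?thesis unfolding left_der_def L(3) contract_counit .
qed

text \<open>
  The second summand carries the action of \<open>transpose i j\<close>, but its coefficient vanishes unless
  \<open>{i, j} = {a, b}\<close>, so the reflection of the derivation itself can be written instead. This is
  what makes the Leibniz rule below hold for arbitrary factors.
\<close>

lemma right_der_y_mult:
  assumes ab: "idx a b" and ij: "idx i j"
  shows "right_der a b (y i j * c) =
    y i j * right_der a b c + scale (\<phi> a b (y i j)) (act (transpose a b) c)"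
proof -
  let ?t = "transpose i j"
  have carr: "?t \<in> carrier (sym_group n)" using ij by (intro transpose_carrier) auto
  obtain L where L: "Vector_Spaces.linear fscale fscale L"
    "\<And>c d. L (T c d) = T (y i j * c) d + T (act ?t c) (y i j * d)"
    "\<And>c. \<Delta> (y i j * c) = L (\<Delta> c)" using comult_y_mult[OF ij] by blast
  note c = contract_right[OF \<phi>_linear[OF ab]] and ce = contract_right[OF counit_linear]
  note al = linearD[OF act_linear[OF carr]]
  have "contract_right (\<phi> a b) (L (\<Delta> c)) =
      y i j * contract_right (\<phi> a b) (\<Delta> c) + scale (\<phi> a b (y i j)) (act ?t (contract_right \<epsilon> (\<Delta> c)))"
  proof (rule linear_eq_on_comult[where s'=scale])
    show "Vector_Spaces.linear fscale scale (\<lambda>u. contract_right (\<phi> a b) (L u))"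
      by (rule linearI'[OF vector_space_fscale vector_space_axioms]) (simp_all add: linearD[OF L(1)] linearD[OF c(1)])
    show "Vector_Spaces.linear fscale scale (\<lambda>u. y i j * contract_right (\<phi> a b) u +
        scale (\<phi> a b (y i j)) (act ?t (contract_right \<epsilon> u)))"
      by (rule linearI'[OF vector_space_fscale vector_space_axioms])
         (simp_all add: linearD[OF ce(1)] linearD[OF c(1)] al scale_right_distrib distrib_left scale_mult_right mult.commute)
    show "contract_right (\<phi> a b) (L (T u v)) = y i j * contract_right (\<phi> a b) (T u v) +
        scale (\<phi> a b (y i j)) (act ?t (contract_right \<epsilon> (T u v)))" for u v
      by (simp add: L(2) linearD[OF c(1)] c(2) ce(2) \<phi>_y_mult[OF ab ij] al scale_mult_right)
  qed
  moreover have "scale (\<phi> a b (y i j)) (act ?t c) = scale (\<phi> a b (y i j)) (act (transpose a b) c)"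
    using \<phi>_y[OF ab ij] by (auto simp: transpose_commute)
  ultimately show ?thesis unfolding right_der_def L(3) contract_counit by simp
qed

lemma
  assumes "idx a b"
  shows left_der_one: "left_der a b 1 = 0" and right_der_one: "right_der a b 1 = 0"
proof -
  have "\<phi> a b 1 = 0" by (rule \<phi>_off_degree_one[OF assms _ gr_unit]) simp
  then show "left_der a b 1 = 0" "right_der a b 1 = 0"
    using contract_left[OF \<phi>_linear[OF assms]] contract_right[OF \<phi>_linear[OF assms]]
    by (simp_all add: left_der_def right_der_def comult_unit)
qed

lemma right_der_mult:
  assumes ab: "idx a b"
  shows "right_der a b (u * c) = u * right_der a b c + right_der a b u * act (transpose a b) c"
proof -
  have carr: "transpose a b \<in> carrier (sym_group n)" using ab by (intro transpose_carrier) auto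
  note d = linearD[OF right_der_linear[OF ab]]
  let ?A = "{u. \<forall>c. right_der a b (u * c) = u * right_der a b c + right_der a b u * act (transpose a b) c}"
  have sub: "subspace ?A"
    unfolding subspace_def
    by (simp add: d distrib_right scale_mult_left scale_right_distrib algebra_simps)
  have y: "y i j \<in> ?A" if "idx i j" for i j
    using right_der_y_mult[OF ab that] right_der_y_mult[OF ab that, of 1]
    by (simp add: right_der_one[OF ab] act_unit[OF carr] scale_mult_left)
  have "?A = UNIV"
  proof (rule subalgebra_UNIV[OF sub])
    show "1 \<in> ?A" by (simp add: right_der_one[OF ab])
    show "gr 1 \<subseteq> ?A" unfolding gr_1_span by (rule span_minimal[OF _ sub]) (use y in auto)
    show "u * v \<in> ?A" if "u \<in> ?A" "v \<in> ?A" for u v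
      using that by (simp add: mult.assoc distrib_left distrib_right act_mult[OF carr] add.assoc)
  qed
  then show ?thesis by blast
qed

lemma right_der_act:
  assumes w: "w permutes {1..n}" and ab: "idx a b" and wab: "idx (w a) (w b)"
  shows "right_der (w a) (w b) (act w c) = act w (right_der a b c)"
proof -
  have carr: "w \<in> carrier (sym_group n)" using w by (simp add: sym_group_carrier)
  note al = linearD[OF act_linear[OF carr]]
  have bil: "bilinear_map scale scale fscale (\<lambda>a b. T (act w a) (act w b))"
    by (rule bilinear_mapI) (simp_all add: vector_space_axioms vector_space_fscale al T_simps)
  note tl = tlift_T[OF bil vector_space_fscale]
  note c = contract_right[OF \<phi>_linear[OF wab]] and c' = contract_right[OF \<phi>_linear[OF ab]]
  have "contract_right (\<phi> (w a) (w b)) (tensor_map scale (act w) (act w) (\<Delta> c)) =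
      act w (contract_right (\<phi> a b) (\<Delta> c))"
    unfolding tensor_map_def
    by (rule linear_eq_on_comult[where s'=scale, OF linear_comp[OF tl(1) c(1)]
          linear_comp[OF c'(1) act_linear[OF carr]]])
       (simp add: tl(2) c(2) c'(2) al \<phi>_act[OF w ab])
  then show ?thesis by (simp add: right_der_def comult_act[OF carr])
qed

lemma right_der_gr:
  assumes ab: "idx a b" and v: "v \<in> gr m"
  shows "right_der a b v \<in> (if m = 0 then {0} else gr (m - 1))" (is "_ \<in> ?G")
proof -
  interpret t: vector_space "fscale :: 'k \<Rightarrow> (('b \<Rightarrow> 'b \<Rightarrow> 'k) \<Rightarrow> 'k) \<Rightarrow> _" by (rule vector_space_fscale)
  note c = contract_right[OF \<phi>_linear[OF ab]]
  have sub: "subspace ?G" by (simp add: subspace_gr)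
  have "contract_right (\<phi> a b) t \<in> ?G"
    if "t \<in> t.span {T a b | a b. \<exists>i j. i + j = m \<and> a \<in> gr i \<and> b \<in> gr j}" for t
    using that
  proof (induction rule: t.span_induct_alt)
    case base
    show ?case unfolding linearD(3)[OF c(1)] by (rule subspace_0[OF sub])
  next
    case (step r t u)
    then obtain i j p q where t: "t = T p q" "i + j = m" "p \<in> gr i" "q \<in> gr j" by blast
    have p: "scale (\<phi> a b q) p \<in> ?G"
    proof (cases "j = 1")
      case True
      with t show ?thesis by (auto intro: subspace_scale[OF subspace_gr])
    next
      case False
      from \<phi>_off_degree_one[OF ab False t(4)] show ?thesis using subspace_0[OF sub] by simp
    qed
    show ?case unfolding linearD(1,2)[OF c(1)] t(1) c(2)
      by (rule subspace_add[OF sub subspace_scale[OF sub p] step(2)])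
  qed
  from this[OF gr_comult[OF v]] show ?thesis unfolding right_der_def .
qed

text \<open>
  Coassociativity: both sides contract the first and the last factor of the iterated coproduct.
\<close>

lemma left_der_right_der_commute:
  assumes ab: "idx a b" and cd: "idx c d"
  shows "left_der a b (right_der c d v) = right_der c d (left_der a b v)"
proof (rule functionals_separate)
  fix f :: "'b \<Rightarrow> 'k" assume f: "Vector_Spaces.linear scale (*) f"
  note fl = linearD[OF f] and p = linearD[OF \<phi>_linear[OF ab]] and q = linearD[OF \<phi>_linear[OF cd]]
  note cl = contract_left[OF \<phi>_linear[OF ab]] and cr = contract_right[OF \<phi>_linear[OF cd]]
  \<comment> \<open>evaluating both sides of coassociativity at this form gives the two sides of the claim\<close>
  define \<tau> where "\<tau> = (\<lambda>u v w. \<phi> a b u * f v * \<phi> c d w)"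
  have \<tau>: "trilinear_form scale \<tau>"
    unfolding trilinear_form_def \<tau>_def
    by (intro conjI allI linearI'[OF vector_space_axioms vector_space_field])
       (simp_all add: fl p q algebra_simps)
  have ev: "tens3 scale u v w \<tau> = \<phi> a b u * f v * \<phi> c d w" for u v w
    using \<tau> by (simp add: tens3_def \<tau>_def)
  have bl: "bilinear_map scale scale fscale (\<lambda>u v. tens3 scale u v w)"
    and br: "bilinear_map scale scale fscale (\<lambda>v w. tens3 scale u v w)" for u w
    by (rule bilinear_mapI; simp add: vector_space_axioms vector_space_fscale tens3_simps)+
  note tl = tlift_T[OF bl vector_space_fscale] and tr = tlift_T[OF br vector_space_fscale]
  have evl: "tlift scale scale fscale (\<lambda>u v. tens3 scale u v w) t \<tau> = f (contract_left (\<phi> a b) t) * \<phi> c d w"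
    if "t \<in> tensors" for t w
    by (rule linear_eq_on_tensors[where s'="(*)", OF linear_apply[OF tl(1)]
          linear_scalar_mult(2)[OF linear_comp[OF cl(1) f]] _ that])
       (simp add: tl(2) ev cl(2) fl)
  have evr: "tlift scale scale fscale (\<lambda>v w. tens3 scale u v w) t \<tau> = \<phi> a b u * f (contract_right (\<phi> c d) t)"
    if "t \<in> tensors" for t u
    by (rule linear_eq_on_tensors[where s'="(*)", OF linear_apply[OF tr(1)]
          linear_scalar_mult(1)[OF linear_comp[OF cr(1) f]] _ that])
       (simp add: tr(2) ev cr(2) fl mult.commute)
  have bL: "bilinear_map scale scale fscale (\<lambda>u w. tlift scale scale fscale (\<lambda>u' v. tens3 scale u' v w) (\<Delta> u))"
  proof (rule bilinear_mapI[OF vector_space_axioms vector_space_axioms vector_space_fscale])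
    show "tlift scale scale fscale (\<lambda>u' v. tens3 scale u' v (w + w')) (\<Delta> u) =
        tlift scale scale fscale (\<lambda>u' v. tens3 scale u' v w) (\<Delta> u) +
        tlift scale scale fscale (\<lambda>u' v. tens3 scale u' v w') (\<Delta> u)" for u w w'
      using tlift_linear_comb[OF vector_space_fscale bl bl bl _ comult_range, of "w + w'" 1 w w' u]
      by (simp add: tens3_simps fscale_simps)
    show "tlift scale scale fscale (\<lambda>u' v. tens3 scale u' v (scale r w)) (\<Delta> u) =
        fscale r (tlift scale scale fscale (\<lambda>u' v. tens3 scale u' v w) (\<Delta> u))" for u r w
      using tlift_linear_comb[OF vector_space_fscale bl bl bl _ comult_range, of "scale r w" "r - 1" w w u]
      by (simp add: tens3_simps fscale_def fun_eq_iff algebra_simps)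
  qed (simp_all add: linearD[OF comult_linear] linearD[OF tl(1)])
  have bR: "bilinear_map scale scale fscale (\<lambda>u w. tlift scale scale fscale (\<lambda>v w'. tens3 scale u v w') (\<Delta> w))"
  proof (rule bilinear_mapI[OF vector_space_axioms vector_space_axioms vector_space_fscale])
    fix u u' w
    have "tlift scale scale fscale (tens3 scale (u + u')) (\<Delta> w) =
        fscale 1 (tlift scale scale fscale (tens3 scale u) (\<Delta> w)) +
        tlift scale scale fscale (tens3 scale u') (\<Delta> w)"
      by (rule tlift_linear_comb[OF vector_space_fscale br br br _ comult_range])
         (simp add: tens3_simps fscale_simps)
    then show "tlift scale scale fscale (tens3 scale (u + u')) (\<Delta> w) =
        tlift scale scale fscale (tens3 scale u) (\<Delta> w) +
        tlift scale scale fscale (tens3 scale u') (\<Delta> w)"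
      unfolding fscale_simps(4) .
  next
    fix u r w
    have "tlift scale scale fscale (tens3 scale (scale r u)) (\<Delta> w) =
        fscale (r - 1) (tlift scale scale fscale (tens3 scale u) (\<Delta> w)) +
        tlift scale scale fscale (tens3 scale u) (\<Delta> w)"
      by (rule tlift_linear_comb[OF vector_space_fscale br br br _ comult_range])
         (simp add: tens3_simps fscale_def fun_eq_iff algebra_simps)
    also have "\<dots> = fscale r (tlift scale scale fscale (tens3 scale u) (\<Delta> w))"
      by (simp add: fscale_def fun_eq_iff algebra_simps)
    finally show "tlift scale scale fscale (tens3 scale (scale r u)) (\<Delta> w) =
        fscale r (tlift scale scale fscale (tens3 scale u) (\<Delta> w))" .
  qed (simp_all add: linearD[OF comult_linear] linearD[OF tr(1)])
  note tL = tlift_T[OF bL vector_space_fscale] and tR = tlift_T[OF bR vector_space_fscale]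
  note dl = linearD[OF left_der_linear[OF ab]] and dr = linearD[OF right_der_linear[OF cd]]
  have "comult_left scale \<Delta> (\<Delta> v) \<tau> = f (left_der a b (contract_right (\<phi> c d) (\<Delta> v)))"
    unfolding comult_left_def
    by (rule linear_eq_on_comult[where s'="(*)", OF linear_apply[OF tL(1)]
          linear_comp[OF linear_comp[OF cr(1) left_der_linear[OF ab]] f]])
       (simp add: tL(2) evl[OF comult_range] cr(2) dl fl left_der_def[symmetric])
  moreover have "comult_right scale \<Delta> (\<Delta> v) \<tau> = f (right_der c d (contract_left (\<phi> a b) (\<Delta> v)))"
    unfolding comult_right_def
    by (rule linear_eq_on_comult[where s'="(*)", OF linear_apply[OF tR(1)]
          linear_comp[OF linear_comp[OF cl(1) right_der_linear[OF cd]] f]])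
       (simp add: tR(2) evr[OF comult_range] cl(2) dr fl right_der_def[symmetric])
  ultimately show "f (left_der a b (right_der c d v)) = f (right_der c d (left_der a b v))"
    by (simp add: coassoc left_der_def right_der_def)
qed

end


section \<open>The pairing with the nilCoxeter algebra\<close>

context type_A_nichols
begin

lemma X_gr:
  assumes "p permutes {1..n}"
  shows "fk.X p \<in> gr (inv_count n p)"
  using assms
proof (induction rule: permutation_word_induct)
  case id
  show ?case by (simp only: fk.X_id inv_count_id gr_unit)
next
  case (step p i)
  have "y i (Suc i) \<in> gr 1" using step(2) by (intro y_gr) (auto simp: descent_def)
  from gr_mult[OF this step.IH] show ?case
    by (simp only: fk.X_descent[OF step(1,2)] step(5) plus_1_eq_Suc)
qed

text \<open>
  Left derivations delete a letter from a reduced word: the result is a multiple of the monomial of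
  the reflected permutation, and is zero unless the length drops by exactly one.
\<close>

lemma left_der_X:
  assumes "p permutes {1..n}" "idx a b"
  shows "\<exists>c. left_der a b (fk.X p) = scale c (fk.X (p \<circ> transpose a b)) \<and>
    (c \<noteq> 0 \<longrightarrow> Suc (inv_count n (p \<circ> transpose a b)) = inv_count n p)"
  using assms
proof (induction arbitrary: a b rule: permutation_word_induct)
  case id
  then show ?case using left_der_one[of a b] by (intro exI[of _ 0]) (simp add: fk.X_id[unfolded id_def] id_def)
next
  case (step p i)
  \<comment> \<open>the root either is the one of the first letter, or is reflected and passed to the other letters\<close>
  let ?s = "adj i" let ?q = "p \<circ> adj i"
  have i: "idx i (Suc i)" "1 \<le> i" "i < n" using step(2) by (auto simp: descent_def)
  have sab: "idx (?s a) (?s b)" using step.prems i by (auto simp: transpose_def)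
  note D = left_der_y_mult[OF step.prems i(1), of "fk.X ?q"]
  from step.IH[OF sab] obtain c where c: "left_der (?s a) (?s b) (fk.X ?q) = scale c (fk.X (?q \<circ> transpose (?s a) (?s b)))"
    "c \<noteq> 0 \<longrightarrow> Suc (inv_count n (?q \<circ> transpose (?s a) (?s b))) = inv_count n ?q" by blast
  have conj: "?q \<circ> transpose (?s a) (?s b) \<circ> ?s = p \<circ> transpose a b"
    by (auto simp: fun_eq_iff transpose_def)
  show ?case
  proof (cases "{a, b} = {i, Suc i}")
    case True
    then have tr: "transpose (?s a) (?s b) = ?s" "transpose a b = ?s"
      by (auto simp: doubleton_eq_iff transpose_commute)
    then have "?q \<circ> transpose (?s a) (?s b) = p" by (simp add: o_assoc[symmetric])
    with c step(5) have "c = 0" by auto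
    with D c(1) have "left_der a b (fk.X p) = scale (\<phi> a b (y i (Suc i))) (fk.X ?q)"
      unfolding fk.X_descent[OF step(1,2)] by simp
    then show ?thesis using step(5) unfolding tr
      by (intro exI[of _ "\<phi> a b (y i (Suc i))"]) (simp del: o_apply)
  next
    case False
    then have "\<phi> a b (y i (Suc i)) = 0" using \<phi>_y[OF step.prems i(1)] by auto
    with D have D': "left_der a b (fk.X p) = scale c (y i (Suc i) * fk.X (?q \<circ> transpose (?s a) (?s b)))" (is "_ = scale c (_ * fk.X ?r)")
      unfolding fk.X_descent[OF step(1,2)] c(1) by (simp add: scale_mult_right)
    have r: "?r permutes {1..n}" using sab by (intro fk.permutes_comp_transpose[OF step(4)]) auto
    note yr = fk.y_mult_X[OF r i(2,3)]
    show ?thesis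
    proof (cases "?r i < ?r (Suc i)")
      case True
      have "inv_count n (?r \<circ> ?s) = Suc (inv_count n ?r)"
        by (rule inv_count_comp_ascent[OF i(2,3) True])
      with c(2) step(5) show ?thesis
        unfolding D' yr if_P[OF True] conj by (intro exI[of _ c] conjI refl) (simp del: o_apply)
    next
      case False
      show ?thesis unfolding D' yr if_not_P[OF False] by (intro exI[of _ 0]) simp
    qed
  qed
qed

text \<open>
  For \<open>a > b\<close> the root is negative; the equivalence says that \<open>p\<close> preserves the order of \<open>a\<close> and
  \<open>b\<close> for either sign. The statement is stable under the reflections that occur in the
  induction.
\<close>

lemma left_der_X_noninversion:
  assumes "p permutes {1..n}" "idx a b" "a < b \<longleftrightarrow> p a < p b"
  shows "left_der a b (fk.X p) = 0"
  using assms
proof (induction arbitrary: a b rule: permutation_word_induct)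
  case id
  show ?case unfolding fk.X_id by (rule left_der_one[OF id(1)])
next
  case (step p i)
  let ?s = "adj i"
  have i: "idx i (Suc i)" "p (Suc i) < p i" using step(2) by (auto simp: descent_def)
  have ne: "\<not> (a = i \<and> b = Suc i)" "\<not> (a = Suc i \<and> b = i)" using i step.prems by auto
  have sab: "idx (?s a) (?s b)" using step.prems i by (auto simp: transpose_def)
  have "?s a < ?s b \<longleftrightarrow> a < b" using ne by (auto simp: transpose_def)
  then have "left_der (?s a) (?s b) (fk.X (p \<circ> ?s)) = 0"
    using step.prems by (intro step.IH sab) simp
  moreover have "\<phi> a b (y i (Suc i)) = 0" using \<phi>_y[OF step.prems(1) i(1)] ne by auto
  ultimately show ?case
    unfolding fk.X_descent[OF step(1,2)] left_der_y_mult[OF step.prems(1) i(1)] by simp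
qed

lemma left_der_X_descent:
  assumes p: "p permutes {1..n}" and d: "descent n p i"
  shows "left_der i (Suc i) (fk.X p) = fk.X (p \<circ> adj i)"
proof -
  have i: "idx i (Suc i)" "idx (Suc i) i" "p (Suc i) < p i" "1 \<le> i" "i < n" using d by (auto simp: descent_def)
  have "left_der (Suc i) i (fk.X (p \<circ> adj i)) = 0"
    by (rule left_der_X_noninversion[OF permutes_adj[OF p i(4,5)] i(2)]) (use i in simp)
  then show ?thesis
    unfolding fk.X_descent[OF p d] left_der_y_mult[OF i(1,1)] using \<phi>_y[OF i(1,1)] by simp
qed

text \<open>
  Compositions of derivations along a list of roots, in opposite orders: \<open>left_path\<close> applies the
  last root first and \<open>right_path\<close> applies the first root first.
\<close>

primrec left_path :: "(nat \<times> nat) list \<Rightarrow> 'b \<Rightarrow> 'b"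
  where "left_path [] v = v"
  | "left_path (r # rs) v = left_der (fst r) (snd r) (left_path rs v)"

primrec right_path :: "(nat \<times> nat) list \<Rightarrow> 'b \<Rightarrow> 'b"
  where "right_path [] v = v"
  | "right_path (r # rs) v = right_path rs (right_der (fst r) (snd r) v)"

abbreviation roots_list :: "(nat \<times> nat) list \<Rightarrow> bool"
  where "roots_list rs \<equiv> \<forall>r\<in>set rs. idx (fst r) (snd r)"

lemma left_path_append: "left_path (rs @ ss) v = left_path rs (left_path ss v)"
  by (induction rs) simp_all

lemma right_path_linear: "roots_list rs \<Longrightarrow> Vector_Spaces.linear scale scale (right_path rs)"
proof (induction rs)
  case Nil
  show ?case by (rule linearI'[OF vector_space_axioms vector_space_axioms]) simp_all
next
  case (Cons r rs)
  then have "Vector_Spaces.linear scale scale (\<lambda>v. right_path rs (right_der (fst r) (snd r) v))"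
    by (intro linear_comp[OF right_der_linear]) auto
  then show ?case by simp
qed

text \<open>
  The outermost right derivation agrees with a left derivation under the counit, and the left
  derivation commutes with all remaining right derivations. Repeating this turns right derivations
  into left ones and reverses their order.
\<close>

lemma counit_right_path:
  assumes "roots_list rs"
  shows "\<epsilon> (right_path rs v) = \<epsilon> (left_path rs v)"
  using assms
proof (induction rs arbitrary: v)
  case (Cons r rs)
  have r: "idx (fst r) (snd r)" "roots_list rs" using Cons.prems by auto
  have "\<epsilon> (right_path (r # rs) v) = \<epsilon> (left_path rs (right_der (fst r) (snd r) v))"
    using Cons.IH[OF r(2)] by simp
  also have "left_path rs (right_der (fst r) (snd r) v) = right_der (fst r) (snd r) (left_path rs v)"
    using r(2)
  proof (induction rs)
    case (Cons q qs)
    then show ?case using left_der_right_der_commute[OF _ r(1), of "fst q" "snd q" "left_path qs v"] by simp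
  qed simp
  also have "\<epsilon> \<dots> = \<epsilon> (left_path (r # rs) v)"
    by (simp add: counit_right_der[OF r(1)] counit_left_der[OF r(1)])
  finally show ?case .
qed simp

lemma right_path_gr:
  assumes "roots_list rs" "v \<in> gr m" "m \<le> length rs"
  shows "right_path rs v \<in> (if m = length rs then gr 0 else {0})"
  using assms
proof (induction rs arbitrary: v m)
  case (Cons r rs)
  have r: "idx (fst r) (snd r)" "roots_list rs" using Cons.prems by auto
  show ?case
  proof (cases m)
    case 0
    then have "right_der (fst r) (snd r) v = 0" using right_der_gr[OF r(1) Cons.prems(2)] by simp
    then show ?thesis using 0 linearD(3)[OF right_path_linear[OF r(2)]] by simp
  next
    case (Suc k)
    then have "right_der (fst r) (snd r) v \<in> gr k" using right_der_gr[OF r(1) Cons.prems(2)] by simp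
    from Cons.IH[OF r(2) this] show ?thesis using Suc Cons.prems(3) by simp
  qed
qed simp

lemma gr_0_counit: "v \<in> gr 0 \<Longrightarrow> v = scale (\<epsilon> v) 1"
  using connected counit_scale_one by auto

primrec path_perm :: "(nat \<times> nat) list \<Rightarrow> nat \<Rightarrow> nat"
  where "path_perm [] = id"
  | "path_perm (r # rs) = path_perm rs \<circ> transpose (fst r) (snd r)"

lemma path_perm_permutes: "roots_list rs \<Longrightarrow> path_perm rs permutes {1..n}"
proof (induction rs)
  case Nil
  show ?case by (simp add: permutes_id[unfolded id_def] id_def)
next
  case (Cons r rs)
  then show ?case unfolding path_perm.simps by (intro fk.permutes_comp_transpose) auto
qed

lemma left_path_X:
  assumes "roots_list rs" "q permutes {1..n}"
  shows "\<exists>c. left_path rs (fk.X q) = scale c (fk.X (q \<circ> path_perm rs)) \<and>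
    (c \<noteq> 0 \<longrightarrow> inv_count n (q \<circ> path_perm rs) + length rs = inv_count n q)"
  using assms(1)
proof (induction rs)
  case Nil
  show ?case by (intro exI[of _ 1]) simp
next
  case (Cons r rs)
  have r: "idx (fst r) (snd r)" "roots_list rs" using Cons.prems by auto
  let ?p = "q \<circ> path_perm rs"
  have p: "?p permutes {1..n}" by (rule permutes_compose[OF path_perm_permutes[OF r(2)] assms(2)])
  from Cons.IH[OF r(2)] obtain c where c: "left_path rs (fk.X q) = scale c (fk.X ?p)"
    "c \<noteq> 0 \<longrightarrow> inv_count n ?p + length rs = inv_count n q" by blast
  from left_der_X[OF p r(1)] obtain d where d: "left_der (fst r) (snd r) (fk.X ?p) = scale d (fk.X (?p \<circ> transpose (fst r) (snd r)))"
    "d \<noteq> 0 \<longrightarrow> Suc (inv_count n (?p \<circ> transpose (fst r) (snd r))) = inv_count n ?p" by blast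
  show ?case
    unfolding path_perm.simps left_path.simps o_assoc c(1) linearD(2)[OF left_der_linear[OF r(1)]] d(1)
    by (intro exI[of _ "c * d"]) (use c(2) d(2) in \<open>auto simp del: o_apply\<close>)
qed

text \<open>
  The result vanishes if \<open>X q\<close> is shorter than the path. Otherwise it has degree zero, hence is
  determined by its counit, which is computed with left derivations. Those lead from \<open>X q\<close> to a multiple of
  the monomial of \<open>q \<circ> path_perm rs\<close>, which has degree zero only if \<open>q\<close> is the inverse of
  \<open>path_perm rs\<close>. The assumption on \<open>X p\<close> says that this inverse is \<open>p\<close>.
\<close>

lemma right_path_X:
  assumes rs: "roots_list rs" "length rs = inv_count n p" "left_path rs (fk.X p) = 1"
    and p: "p permutes {1..n}" and q: "q permutes {1..n}" "inv_count n q \<le> inv_count n p"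
  shows "\<epsilon> (right_path rs (fk.X q)) = (if q = p then 1 else 0)"
    "right_path rs (fk.X q) = (if q = p then 1 else 0)"
proof -
  have id: "q \<circ> path_perm rs = id \<or> left_path rs (fk.X q) = 0"
    if q: "q permutes {1..n}" "inv_count n q = length rs" for q
  proof -
    have "(q \<circ> path_perm rs) permutes {1..n}"
      by (rule permutes_compose[OF path_perm_permutes[OF rs(1)] q(1)])
    then have *: "inv_count n (q \<circ> path_perm rs) = 0 \<Longrightarrow> q \<circ> path_perm rs = id" by (rule inv_count_0)
    obtain c where c: "left_path rs (fk.X q) = scale c (fk.X (q \<circ> path_perm rs))"
      "c \<noteq> 0 \<longrightarrow> inv_count n (q \<circ> path_perm rs) + length rs = inv_count n q"
      using left_path_X[OF rs(1) q(1)] by blast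
    show ?thesis
    proof (cases "c = 0")
      case True
      with c(1) show ?thesis by simp
    next
      case False
      with c(2) q(2) have "inv_count n (q \<circ> path_perm rs) = 0" by linarith
      with * show ?thesis by blast
    qed
  qed
  have gr: "right_path rs (fk.X q) \<in> (if inv_count n q = length rs then gr 0 else {0})"
    by (rule right_path_gr[OF rs(1) X_gr[OF q(1)]]) (use q rs in simp)
  have "left_path rs (fk.X q) = 0" if "q \<noteq> p" "inv_count n q = length rs"
  proof (rule ccontr)
    assume "left_path rs (fk.X q) \<noteq> 0"
    with id[OF q(1) that(2)] have 1: "q \<circ> path_perm rs = id" by simp
    from id[OF p] rs have 2: "p \<circ> path_perm rs = id" by simp
    have "surj (path_perm rs)" by (rule permutes_surj[OF path_perm_permutes[OF rs(1)]])
    have "q z = p z" for z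
    proof -
      obtain w where "z = path_perm rs w" using surjD[OF \<open>surj (path_perm rs)\<close>] by blast
      with fun_cong[OF 1, of w] fun_cong[OF 2, of w] show ?thesis by simp
    qed
    with that(1) show False by (simp add: fun_eq_iff)
  qed
  then have "\<epsilon> (left_path rs (fk.X q)) = (if q = p then 1 else 0)" if "inv_count n q = length rs"
    using that rs(3) by (auto simp: counit_unit linearD[OF counit_linear])
  then show e: "\<epsilon> (right_path rs (fk.X q)) = (if q = p then 1 else 0)"
    using gr rs(2) counit_right_path[OF rs(1), of "fk.X q"] by (auto simp: linearD[OF counit_linear] split: if_splits)
  show "right_path rs (fk.X q) = (if q = p then 1 else 0)"
  proof (cases "inv_count n q = length rs")
    case True
    with gr have "right_path rs (fk.X q) = scale (\<epsilon> (right_path rs (fk.X q))) 1" by (intro gr_0_counit) simp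
    then show ?thesis using e by simp
  next
    case False
    with gr rs(2) show ?thesis by auto
  qed
qed

text \<open>
  Simple derivations along a word; the reversal makes \<open>left_path\<close> remove the first letter first.
\<close>

definition simple_path :: "nat list \<Rightarrow> (nat \<times> nat) list"
  where "simple_path is = rev (map (\<lambda>i. (i, Suc i)) is)"

lemma red_word_set:
  assumes "p permutes {1..n}" "i \<in> set (red_word n p)"
  shows "1 \<le> i" "i < n"
proof -
  have "1 \<le> i \<and> i < n"
    using assms
  proof (induction rule: permutation_word_induct)
    case id
    then show ?case by (simp only: red_word_id) simp
  next
    case (step p j)
    from step.prems step.IH show ?case
      unfolding step(3) using step(2) by (auto simp: descent_def simp del: o_apply)
  qed
  then show "1 \<le> i" "i < n" by auto
qed

lemma red_word_length: "p permutes {1..n} \<Longrightarrow> length (red_word n p) = inv_count n p"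
proof (induction rule: permutation_word_induct)
  case id
  show ?case by (simp only: red_word_id inv_count_id list.size(3))
next
  case (step p i)
  show ?case unfolding step(3,5) length_Cons step.IH ..
qed

lemma roots_list_simple_path: "p permutes {1..n} \<Longrightarrow> roots_list (simple_path (red_word n p))"
proof
  fix r assume p: "p permutes {1..n}" and "r \<in> set (simple_path (red_word n p))"
  then obtain i where i: "r = (i, Suc i)" "i \<in> set (red_word n p)" by (auto simp: simple_path_def)
  from red_word_set[OF p i(2)] show "idx (fst r) (snd r)" by (simp add: i(1))
qed

lemma left_path_simple_path:
  assumes "p permutes {1..n}"
  shows "left_path (simple_path (red_word n p)) (fk.X p) = 1"
  using assms
proof (induction rule: permutation_word_induct)
  case id
  show ?case by (simp only: red_word_id fk.X_id) (simp add: simple_path_def)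
next
  case (step p i)
  then show ?case
    unfolding step(3) using left_der_X_descent[OF step(1,2)]
    by (simp add: simple_path_def left_path_append del: o_apply)
qed

text \<open>
  The inversions of \<open>p\<close> in the order in which a reduced word produces them. They arise when the
  reflections in \<open>twisted_ders\<close> below are moved to the left, past the derivations.
\<close>

primrec inversion_path :: "nat list \<Rightarrow> (nat \<times> nat) list"
  where "inversion_path [] = []"
  | "inversion_path (i # is) = (i, Suc i) # map (map_prod (adj i) (adj i)) (inversion_path is)"

lemma inversion_path_length: "length (inversion_path is) = length is"
  by (induction "is") simp_all

lemma inversion_path_inversions:
  assumes "p permutes {1..n}" "(a, b) \<in> set (inversion_path (red_word n p))"
  shows "(a, b) \<in> inversions n p"
  using assms
proof (induction arbitrary: a b rule: permutation_word_induct)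
  case id
  then show ?case by (simp only: red_word_id inversion_path.simps) simp
next
  case (step p i)
  from step.prems step.IH show ?case
    unfolding step(3) inversions_comp_adj[OF step(2)] by (auto simp del: o_apply)
qed

lemma roots_list_inversion_path: "p permutes {1..n} \<Longrightarrow> roots_list (inversion_path (red_word n p))"
proof
  fix r assume p: "p permutes {1..n}" and r: "r \<in> set (inversion_path (red_word n p))"
  obtain a b where ab: "r = (a, b)" by (cases r)
  from inversion_path_inversions[OF p r[unfolded ab]] show "idx (fst r) (snd r)"
    by (simp add: inversions_def ab)
qed

text \<open>
  A reflected root list passes through the letter \<open>y i (Suc i)\<close> unchanged, provided that the letter
  itself is never hit.
\<close>

lemma left_path_map_adj:
  assumes i: "idx i (Suc i)" and rs: "roots_list rs" "(i, Suc i) \<notin> set rs" "(Suc i, i) \<notin> set rs"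
  shows "left_path (map (map_prod (adj i) (adj i)) rs) (y i (Suc i) * v) = y i (Suc i) * left_path rs v"
  using rs
proof (induction rs)
  case (Cons r rs)
  obtain a b where r: "r = (a, b)" by (cases r)
  have ab: "idx a b" "idx (adj i a) (adj i b)" using Cons.prems i by (auto simp: r transpose_def)
  have "\<phi> (adj i a) (adj i b) (y i (Suc i)) = 0"
    using \<phi>_y[OF ab(2) i] Cons.prems by (auto simp: r transpose_def split: if_splits)
  then show ?case using Cons left_der_y_mult[OF ab(2) i, of "left_path rs v"] by (simp add: r)
qed simp

lemma left_path_inversion_path:
  assumes "p permutes {1..n}"
  shows "left_path (inversion_path (red_word n p)) (fk.X p) = 1"
  using assms
proof (induction rule: permutation_word_induct)
  case id
  show ?case by (simp only: red_word_id fk.X_id inversion_path.simps left_path.simps)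
next
  case (step p i)
  have i: "idx i (Suc i)" "idx (Suc i) i" "p (Suc i) < p i" using step(2) by (auto simp: descent_def)
  let ?rs = "inversion_path (red_word n (p \<circ> adj i))"
  have "(i, Suc i) \<notin> inversions n (p \<circ> adj i)" "(Suc i, i) \<notin> inversions n (p \<circ> adj i)"
    using i(3) by (auto simp: inversions_def)
  then have ni: "(i, Suc i) \<notin> set ?rs" "(Suc i, i) \<notin> set ?rs"
    using inversion_path_inversions[OF step(4)] by blast+
  have eq: "left_path (map (map_prod (adj i) (adj i)) ?rs) (fk.X p) = y i (Suc i) * left_path ?rs (fk.X (p \<circ> adj i))"
    unfolding fk.X_descent[OF step(1,2)]
    by (rule left_path_map_adj[OF i(1) roots_list_inversion_path[OF step(4)] ni])
  show ?case
    unfolding step(3) inversion_path.simps left_path.simps fst_conv snd_conv eq step.IH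
      left_der_y_mult[OF i(1,1)] transpose_apply_first transpose_apply_second left_der_one[OF i(2)] \<phi>_y[OF i(1,1)]
    by simp
qed

text \<open>
  Iterates of the twisted derivation \<open>v \<mapsto> s\<^sub>i (\<partial>\<^sub>i v)\<close>, which satisfies
  \<open>s\<^sub>i (\<partial>\<^sub>i (u v)) = s\<^sub>i (\<partial>\<^sub>i u) \<cdot> v + s\<^sub>i u \<cdot> s\<^sub>i (\<partial>\<^sub>i v)\<close>: it is linear over elements of the kernel of
  \<open>\<partial>\<^sub>i\<close> on the right.
\<close>

primrec twisted_ders :: "nat list \<Rightarrow> 'b \<Rightarrow> 'b"
  where "twisted_ders [] v = v"
  | "twisted_ders (i # is) v = twisted_ders is (act (adj i) (right_der i (Suc i) v))"

lemma right_path_act: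
  assumes w: "w permutes {1..n}" and rs: "roots_list rs"
  shows "right_path (map (map_prod w w) rs) (act w v) = act w (right_path rs v)"
  using rs
proof (induction rs arbitrary: v)
  case (Cons r rs)
  have w_in: "w c \<in> {1..n} \<longleftrightarrow> c \<in> {1..n}" for c by (rule permutes_in_image[OF w])
  have w_eq: "w c = w d \<longleftrightarrow> c = d" for c d by (rule inj_eq[OF permutes_inj[OF w]])
  have r: "idx (fst r) (snd r)" "roots_list rs" using Cons.prems by auto
  then have "idx (w (fst r)) (w (snd r))" by (simp only: w_in w_eq not_False_eq_True simp_thms)
  from right_der_act[OF w r(1) this] Cons.IH[OF r(2)] show ?case by simp
qed simp

lemma act_adj_twice:
  assumes "idx a b"
  shows "act (transpose a b) (act (transpose a b) v) = v"
proof -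
  have "transpose a b \<in> carrier (sym_group n)" using assms by (intro transpose_carrier) auto
  from act_comp[OF this this, of v] have "act (transpose a b) (act (transpose a b) v) = act id v"
    by (simp only: sym_group_mult transpose_comp_involutory)
  also have "act id v = v" using act_one[of v] by (simp only: sym_group_one)
  finally show ?thesis .
qed

lemma right_path_adj:
  assumes "idx i (Suc i)" "roots_list rs"
  shows "right_path (map (map_prod (adj i) (adj i)) rs) v = act (adj i) (right_path rs (act (adj i) v))"
  using right_path_act[OF _ assms(2), of "adj i" "act (adj i) v"] assms act_adj_twice[of i "Suc i" v]
  by (simp add: permutes_swap_id)

text \<open>
  The counit is invariant under the group, so after conjugating every derivation by the reflections
  on its left, only right derivations at the inversions remain.
\<close>

lemma counit_twisted_ders:
  assumes "p permutes {1..n}"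
  shows "\<epsilon> (twisted_ders (red_word n p) v) = \<epsilon> (right_path (inversion_path (red_word n p)) v)"
  using assms
proof (induction arbitrary: v rule: permutation_word_induct)
  case id
  show ?case by (simp only: red_word_id twisted_ders.simps inversion_path.simps right_path.simps)
next
  case (step p i)
  have i: "idx i (Suc i)" using step(2) by (auto simp: descent_def)
  have carr: "adj i \<in> carrier (sym_group n)" using i by (intro transpose_carrier) auto
  show ?case
    unfolding step(3) twisted_ders.simps inversion_path.simps right_path.simps step.IH fst_conv snd_conv
      right_path_adj[OF i roots_list_inversion_path[OF step(4)]] counit_act[OF carr] ..
qed

lemma twisted_ders_linear:
  "\<forall>i\<in>set is. 1 \<le> i \<and> i < n \<Longrightarrow> Vector_Spaces.linear scale scale (twisted_ders is)"
proof (induction "is")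
  case Nil
  show ?case by (rule linearI'[OF vector_space_axioms vector_space_axioms]) simp_all
next
  case (Cons i "is")
  then have i: "idx i (Suc i)" by auto
  have carr: "adj i \<in> carrier (sym_group n)" using i by (intro transpose_carrier) auto
  have "Vector_Spaces.linear scale scale (\<lambda>v. twisted_ders is (act (adj i) (right_der i (Suc i) v)))"
    using Cons by (intro linear_comp[OF linear_comp[OF right_der_linear[OF i] act_linear[OF carr]]]) auto
  then show ?case by simp
qed

lemma twisted_ders_gr:
  assumes "\<forall>i\<in>set is. 1 \<le> i \<and> i < n" "v \<in> gr m" "m \<le> length is"
  shows "twisted_ders is v \<in> (if m = length is then gr 0 else {0})"
  using assms
proof (induction "is" arbitrary: v m)
  case (Cons i "is")
  have i: "idx i (Suc i)" "\<forall>i\<in>set is. 1 \<le> i \<and> i < n" using Cons.prems by auto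
  have carr: "adj i \<in> carrier (sym_group n)" using i by (intro transpose_carrier) auto
  show ?case
  proof (cases m)
    case 0
    then have "right_der i (Suc i) v = 0" using right_der_gr[OF i(1) Cons.prems(2)] by simp
    then show ?thesis using 0 linearD(3)[OF twisted_ders_linear[OF i(2)]] linearD(3)[OF act_linear[OF carr]] by simp
  next
    case (Suc k)
    then have "act (adj i) (right_der i (Suc i) v) \<in> gr k"
      using right_der_gr[OF i(1) Cons.prems(2)] by (intro gr_act[OF carr]) simp
    from Cons.IH[OF i(2) this] show ?thesis using Suc Cons.prems(3) by simp
  qed
qed simp

lemma twisted_ders_X:
  assumes p: "p permutes {1..n}" and q: "q permutes {1..n}" "inv_count n q \<le> inv_count n p"
  shows "twisted_ders (red_word n p) (fk.X q) = (if q = p then 1 else 0)"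
proof -
  have len: "length (red_word n p) = inv_count n p" by (rule red_word_length[OF p])
  have gr: "twisted_ders (red_word n p) (fk.X q) \<in> (if inv_count n q = inv_count n p then gr 0 else {0})"
    using twisted_ders_gr[OF _ X_gr[OF q(1)], of "red_word n p"] red_word_set[OF p] q(2) len by simp
  have e: "\<epsilon> (twisted_ders (red_word n p) (fk.X q)) = (if q = p then 1 else 0)"
    unfolding counit_twisted_ders[OF p]
    by (rule right_path_X(1)[OF roots_list_inversion_path[OF p] _ left_path_inversion_path[OF p] p q])
       (simp add: inversion_path_length len)
  show ?thesis
  proof (cases "inv_count n q = inv_count n p")
    case True
    with gr have "twisted_ders (red_word n p) (fk.X q) = scale (\<epsilon> (twisted_ders (red_word n p) (fk.X q))) 1"
      by (intro gr_0_counit) simp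
    then show ?thesis using e by simp
  next
    case False
    with gr show ?thesis by auto
  qed
qed

end


section \<open>From triangularity to tensor product decompositions\<close>

text \<open>
  Among the indices with nonzero coefficient, the operator of one of maximal length isolates its own
  coefficient.
\<close>

lemma triangular_family_zero:
  fixes E :: "'i \<Rightarrow> 'b::ab_group_add \<Rightarrow> 'b" and h :: "'i \<Rightarrow> 'b \<Rightarrow> 'b" and len :: "'i \<Rightarrow> nat"
  assumes P: "finite P" and sum0: "(\<Sum>q\<in>P. h q (b q)) = 0"
    and E: "\<And>p. p \<in> P \<Longrightarrow> Vector_Spaces.linear s s (E p)" and h0: "\<And>q. h q 0 = 0"
    and tri: "\<And>p q. p \<in> P \<Longrightarrow> q \<in> P \<Longrightarrow> len q \<le> len p \<Longrightarrow> E p (h q (b q)) = (if q = p then b p else 0)"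
  shows "\<forall>p\<in>P. b p = 0"
proof (rule ccontr)
  assume "\<not> (\<forall>p\<in>P. b p = 0)"
  then have ne: "{p\<in>P. b p \<noteq> 0} \<noteq> {}" by blast
  have fin: "finite (len ` {p\<in>P. b p \<noteq> 0})" using P by simp
  obtain p where p: "p \<in> P" "b p \<noteq> 0" "len p = Max (len ` {p\<in>P. b p \<noteq> 0})"
    using Max_in[OF fin] ne by auto
  have max: "len q \<le> len p" if "q \<in> P" "b q \<noteq> 0" for q
    unfolding p(3) using fin that by (intro Max_ge) auto
  interpret E: Vector_Spaces.linear s s "E p" by (rule E[OF p(1)])
  have "0 = E p (\<Sum>q\<in>P. h q (b q))" unfolding sum0 by simp
  also have "\<dots> = (\<Sum>q\<in>P. E p (h q (b q)))" by (rule E.sum)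
  also have "\<dots> = (\<Sum>q\<in>P. if q = p then b p else 0)"
  proof (rule sum.cong[OF refl])
    fix q assume q: "q \<in> P"
    show "E p (h q (b q)) = (if q = p then b p else 0)"
      using tri[OF p(1) q] max[OF q] p(2) h0 by (cases "b q = 0") auto
  qed
  also have "\<dots> = b p" using P p(1) by simp
  finally show False using p(2) by simp
qed

lemma span_bilinear_expansion:
  assumes \<beta>: "bilinear_map s1 s2 s3 \<beta>" and P: "finite P" and C: "module.subspace s2 C"
    and A: "A \<subseteq> module.span s1 (X ` P)"
    and t: "t \<in> module.span s3 {\<beta> a c | a c. a \<in> A \<and> c \<in> C}"
    and s: "vector_space s1" "vector_space s2" "vector_space s3"
  shows "\<exists>b. (\<forall>p\<in>P. b p \<in> C) \<and> t = (\<Sum>p\<in>P. \<beta> (X p) (b p))"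
proof -
  interpret s1: vector_space s1 by fact
  interpret s2: vector_space s2 by fact
  interpret s3: vector_space s3 by fact
  note \<beta>D = bilinear_mapD[OF \<beta>]
  define Q where "Q t \<longleftrightarrow> (\<exists>b. (\<forall>p\<in>P. b p \<in> C) \<and> t = (\<Sum>p\<in>P. \<beta> (X p) (b p)))" for t
  have \<beta>0: "\<beta> a 0 = 0" "\<beta> 0 c = 0" for a c using \<beta>D(2)[of a 0 0] \<beta>D(1)[of 0 0 c] by simp_all
  have Q0: "Q 0"
    unfolding Q_def using s2.subspace_0[OF C] by (intro exI[of _ "\<lambda>_. 0"]) (simp add: \<beta>0)
  have Q_add: "Q (t + u)" if tu: "Q t" "Q u" for t u
  proof -
    obtain b b' where b: "\<forall>p\<in>P. b p \<in> C" "t = (\<Sum>p\<in>P. \<beta> (X p) (b p))"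
      "\<forall>p\<in>P. b' p \<in> C" "u = (\<Sum>p\<in>P. \<beta> (X p) (b' p))" using tu unfolding Q_def by blast
    then show ?thesis unfolding Q_def
      by (intro exI[of _ "\<lambda>p. b p + b' p"]) (simp add: \<beta>D sum.distrib s2.subspace_add[OF C])
  qed
  have Q_scale: "Q (s3 r t)" if "Q t" for r t
  proof -
    obtain b where b: "\<forall>p\<in>P. b p \<in> C" "t = (\<Sum>p\<in>P. \<beta> (X p) (b p))" using \<open>Q t\<close> unfolding Q_def by blast
    then show ?thesis unfolding Q_def
      by (intro exI[of _ "\<lambda>p. s2 r (b p)"]) (simp add: \<beta>D s3.scale_sum_right s2.subspace_scale[OF C])
  qed
  have Q_X: "Q (\<beta> (X p) c)" if "p \<in> P" "c \<in> C" for p c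
  proof -
    have "(\<Sum>q\<in>P. \<beta> (X q) (if q = p then c else 0)) = (\<Sum>q\<in>P. if q = p then \<beta> (X q) c else 0)"
      by (rule sum.cong) (simp_all add: \<beta>0)
    also have "\<dots> = \<beta> (X p) c" using P that by simp
    finally show ?thesis unfolding Q_def
      using that s2.subspace_0[OF C] by (intro exI[of _ "\<lambda>q. if q = p then c else 0"]) auto
  qed
  have Q_\<beta>: "Q (\<beta> a c)" if "a \<in> s1.span (X ` P)" "c \<in> C" for a c
    using that(1)
  proof (induction rule: s1.span_induct_alt)
    case base
    show ?case by (simp only: \<beta>0 Q0)
  next
    case (step r v a)
    then obtain p where "p \<in> P" "v = X p" by blast
    with Q_X[OF _ that(2)] step(2) show ?case by (simp only: \<beta>D Q_add Q_scale)
  qed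
  have "Q t"
    using t
  proof (induction rule: s3.span_induct_alt)
    case (step r v u)
    then obtain a c where "v = \<beta> a c" "a \<in> A" "c \<in> C" by blast
    with A Q_\<beta>[of a c] step(2) show ?case by (intro Q_add Q_scale) auto
  qed (rule Q0)
  then show ?thesis unfolding Q_def .
qed

context braided_hopf_algebra
begin

lemma mult_map_linear: "Vector_Spaces.linear fscale scale (mult_map scale)"
  and mult_map_T: "mult_map scale (T a b) = a * b"
proof -
  have b: "bilinear_map scale scale scale (*)"
    by (rule bilinear_mapI) (simp_all add: vector_space_axioms algebra_simps scale_mult_left scale_mult_right)
  show "Vector_Spaces.linear fscale scale (mult_map scale)" "mult_map scale (T a b) = a * b"
    unfolding mult_map_def by (rule tlift_T[OF b vector_space_axioms])+
qed

lemma bij_betw_mult_map: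
  assumes surj: "span {a * c | a c. a \<in> A \<and> c \<in> C} = UNIV"
    and inj: "\<And>t. t \<in> tensor_space scale scale A C \<Longrightarrow> mult_map scale t = 0 \<Longrightarrow> t = 0"
  shows "bij_betw (mult_map scale) (tensor_space scale scale A C) UNIV"
proof -
  interpret t: vector_space "fscale :: 'k \<Rightarrow> (('b \<Rightarrow> 'b \<Rightarrow> 'k) \<Rightarrow> 'k) \<Rightarrow> _" by (rule vector_space_fscale)
  interpret m: Vector_Spaces.linear fscale scale "mult_map scale" by (rule mult_map_linear)
  let ?S = "{T a c | a c. a \<in> A \<and> c \<in> C}"
  have "mult_map scale ` t.span ?S = span (mult_map scale ` ?S)" by (rule m.span_image[symmetric])
  also have "mult_map scale ` ?S = {a * c | a c. a \<in> A \<and> c \<in> C}"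
    using mult_map_T by (auto simp: image_iff) (metis mult_map_T)
  finally have "mult_map scale ` t.span ?S = UNIV" using surj by simp
  moreover have "inj_on (mult_map scale) (t.span ?S)"
  proof (rule inj_onI)
    fix t u assume tu: "t \<in> t.span ?S" "u \<in> t.span ?S" "mult_map scale t = mult_map scale u"
    have "t - u \<in> t.span ?S" by (rule t.span_diff[OF tu(1,2)])
    moreover have "mult_map scale (t - u) = 0" unfolding m.diff tu(3) by simp
    ultimately have "t - u = 0" by (intro inj) (simp_all only: tensor_space_def)
    then show "t = u" by (simp only: right_minus_eq)
  qed
  ultimately show ?thesis by (simp add: bij_betw_def tensor_space_def)
qed

end

lemma
  fixes scale :: "'k::field \<Rightarrow> 'b::ring_1 \<Rightarrow> 'b"
  assumes "vector_space scale"
  shows subalgebra_generated_subalgebra: "subalgebra scale (generated_subalgebra scale Z)"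
    and generated_subalgebra_superset: "Z \<subseteq> generated_subalgebra scale Z"
    and generated_subalgebra_minimal: "Z \<subseteq> A \<Longrightarrow> subalgebra scale A \<Longrightarrow> generated_subalgebra scale Z \<subseteq> A"
proof -
  interpret vector_space scale by fact
  show "subalgebra scale (generated_subalgebra scale Z)"
    unfolding generated_subalgebra_def
    by (rule hull_in) (auto simp: subalgebra_def subspace_def)
  show "Z \<subseteq> generated_subalgebra scale Z" unfolding generated_subalgebra_def by (rule hull_subset)
  show "Z \<subseteq> A \<Longrightarrow> subalgebra scale A \<Longrightarrow> generated_subalgebra scale Z \<subseteq> A"
    unfolding generated_subalgebra_def by (rule hull_minimal)
qed

context type_A_nichols
begin

abbreviation "N \<equiv> nilcoxeter n scale x"
abbreviation "B' \<equiv> B_prime n scale x"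
abbreviation "perms \<equiv> {p. p permutes {1..n}}"

lemma subalgebra_N: "subalgebra scale N" and subalgebra_B': "subalgebra scale B'"
  unfolding nilcoxeter_def B_prime_def
  by (rule subalgebra_generated_subalgebra[OF vector_space_axioms])+

lemma y_in_N: "1 \<le> i \<Longrightarrow> i < n \<Longrightarrow> y i (Suc i) \<in> N"
  unfolding nilcoxeter_def
  by (rule subsetD[OF generated_subalgebra_superset[OF vector_space_axioms]])
     (auto simp: y_def root_vec_def simple_roots_def)

lemma nonsimple_generators: "x ` (pos_roots n - simple_roots n) = {y a b | a b. 1 \<le> a \<and> Suc a < b \<and> b \<le> n}"
proof -
  have simple: "root_vec a b \<in> simple_roots n \<longleftrightarrow> b = Suc a" if "1 \<le> a" "a < b" "b \<le> n" for a b
  proof -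
    have "root_vec a b = unit_vec i - unit_vec (Suc i) \<longleftrightarrow> a = i \<and> b = Suc i" for i
      using root_vec_eq_iff[of a b i "Suc i"] that by (auto simp: root_vec_def)
    then show ?thesis using that by (auto simp: simple_roots_def)
  qed
  have pos: "pos_roots n = {root_vec a b | a b. 1 \<le> a \<and> a < b \<and> b \<le> n}"
    by (fastforce simp: pos_roots_def root_vec_def)
  have "pos_roots n - simple_roots n =
      {root_vec a b | a b. 1 \<le> a \<and> a < b \<and> b \<le> n \<and> root_vec a b \<notin> simple_roots n}"
    unfolding pos by blast
  also have "\<dots> = {root_vec a b | a b. 1 \<le> a \<and> Suc a < b \<and> b \<le> n}"
  proof -
    have "1 \<le> a \<and> a < b \<and> b \<le> n \<and> root_vec a b \<notin> simple_roots n \<longleftrightarrow> 1 \<le> a \<and> Suc a < b \<and> b \<le> n" for a b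
      using simple[of a b] by auto
    then show ?thesis by simp
  qed
  finally show ?thesis by (auto simp: y_def)
qed

lemma y_in_B': "1 \<le> a \<Longrightarrow> Suc a < b \<Longrightarrow> b \<le> n \<Longrightarrow> y a b \<in> B'"
  unfolding B_prime_def nonsimple_generators
  by (rule subsetD[OF generated_subalgebra_superset[OF vector_space_axioms]]) blast

lemma N_subset_span_X: "N \<subseteq> span (fk.X ` perms)"
proof -
  let ?A = "{a. \<forall>v\<in>span (fk.X ` perms). a * v \<in> span (fk.X ` perms)}"
  have "N \<subseteq> ?A"
    unfolding nilcoxeter_def
  proof (rule generated_subalgebra_minimal[OF vector_space_axioms])
    show "x ` simple_roots n \<subseteq> ?A"
    proof
      fix v assume "v \<in> x ` simple_roots n"
      then obtain i where "v = y i (Suc i)" "1 \<le> i" "i < n"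
        by (auto simp: simple_roots_def y_def root_vec_def)
      then show "v \<in> ?A" using fk.y_mult_span_X[of i] by simp
    qed
    show "subalgebra scale ?A"
      unfolding subalgebra_def subspace_def
      by (auto simp: distrib_right mult.assoc scale_mult_left intro: span_zero span_add span_scale)
  qed
  moreover have "1 \<in> span (fk.X ` perms)"
    by (rule span_base) (rule image_eqI[of _ _ id]; simp only: fk.X_id mem_Collect_eq permutes_id)
  ultimately show ?thesis by force
qed

text \<open>
  The elements \<open>b\<close> with this property form a subalgebra, and it contains every generator of root
  different from the simple root, up to sign.
\<close>

lemma right_der_B':
  assumes i: "1 \<le> i" "i < n" and b: "b \<in> B'"
  shows "right_der i (Suc i) (b * v) = b * right_der i (Suc i) v"
proof -
  have idx: "idx i (Suc i)" using i by auto
  note d = linearD[OF right_der_linear[OF idx]]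
  let ?A = "{b. \<forall>v. right_der i (Suc i) (b * v) = b * right_der i (Suc i) v}"
  have "B' \<subseteq> ?A"
    unfolding B_prime_def
  proof (rule generated_subalgebra_minimal[OF vector_space_axioms])
    show "x ` (pos_roots n - simple_roots n) \<subseteq> ?A"
    proof
      fix z assume "z \<in> x ` (pos_roots n - simple_roots n)"
      then obtain a b where z: "z = y a b" "1 \<le> a" "Suc a < b" "b \<le> n" unfolding nonsimple_generators by blast
      then have ab: "idx a b" by auto
      from z \<phi>_y[OF idx ab] have "\<phi> i (Suc i) (y a b) = 0" by auto
      with right_der_y_mult[OF idx ab] show "z \<in> ?A" by (simp add: z(1))
    qed
    show "subalgebra scale ?A"
      unfolding subalgebra_def subspace_def
      by (auto simp: distrib_right mult.assoc scale_mult_left d)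
  qed
  with b show ?thesis by blast
qed

lemma right_path_B':
  assumes "\<forall>r\<in>set rs. 1 \<le> fst r \<and> fst r < n \<and> snd r = Suc (fst r)" "b \<in> B'"
  shows "right_path rs (b * v) = b * right_path rs v"
  using assms(1) by (induction rs arbitrary: v) (simp_all add: right_der_B'[OF _ _ assms(2)])

lemma twisted_ders_B':
  assumes "\<forall>i\<in>set is. 1 \<le> i \<and> i < n" "b \<in> B'"
  shows "twisted_ders is (v * b) = twisted_ders is v * b"
  using assms(1)
proof (induction "is" arbitrary: v)
  case (Cons i "is")
  then have i: "1 \<le> i" "i < n" and idx: "idx i (Suc i)" by auto
  have carr: "adj i \<in> carrier (sym_group n)" using idx by (intro transpose_carrier) auto
  have "right_der i (Suc i) b = 0"
    using right_der_B'[OF i assms(2), of 1] right_der_one[OF idx] by simp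
  then have "act (adj i) (right_der i (Suc i) (v * b)) = act (adj i) (right_der i (Suc i) v) * b"
    unfolding right_der_mult[OF idx] by (simp add: act_mult[OF carr] act_adj_twice[OF idx])
  with Cons show ?case by simp
qed simp

text \<open>
  The first equality comes from the algebra itself, the second from its opposite.
\<close>

lemma spanning:
  "span {a * c | a c. a \<in> N \<and> c \<in> B'} = UNIV" "span {c * a | c a. c \<in> B' \<and> a \<in> N} = UNIV"
proof -
  have N1: "1 \<in> N" and B1: "1 \<in> B'" using subalgebra_N subalgebra_B' by (auto simp: subalgebra_def)
  have Nm: "u * v \<in> N" if "u \<in> N" "v \<in> N" for u v using that subalgebra_N by (auto simp: subalgebra_def)
  have Bm: "u * v \<in> B'" if "u \<in> B'" "v \<in> B'" for u v using that subalgebra_B' by (auto simp: subalgebra_def)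
  have gen: "A = UNIV" if A: "subspace A" "1 \<in> A" "\<And>u v. u \<in> A \<Longrightarrow> v \<in> A \<Longrightarrow> u * v \<in> A"
    "\<And>a b. 1 \<le> a \<Longrightarrow> a < b \<Longrightarrow> b \<le> n \<Longrightarrow> y a b \<in> A" for A
  proof (rule subalgebra_UNIV[OF A(1-3)])
    show "gr 1 \<subseteq> A" unfolding gr_1_span by (rule span_minimal[OF _ A(1)]) (use A(4) in blast)
  qed
  show "span {a * c | a c. a \<in> N \<and> c \<in> B'} = UNIV"
  proof (rule fk.products_span[OF N1 _ B1])
    show "y i (Suc i) * z \<in> N" if "1 \<le> i" "i < n" "z \<in> N" for i z by (rule Nm[OF y_in_N[OF that(1,2)] that(3)])
    show "z * y a b \<in> B'" if "1 \<le> a" "Suc a < b" "b \<le> n" "z \<in> B'" for a b z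
      by (rule Bm[OF that(4) y_in_B'[OF that(1-3)]])
  qed (rule gen)
  interpret op: fk_algebra scale n "\<lambda>a b. b * a" 1 y by (rule fk_opposite)
  have "span {w * z | z w. z \<in> N \<and> w \<in> B'} = UNIV"
  proof (rule op.products_span[OF N1 _ B1])
    show "z * y i (Suc i) \<in> N" if "1 \<le> i" "i < n" "z \<in> N" for i z by (rule Nm[OF that(3) y_in_N[OF that(1,2)]])
    show "y a b * z \<in> B'" if "1 \<le> a" "Suc a < b" "b \<le> n" "z \<in> B'" for a b z
      by (rule Bm[OF y_in_B'[OF that(1-3)] that(4)])
  qed (rule gen)
  moreover have "{w * z | z w. z \<in> N \<and> w \<in> B'} = {c * a | c a. c \<in> B' \<and> a \<in> N}" by blast
  ultimately show "span {c * a | c a. c \<in> B' \<and> a \<in> N} = UNIV" by simp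
qed

lemma finite_perms: "finite perms" by (rule finite_permutations) simp

lemma X_left_independent:
  assumes "\<forall>p\<in>perms. b p \<in> B'" "(\<Sum>p\<in>perms. fk.X p * b p) = 0"
  shows "\<forall>p\<in>perms. b p = 0"
proof (rule triangular_family_zero[where h = "\<lambda>p v. fk.X p * v" and E = "\<lambda>p. twisted_ders (red_word n p)"
      and len = "inv_count n" and s = scale, OF finite_perms assms(2)])
  fix p assume p: "p \<in> perms"
  show "Vector_Spaces.linear scale scale (twisted_ders (red_word n p))"
    using red_word_set p by (intro twisted_ders_linear) auto
  fix q assume q: "q \<in> perms" "inv_count n q \<le> inv_count n p"
  have "twisted_ders (red_word n p) (fk.X q * b q) = twisted_ders (red_word n p) (fk.X q) * b q"
    using red_word_set p q(1) assms(1) by (intro twisted_ders_B') auto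
  also have "twisted_ders (red_word n p) (fk.X q) = (if q = p then 1 else 0)"
    using p q by (intro twisted_ders_X) auto
  finally show "twisted_ders (red_word n p) (fk.X q * b q) = (if q = p then b p else 0)" by auto
qed simp

lemma X_right_independent:
  assumes "\<forall>p\<in>perms. b p \<in> B'" "(\<Sum>p\<in>perms. b p * fk.X p) = 0"
  shows "\<forall>p\<in>perms. b p = 0"
proof (rule triangular_family_zero[where h = "\<lambda>p v. v * fk.X p" and E = "\<lambda>p. right_path (simple_path (red_word n p))"
      and len = "inv_count n" and s = scale, OF finite_perms assms(2)])
  fix p assume p: "p \<in> perms"
  then have p': "p permutes {1..n}" by simp
  show "Vector_Spaces.linear scale scale (right_path (simple_path (red_word n p)))"
    by (rule right_path_linear[OF roots_list_simple_path[OF p']])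
  fix q assume q: "q \<in> perms" "inv_count n q \<le> inv_count n p"
  have "right_path (simple_path (red_word n p)) (b q * fk.X q) = b q * right_path (simple_path (red_word n p)) (fk.X q)"
    using red_word_set[OF p'] q(1) assms(1) by (intro right_path_B') (auto simp: simple_path_def)
  also have "right_path (simple_path (red_word n p)) (fk.X q) = (if q = p then 1 else 0)"
    by (rule right_path_X(2)[OF roots_list_simple_path[OF p'] _ left_path_simple_path[OF p'] p'])
       (use q in \<open>simp_all add: simple_path_def red_word_length[OF p']\<close>)
  finally show "right_path (simple_path (red_word n p)) (b q * fk.X q) = (if q = p then b p else 0)" by auto
qed simp

lemma tensor_decompositions:
  "bij_betw (mult_map scale) (tensor_space scale scale N B') UNIV"
  "bij_betw (mult_map scale) (tensor_space scale scale B' N) UNIV"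
proof -
  interpret m: Vector_Spaces.linear fscale scale "mult_map scale" by (rule mult_map_linear)
  note bt = bilinear_tens[OF vector_space_axioms vector_space_axioms]
  have sub: "subspace B'" using subalgebra_B' by (simp add: subalgebra_def)
  have T0: "T a 0 = 0" "T 0 a = 0" for a using T_simps(2)[of a 0 0] T_simps(1)[of 0 0 a] by simp_all
  show "bij_betw (mult_map scale) (tensor_space scale scale N B') UNIV"
  proof (rule bij_betw_mult_map[OF spanning(1)])
    fix t assume t: "t \<in> tensor_space scale scale N B'" "mult_map scale t = 0"
    from span_bilinear_expansion[OF bt finite_perms sub N_subset_span_X t(1)[unfolded tensor_space_def]
        vector_space_axioms vector_space_axioms vector_space_fscale]
    obtain b where b: "\<forall>p\<in>perms. b p \<in> B'" "t = (\<Sum>p\<in>perms. T (fk.X p) (b p))" by blast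
    have "(\<Sum>p\<in>perms. fk.X p * b p) = 0"
      using t(2) unfolding b(2) m.sum mult_map_T .
    from X_left_independent[OF b(1) this] show "t = 0" unfolding b(2) by (intro sum.neutral) (simp add: T0)
  qed
  show "bij_betw (mult_map scale) (tensor_space scale scale B' N) UNIV"
  proof (rule bij_betw_mult_map[OF spanning(2)])
    fix t assume t: "t \<in> tensor_space scale scale B' N" "mult_map scale t = 0"
    have bt': "bilinear_map scale scale fscale (\<lambda>a c. T c a)"
      using bt by (simp add: bilinear_map_def)
    have "{T a c | a c. a \<in> B' \<and> c \<in> N} = {T c a | a c. a \<in> N \<and> c \<in> B'}" by blast
    with t(1) have t': "t \<in> module.span fscale {T c a | a c. a \<in> N \<and> c \<in> B'}"
      by (simp add: tensor_space_def)
    from span_bilinear_expansion[OF bt' finite_perms sub N_subset_span_X t'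
        vector_space_axioms vector_space_axioms vector_space_fscale]
    obtain b where b: "\<forall>p\<in>perms. b p \<in> B'" "t = (\<Sum>p\<in>perms. T (b p) (fk.X p))" by blast
    have "(\<Sum>p\<in>perms. b p * fk.X p) = 0"
      using t(2) unfolding b(2) m.sum mult_map_T .
    from X_right_independent[OF b(1) this] show "t = 0" unfolding b(2) by (intro sum.neutral) (simp add: T0)
  qed
qed

end

theorem corollary15p2:
  fixes n :: nat
    and scale :: "'k::field \<Rightarrow> 'b::ring_1 \<Rightarrow> 'b"
    and act :: "(nat \<Rightarrow> nat) \<Rightarrow> 'b \<Rightarrow> 'b"
    and deg :: "(nat \<Rightarrow> nat) \<Rightarrow> 'b set"
    and \<Delta> :: "'b \<Rightarrow> ('b \<Rightarrow> 'b \<Rightarrow> 'k) \<Rightarrow> 'k"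
    and \<epsilon> :: "'b \<Rightarrow> 'k"
    and S :: "'b \<Rightarrow> 'b"
    and gr :: "nat \<Rightarrow> 'b set"
    and x :: "(nat \<Rightarrow> real) \<Rightarrow> 'b"
  assumes "n \<ge> 2"
    and "nichols_algebra (sym_group n) scale act deg \<Delta> \<epsilon> S gr"
    and "is_V_W n scale act deg (gr 1) x"
  shows "Vector_Spaces.linear fscale scale (mult_map scale) \<and>
    bij_betw (mult_map scale)
      (tensor_space scale scale (nilcoxeter n scale x) (B_prime n scale x)) UNIV \<and>
    bij_betw (mult_map scale)
      (tensor_space scale scale (B_prime n scale x) (nilcoxeter n scale x)) UNIV"
proof -
  interpret type_A_nichols n scale act deg \<Delta> \<epsilon> S gr x
    using assms(2,3) by (simp add: type_A_nichols_def type_A_nichols_axioms_def)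
  show ?thesis using mult_map_linear tensor_decompositions by blast
qed

end
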